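(* The following conditions are equivalent: (i) The no-arbitrage condition under the efficient friction assumption (NAEF) is satisfied. (ii) There exists a risk-neutral measure. (iii) There exists a risk-neutral measure $\mathbb{Q}$ such that $\mathrm{d}\mathbb{Q}/\mathrm{d}\mathbb{P}\in L^\infty(\Omega,\mathcal{F}_T,\mathbb{P};\mathbb{R})$.
   Context: Fix a time horizon $T\ge 1$, an integer $N\ge 1$ and a filtered probability space $(\Omega,\mathcal{F}_T,\mathbb{F}=(\mathcal{F}_t)_{t=0}^T,\mathbb{P})$. Let $\mathcal{J}^*=\{1,\dots,N\}$. All equalities and inequalities between random variables/processes are $\mathbb{P}$-a.s. and coordinate-wise. $\Delta X_t:=X_t-X_{t-1}$. Market: a savings account with price process $B_t=\prod_{s=0}^t(1+r_s)$, $t=0,\dots,T$, where $r=(r_t)_{t=0}^T$ is a nonnegative adapted process (the risk-free rate); adapted $\mathbb{R}^N$-valued ex-dividend price processes $P^{ask},P^{bid}$ (indexed by $t=0,\dots,T$) and adapted $\mathbb{R}^N$-valued cumulative dividend processes $A^{ask},A^{bid}$ (indexed by $t=1,\dots,T$, with the convention $A^{ask}_0=A^{bid}_0=0$). Standing Bid-Ask Assumption: $P^{ask}\ge P^{bid}$ and $\Delta A^{ask}\le\Delta A^{bid}$. Discounted processes: $P^{ask,*}=B^{-1}P^{ask}$, $P^{bid,*}=B^{-1}P^{bid}$, $A^{ask,*}=B^{-1}\Delta A^{ask}$, $A^{bid,*}=B^{-1}\Delta A^{bid}$. A trading strategy is an $\mathbb{R}^{N+1}$-valued predictable process $\phi=(\phi^0_t,\phi^1_t,\dots,\phi^N_t)_{t=1}^T$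 ($\phi_t$ is $\mathcal{F}_{t-1}$-measurable), with convention $\phi_0=0$. Its value process is $V_0(\phi)=\phi^0_1+\sum_{j=1}^N\phi^j_1(1_{\{\phi^j_1\ge0\}}P^{ask,j}_0+1_{\{\phi^j_1<0\}}P^{bid,j}_0)$ and, for $1\le t\le T$, $V_t(\phi)=\phi^0_tB_t+\sum_{j=1}^N\phi^j_t(1_{\{\phi^j_t\ge0\}}P^{bid,j}_t+1_{\{\phi^j_t<0\}}P^{ask,j}_t)+\sum_{j=1}^N\phi^j_t(1_{\{\phi^j_t\ge0\}}\Delta A^{ask,j}_t+1_{\{\phi^j_t<0\}}\Delta A^{bid,j}_t)$. Set $V^*(\phi)=B^{-1}V(\phi)$. $\phi$ is self-financing if for $t=1,\dots,T-1$: $B_t\Delta\phi^0_{t+1}+\sum_{j=1}^N\Delta\phi^j_{t+1}(1_{\{\Delta\phi^j_{t+1}\ge0\}}P^{ask,j}_t+1_{\{\Delta\phi^j_{t+1}<0\}}P^{bid,j}_t)=\sum_{j=1}^N\phi^j_t(1_{\{\phi^j_t\ge0\}}\Delta A^{ask,j}_t+1_{\{\phi^j_t<0\}}\Delta A^{bid,j}_t)$. $\mathcal{S}$ is the set of self-financing trading strategies. The no-arbitrage condition (NA): for each $\phi\in\mathcal{S}$ with $V_0(\phi)=0$ and $V_T(\phi)\ge0$, one has $V_T(\phi)=0$. The efficient friction assumption (EF): $\{\phi\in\mathcal{S}:V_0(\phi)=V_T(\phi)=0\}=\{0\}$. NAEF denotes the no-arbitrage condition under the efficient friction assumption, i.e.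 NA and EF both hold. $\mathcal{Z}$ is the set of probability measures $\mathbb{Q}$ with $\mathbb{Q}\sim\mathbb{P}$ such that $P^{ask,*},P^{bid,*},A^{ask,*},A^{bid,*}$ are $\mathbb{Q}$-integrable. A risk-neutral measure is a $\mathbb{Q}\in\mathcal{Z}$ with $\mathbb{E}_{\mathbb{Q}}[V^*_T(\phi)]\le0$ for all $\phi\in\mathcal{S}$ such that $\phi^j$ is a.s. bounded for every $j\in\mathcal{J}^*$ and $V_0(\phi)=0$.
   Formalization: The efficient friction assumption (EF) is taken as a standing hypothesis: without it (ii) does not imply (i), e.g. one frictionless security of constant price 1 with r = 0. The expectation of V*_T under a risk-neutral measure is required to exist. *)

theory Defs
  imports "HOL-Probability.Probability"
begin

text \<open>
  The savings account is indexed by 0 and the \<open>N\<close> securities by the finite type \<open>'n\<close>, so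
  \<open>N = CARD('n) \<ge> 1\<close>. Dividend processes are cumulative.
\<close>

record ('a, 'n) market =
  rate :: "nat \<Rightarrow> 'a \<Rightarrow> real"
  Pask :: "nat \<Rightarrow> 'a \<Rightarrow> real ^ 'n"
  Pbid :: "nat \<Rightarrow> 'a \<Rightarrow> real ^ 'n"
  Aask :: "nat \<Rightarrow> 'a \<Rightarrow> real ^ 'n"
  Abid :: "nat \<Rightarrow> 'a \<Rightarrow> real ^ 'n"

text \<open>At \<open>t = 0\<close> this is the junk value \<open>0\<close>; increments are only used for \<open>t \<ge> 1\<close>.\<close>

definition increment :: "(nat \<Rightarrow> 'a \<Rightarrow> 'b::ab_group_add) \<Rightarrow> nat \<Rightarrow> 'a \<Rightarrow> 'b" where
  "increment Y t \<omega> = Y t \<omega> - Y (t - 1) \<omega>"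

definition savings :: "('a, 'n::finite) market \<Rightarrow> nat \<Rightarrow> 'a \<Rightarrow> real" where
  "savings X t \<omega> = (\<Prod>s\<le>t. 1 + rate X s \<omega>)"

text \<open>
  The measure \<open>M\<close> is the reference probability on \<open>F\<^sub>T\<close>; only the \<open>\<sigma>\<close>-algebras of the \<open>F t\<close> with
  \<open>t \<le> T\<close> play a role (a finite filtration extends to all of \<open>nat\<close> by \<open>F t = F T\<close> for \<open>t > T\<close>).
  The order on \<open>real ^ 'n\<close> is the coordinate-wise one.
\<close>

locale bid_ask_market = prob_space M + filtration "space M" F
  for M :: "'a measure" and F :: "nat \<Rightarrow> 'a measure" +
  fixes T :: nat and X :: "('a, 'n::finite) market"
  assumes horizon: "T \<ge> 1"
    and sets_horizon: "sets (F T) = sets M"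
    and rate_adapted: "\<And>t. t \<le> T \<Longrightarrow> rate X t \<in> borel_measurable (F t)"
    and rate_nonneg: "\<And>t. t \<le> T \<Longrightarrow> AE \<omega> in M. 0 \<le> rate X t \<omega>"
    and Pask_adapted: "\<And>t. t \<le> T \<Longrightarrow> Pask X t \<in> borel_measurable (F t)"
    and Pbid_adapted: "\<And>t. t \<le> T \<Longrightarrow> Pbid X t \<in> borel_measurable (F t)"
    and Aask_adapted: "\<And>t. 1 \<le> t \<Longrightarrow> t \<le> T \<Longrightarrow> Aask X t \<in> borel_measurable (F t)"
    and Abid_adapted: "\<And>t. 1 \<le> t \<Longrightarrow> t \<le> T \<Longrightarrow> Abid X t \<in> borel_measurable (F t)"
    and Aask_0: "\<And>\<omega>. \<omega> \<in> space M \<Longrightarrow> Aask X 0 \<omega> = 0"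
    and Abid_0: "\<And>\<omega>. \<omega> \<in> space M \<Longrightarrow> Abid X 0 \<omega> = 0"
    and price_spread: "\<And>t. t \<le> T \<Longrightarrow> AE \<omega> in M. Pbid X t \<omega> \<le> Pask X t \<omega>"
    and dividend_spread: "\<And>t. 1 \<le> t \<Longrightarrow> t \<le> T \<Longrightarrow>
      AE \<omega> in M. increment (Aask X) t \<omega> \<le> increment (Abid X) t \<omega>"

text \<open>
  A strategy takes values in \<open>real \<times> real ^ 'n\<close>, i.e. in dimension \<open>N + 1\<close>: the first component
  is the position \<open>\<phi>\<^sup>0\<close> in the savings account.
\<close>

type_synonym ('a, 'n) strategy = "nat \<Rightarrow> 'a \<Rightarrow> real \<times> (real ^ 'n)"

definition trading_strategy ::
    "'a measure \<Rightarrow> (nat \<Rightarrow> 'a measure) \<Rightarrow> nat \<Rightarrow> ('a, 'n::finite) strategy \<Rightarrow> bool" where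
  "trading_strategy M F T \<phi> \<longleftrightarrow>
    (\<forall>t\<in>{1..T}. \<phi> t \<in> borel_measurable (F (t - 1))) \<and> (\<forall>\<omega>\<in>space M. \<phi> 0 \<omega> = 0)"

text \<open>\<open>\<Sum>\<^sub>j h\<^sup>j (1\<^bsub>{h\<^sup>j \<ge> 0}\<^esub> p\<^sup>j + 1\<^bsub>{h\<^sup>j < 0}\<^esub> q\<^sup>j)\<close>\<close>

definition two_sided :: "real ^ 'n::finite \<Rightarrow> real ^ 'n \<Rightarrow> real ^ 'n \<Rightarrow> real" where
  "two_sided h p q = (\<Sum>j\<in>UNIV. h $ j * (if h $ j \<ge> 0 then p $ j else q $ j))"

definition dividend_flow ::
    "('a, 'n::finite) market \<Rightarrow> ('a, 'n) strategy \<Rightarrow> nat \<Rightarrow> 'a \<Rightarrow> real" where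
  "dividend_flow X \<phi> t \<omega> =
    two_sided (snd (\<phi> t \<omega>)) (increment (Aask X) t \<omega>) (increment (Abid X) t \<omega>)"

text \<open>
  Set-up cost at time \<open>0\<close> (buy at ask, sell at bid; one unit of the savings account is charged 1,
  not \<open>B\<^sub>0\<close>), liquidation value including the current dividends at times \<open>t \<ge> 1\<close>.
\<close>

definition wealth ::
    "('a, 'n::finite) market \<Rightarrow> ('a, 'n) strategy \<Rightarrow> nat \<Rightarrow> 'a \<Rightarrow> real" where
  "wealth X \<phi> t \<omega> =
    (if t = 0 then fst (\<phi> 1 \<omega>) + two_sided (snd (\<phi> 1 \<omega>)) (Pask X 0 \<omega>) (Pbid X 0 \<omega>)
     else fst (\<phi> t \<omega>) * savings X t \<omega> + two_sided (snd (\<phi> t \<omega>)) (Pbid X t \<omega>) (Pask X t \<omega>)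
       + dividend_flow X \<phi> t \<omega>)"

definition discounted_wealth ::
    "('a, 'n::finite) market \<Rightarrow> ('a, 'n) strategy \<Rightarrow> nat \<Rightarrow> 'a \<Rightarrow> real" where
  "discounted_wealth X \<phi> t \<omega> = wealth X \<phi> t \<omega> / savings X t \<omega>"

definition self_financing ::
    "'a measure \<Rightarrow> nat \<Rightarrow> ('a, 'n::finite) market \<Rightarrow> ('a, 'n) strategy \<Rightarrow> bool" where
  "self_financing M T X \<phi> \<longleftrightarrow>
    (\<forall>t\<in>{1..T - 1}. AE \<omega> in M.
      savings X t \<omega> * fst (increment \<phi> (t + 1) \<omega>)
        + two_sided (snd (increment \<phi> (t + 1) \<omega>)) (Pask X t \<omega>) (Pbid X t \<omega>)
      = dividend_flow X \<phi> t \<omega>)"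

definition SF :: "'a measure \<Rightarrow> (nat \<Rightarrow> 'a measure) \<Rightarrow> nat \<Rightarrow> ('a, 'n::finite) market
    \<Rightarrow> ('a, 'n) strategy set" where
  "SF M F T X = {\<phi>. trading_strategy M F T \<phi> \<and> self_financing M T X \<phi>}"

definition no_arbitrage ::
    "'a measure \<Rightarrow> (nat \<Rightarrow> 'a measure) \<Rightarrow> nat \<Rightarrow> ('a, 'n::finite) market \<Rightarrow> bool" where
  "no_arbitrage M F T X \<longleftrightarrow>
    (\<forall>\<phi>\<in>SF M F T X. (AE \<omega> in M. wealth X \<phi> 0 \<omega> = 0) \<longrightarrow> (AE \<omega> in M. 0 \<le> wealth X \<phi> T \<omega>) \<longrightarrow>
      (AE \<omega> in M. wealth X \<phi> T \<omega> = 0))"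

text \<open>
  This is \<open>{\<phi> \<in> S. V\<^sub>0(\<phi>) = V\<^sub>T(\<phi>) = 0} = {0}\<close>, processes being identified up to null sets;
  the zero strategy always belongs to the left-hand side. A risk-neutral measure does not entail
  efficient friction: with one security of constant price \<open>1\<close>, no dividends, no spread and \<open>r = 0\<close>,
  the wealth at times 0 and \<open>T = 1\<close> coincides, so \<open>M\<close> is risk neutral, but \<open>\<phi> = (-1, 1)\<close>
  violates the condition. Hence results deducing NAEF from the existence of such a
  measure need efficient friction as a standing assumption.
\<close>

definition efficient_friction ::
    "'a measure \<Rightarrow> (nat \<Rightarrow> 'a measure) \<Rightarrow> nat \<Rightarrow> ('a, 'n::finite) market \<Rightarrow> bool" where
  "efficient_friction M F T X \<longleftrightarrow>
    (\<forall>\<phi>\<in>SF M F T X. (AE \<omega> in M. wealth X \<phi> 0 \<omega> = 0) \<longrightarrow> (AE \<omega> in M. wealth X \<phi> T \<omega> = 0) \<longrightarrow>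
      (\<forall>t\<in>{1..T}. AE \<omega> in M. \<phi> t \<omega> = 0))"

definition NAEF ::
    "'a measure \<Rightarrow> (nat \<Rightarrow> 'a measure) \<Rightarrow> nat \<Rightarrow> ('a, 'n::finite) market \<Rightarrow> bool" where
  "NAEF M F T X \<longleftrightarrow> no_arbitrage M F T X \<and> efficient_friction M F T X"

definition equivalent_integrable_measures ::
    "'a measure \<Rightarrow> nat \<Rightarrow> ('a, 'n::finite) market \<Rightarrow> 'a measure set" where
  "equivalent_integrable_measures M T X = {Q.
    prob_space Q \<and> sets Q = sets M \<and> absolutely_continuous M Q \<and> absolutely_continuous Q M \<and>
    (\<forall>t\<le>T. integrable Q (\<lambda>\<omega>. Pask X t \<omega> /\<^sub>R savings X t \<omega>) \<and>
           integrable Q (\<lambda>\<omega>. Pbid X t \<omega> /\<^sub>R savings X t \<omega>)) \<and>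
    (\<forall>t\<in>{1..T}. integrable Q (\<lambda>\<omega>. increment (Aask X) t \<omega> /\<^sub>R savings X t \<omega>) \<and>
           integrable Q (\<lambda>\<omega>. increment (Abid X) t \<omega> /\<^sub>R savings X t \<omega>))}"

text \<open>
  Only the positions in the securities are required to be bounded. Since the Bochner integral of
  a non-integrable function is \<open>0\<close>, the existence of the expectation is stated explicitly. It holds
  automatically whenever the undiscounted prices at time \<open>0\<close> are \<open>Q\<close>-integrable, e.g. if \<open>r\<^sub>0\<close> is
  bounded.
\<close>

definition risk_neutral :: "'a measure \<Rightarrow> (nat \<Rightarrow> 'a measure) \<Rightarrow> nat \<Rightarrow> ('a, 'n::finite) market
    \<Rightarrow> 'a measure \<Rightarrow> bool" where
  "risk_neutral M F T X Q \<longleftrightarrow>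
    Q \<in> equivalent_integrable_measures M T X \<and>
    (\<forall>\<phi>\<in>SF M F T X.
      (\<forall>j. \<exists>C. \<forall>t\<in>{1..T}. AE \<omega> in M. \<bar>snd (\<phi> t \<omega>) $ j\<bar> \<le> C) \<longrightarrow>
      (AE \<omega> in M. wealth X \<phi> 0 \<omega> = 0) \<longrightarrow>
      integrable Q (discounted_wealth X \<phi> T) \<and> (\<integral>\<omega>. discounted_wealth X \<phi> T \<omega> \<partial>Q) \<le> 0)"

definition bounded_density :: "'a measure \<Rightarrow> 'a measure \<Rightarrow> bool" where
  "bounded_density M Q \<longleftrightarrow> (\<exists>C::real. AE \<omega> in M. RN_deriv M Q \<omega> \<le> ennreal C)"

end

theory Submission
  imports Defs
begin

text \<open>
  The discounted terminal wealth of a self-financing strategy with zero initial cost is a superlinear,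
  Lipschitz function of the positions in the securities, and these may be prescribed freely.

  Given a risk-neutral measure and a strategy with nonnegative terminal wealth, liquidating before
  the positions exceed suitable thresholds yields bounded strategies. Their expected
  wealth is nonpositive and exceeds, up to an arbitrarily small error, the expectation of the original
  wealth on the event of small positions. Hence that wealth vanishes.

  Conversely, rescale the gains to have Lipschitz constant 1. If only the zero strategy has a
  nonnegative gain, then strategies with gains bounded below are almost surely bounded: otherwise
  suitably normalised strategies would have convex combinations converging to a nonzero strategy with
  nonnegative gain. For the utility \<open>u x = x - sqrt (1 + x\<^sup>2)\<close>, strict concavity makes the gains along a
  maximising sequence converge, so that the strategies are bounded and have convex combinations
  converging to a maximiser. The first-order condition says that \<open>u'\<close>, evaluated at the optimal gain,
  is up to normalisation the density of a risk-neutral measure. It is positive and bounded since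
  \<open>0 < u' < 2\<close>.
\<close>

section \<open>Convergence of convex combinations\<close>

text \<open>No arbitrage and efficient friction together leave only the zero strategy with
  nonnegative gain; this acts like a trivial recession cone and gives boundedness. Maximising a
  utility replaces a separation theorem and exhibits the density. Three properties guide the choice
  of \<open>u\<close>: it is bounded above, so that Fatou's lemma controls limits although the gains
  have no common integrable bound; it is strictly increasing, which makes the density positive; its
  slope is bounded, which makes the density bounded. The market gain is Lipschitz only with a random
  constant. It is first multiplied by an almost surely positive random weight, which preserves the
  sign of gains; as a factor of the density, the same weight makes all prices integrable.\<close>

definition tail_weights :: "nat \<Rightarrow> (nat \<Rightarrow> real) set" where
  "tail_weights k = {c. (\<forall>n. 0 \<le> c n) \<and> (\<forall>n<k. c n = 0) \<and> finite {n. c n \<noteq> 0}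
    \<and> (\<Sum>n | c n \<noteq> 0. c n) = 1}"

text \<open>The weights do not depend on the scenario, so combinations of predictable strategies
  stay predictable. As they vanish below \<open>k\<close>, a bound valid for late indices passes to
  the combinations.\<close>

definition combination :: "(nat \<Rightarrow> real) \<Rightarrow> (nat \<Rightarrow> 'v::real_vector) \<Rightarrow> 'v" where
  "combination c f = (\<Sum>n | c n \<noteq> 0. c n *\<^sub>R f n)"

section \<open>Finitely supported convex weights\<close>

lemma combination_superset:
  assumes "finite A" "{n. c n \<noteq> 0} \<subseteq> A"
  shows "combination c f = (\<Sum>n\<in>A. c n *\<^sub>R f n)"
  unfolding combination_def by (rule sum.mono_neutral_left) (use assms in auto)

lemma tail_weightsD:
  assumes "c \<in> tail_weights k"
  shows "0 \<le> c n" "n < k \<Longrightarrow> c n = 0" "finite {n. c n \<noteq> 0}" "(\<Sum>n | c n \<noteq> 0. c n) = 1"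
  using assms by (auto simp: tail_weights_def)

lemma tail_weights_antimono: "k \<le> l \<Longrightarrow> tail_weights l \<subseteq> tail_weights k"
  by (auto simp: tail_weights_def)

lemma tail_weights_nonempty: "tail_weights k \<noteq> {}"
proof -
  have "(\<lambda>n. if n = k then 1 else 0) \<in> tail_weights k"
    by (auto simp: tail_weights_def)
  then show ?thesis by blast
qed

lemma tail_weights_midpoint:
  assumes c: "c \<in> tail_weights k" and d: "d \<in> tail_weights k"
  shows "(\<lambda>n. (c n + d n) / 2) \<in> tail_weights k"
proof -
  let ?A = "{n. c n \<noteq> 0} \<union> {n. d n \<noteq> 0}"
  have fin: "finite ?A" using c d by (auto simp: tail_weights_def)
  have "(\<Sum>n | c n \<noteq> 0. c n) = (\<Sum>n\<in>?A. c n)" "(\<Sum>n | d n \<noteq> 0. d n) = (\<Sum>n\<in>?A. d n)"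
    by (rule sum.mono_neutral_left[OF fin]; auto)+
  then have eq: "(\<Sum>n\<in>?A. c n) = 1" "(\<Sum>n\<in>?A. d n) = 1"
    by (metis tail_weightsD(4)[OF c], metis tail_weightsD(4)[OF d])
  have "(\<Sum>n | (c n + d n) / 2 \<noteq> 0. (c n + d n) / 2) = (\<Sum>n\<in>?A. (c n + d n) / 2)"
    by (rule sum.mono_neutral_left) (use fin in auto)
  also have "\<dots> = (\<Sum>n\<in>?A. c n + d n) / 2"
    by (rule sum_divide_distrib[symmetric])
  also have "\<dots> = 1"
    unfolding sum.distrib eq by simp
  finally have "(\<Sum>n | (c n + d n) / 2 \<noteq> 0. (c n + d n) / 2) = 1" .
  moreover have "finite {n. (c n + d n) / 2 \<noteq> 0}"
    by (rule finite_subset[OF _ fin]) auto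
  ultimately show ?thesis
    using tail_weightsD(1,2)[OF c] tail_weightsD(1,2)[OF d] by (simp add: tail_weights_def)
qed

lemma combination_midpoint:
  assumes "finite {n. c n \<noteq> 0}" "finite {n. d n \<noteq> 0}"
  shows "combination (\<lambda>n. (c n + d n) / 2) f = (1 / 2) *\<^sub>R (combination c f + combination d f)"
proof -
  let ?A = "{n. c n \<noteq> 0} \<union> {n. d n \<noteq> 0}"
  have fin: "finite ?A" using assms by auto
  have "combination (\<lambda>n. (c n + d n) / 2) f = (\<Sum>n\<in>?A. ((c n + d n) / 2) *\<^sub>R f n)"
    by (rule combination_superset[OF fin]) auto
  also have "\<dots> = (\<Sum>n\<in>?A. (1 / 2) *\<^sub>R (c n *\<^sub>R f n + d n *\<^sub>R f n))"
    by (simp flip: scaleR_add_left)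
  also have "\<dots> = (1 / 2) *\<^sub>R (combination c f + combination d f)"
    by (simp add: combination_superset[OF fin] scaleR_sum_right sum.distrib scaleR_add_right)
  finally show ?thesis .
qed

lemma norm_combination_le:
  fixes f :: "nat \<Rightarrow> 'v::real_normed_vector"
  assumes c: "c \<in> tail_weights k" and "\<And>n. norm (f n) \<le> K"
  shows "norm (combination c f) \<le> K"
proof -
  have "norm (combination c f) \<le> (\<Sum>n | c n \<noteq> 0. c n * K)"
    unfolding combination_def
    by (rule sum_norm_le) (use assms tail_weightsD(1)[OF c] in \<open>auto intro!: mult_left_mono\<close>)
  also have "\<dots> = K"
    using tail_weightsD(4)[OF c] by (simp flip: sum_distrib_right)
  finally show ?thesis .
qed

lemma combination_scaleR: "combination c (\<lambda>n. a *\<^sub>R f n) = a *\<^sub>R combination c f"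
  by (simp add: combination_def scaleR_sum_right mult.commute)

lemma borel_measurable_combination[measurable]:
  fixes f :: "nat \<Rightarrow> 'a \<Rightarrow> 'v::{real_normed_vector, second_countable_topology}"
  assumes "\<And>n. f n \<in> borel_measurable N"
  shows "(\<lambda>\<omega>. combination c (\<lambda>n. f n \<omega>)) \<in> borel_measurable N"
  unfolding combination_def using assms by measurable

lemma parallelogram_norm:
  fixes x y :: "'v::real_inner"
  shows "(norm (x - y))\<^sup>2 = 2 * (norm x)\<^sup>2 + 2 * (norm y)\<^sup>2 - 4 * (norm ((1 / 2) *\<^sub>R (x + y)))\<^sup>2"
  by (simp add: power2_norm_eq_inner inner_diff inner_add field_simps inner_commute)

section \<open>From mean-square to almost sure convergence\<close>

text \<open>The elementary bound \<open>x \<le> e / 2 + x\<^sup>2 / (2 * e)\<close> turns square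
  distances into L1 distances, which yield an almost surely Cauchy subsequence. The finitely many
  indices are treated in turn, since further subsequences stay Cauchy.\<close>

lemma (in prob_space) L2_Cauchy_AE_Cauchy_subseq:
  fixes s :: "nat \<Rightarrow> 'i \<Rightarrow> 'a \<Rightarrow> 'v::euclidean_space"
  assumes fin: "finite I"
    and meas: "\<And>n i. i \<in> I \<Longrightarrow> s n i \<in> borel_measurable M"
    and bdd: "\<And>n i. i \<in> I \<Longrightarrow> AE \<omega> in M. norm (s n i \<omega>) \<le> K"
    and Cauchy: "\<And>i e. i \<in> I \<Longrightarrow> e > 0 \<Longrightarrow>
      \<exists>N. \<forall>k\<ge>N. \<forall>l\<ge>N. (\<integral>\<omega>. (norm (s k i \<omega> - s l i \<omega>))\<^sup>2 \<partial>M) < e"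
  obtains r where "strict_mono r" "\<And>i. i \<in> I \<Longrightarrow> AE \<omega> in M. Cauchy (\<lambda>k. s (r k) i \<omega>)"
proof -
  have int2: "integrable M (\<lambda>\<omega>. (norm (s k i \<omega> - s l i \<omega>))\<^sup>2)" if "i \<in> I" for k l i
  proof (rule integrable_const_bound[where B = "(2 * K)\<^sup>2"])
    show "AE \<omega> in M. norm ((norm (s k i \<omega> - s l i \<omega>))\<^sup>2) \<le> (2 * K)\<^sup>2"
      using bdd[OF that, of k] bdd[OF that, of l]
    proof eventually_elim
      case (elim \<omega>)
      have "norm (s k i \<omega> - s l i \<omega>) \<le> 2 * K"
        using elim norm_triangle_ineq4[of "s k i \<omega>" "s l i \<omega>"] by linarith
      then show ?case using power_mono[of "norm (s k i \<omega> - s l i \<omega>)" "2 * K" 2] by simp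
    qed
  qed (use meas[OF that] in measurable)
  have int: "integrable M (s k i)" if "i \<in> I" for k i
    by (rule integrable_const_bound[OF bdd meas]) (use that in auto)
  have L1: "\<exists>N. \<forall>k\<ge>N. \<forall>l\<ge>N. (\<integral>\<omega>. norm (s k i \<omega> - s l i \<omega>) \<partial>M) < e" if "i \<in> I" "e > 0" for i e
  proof -
    obtain N where N: "\<And>k l. k \<ge> N \<Longrightarrow> l \<ge> N \<Longrightarrow> (\<integral>\<omega>. (norm (s k i \<omega> - s l i \<omega>))\<^sup>2 \<partial>M) < e\<^sup>2"
      using Cauchy[OF \<open>i \<in> I\<close>, of "e\<^sup>2"] \<open>e > 0\<close> by auto
    have "(\<integral>\<omega>. norm (s k i \<omega> - s l i \<omega>) \<partial>M) < e" if kl: "k \<ge> N" "l \<ge> N" for k l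
    proof -
      have "(\<integral>\<omega>. norm (s k i \<omega> - s l i \<omega>) \<partial>M)
          \<le> (\<integral>\<omega>. e / 2 + (norm (s k i \<omega> - s l i \<omega>))\<^sup>2 / (2 * e) \<partial>M)"
      proof (rule integral_mono)
        fix \<omega>
        have "0 \<le> (norm (s k i \<omega> - s l i \<omega>) - e)\<^sup>2" by simp
        then show "norm (s k i \<omega> - s l i \<omega>) \<le> e / 2 + (norm (s k i \<omega> - s l i \<omega>))\<^sup>2 / (2 * e)"
          using \<open>e > 0\<close> by (simp add: field_simps power2_eq_square)
      qed (use int int2 \<open>i \<in> I\<close> in auto)
      also have "\<dots> = e / 2 + (\<integral>\<omega>. (norm (s k i \<omega> - s l i \<omega>))\<^sup>2 \<partial>M) / (2 * e)"
        using int2[OF \<open>i \<in> I\<close>] by (simp add: prob_space)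
      also have "\<dots> < e / 2 + e\<^sup>2 / (2 * e)"
        using N[OF kl] \<open>e > 0\<close> by (intro add_strict_left_mono divide_strict_right_mono) auto
      also have "\<dots> = e" using \<open>e > 0\<close> by (simp add: power2_eq_square)
      finally show ?thesis .
    qed
    then show ?thesis by blast
  qed
  have "\<exists>r. strict_mono r \<and> (\<forall>i\<in>I. AE \<omega> in M. Cauchy (\<lambda>k. s (r k) i \<omega>))"
    using fin int L1
  proof (induction I)
    case empty
    show ?case using strict_mono_id by auto
  next
    case (insert j J)
    have "\<exists>r. strict_mono r \<and> (\<forall>i\<in>J. AE \<omega> in M. Cauchy (\<lambda>k. s (r k) i \<omega>))"
      by (rule insert.IH) (use insert.prems in auto)
    then obtain r where r: "strict_mono r" "\<And>i. i \<in> J \<Longrightarrow> AE \<omega> in M. Cauchy (\<lambda>k. s (r k) i \<omega>)"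
      by blast
    obtain r' where r': "strict_mono r'" "AE \<omega> in M. Cauchy (\<lambda>k. s (r (r' k)) j \<omega>)"
    proof (rule cauchy_L1_AE_cauchy_subseq[of M "\<lambda>k. s (r k) j"])
      show "integrable M (s (r n) j)" for n using insert.prems(1) by auto
      fix e :: real assume "e > 0"
      then obtain N where "\<forall>k\<ge>N. \<forall>l\<ge>N. (\<integral>\<omega>. norm (s k j \<omega> - s l j \<omega>) \<partial>M) < e"
        using insert.prems(2) by blast
      then show "\<exists>N. \<forall>k\<ge>N. \<forall>l\<ge>N. (\<integral>\<omega>. norm (s (r k) j \<omega> - s (r l) j \<omega>) \<partial>M) < e"
        using seq_suble[OF r(1)] by (meson order_trans)
    qed auto
    have "AE \<omega> in M. Cauchy (\<lambda>k. s (r (r' k)) i \<omega>)" if "i \<in> J" for i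
      using r(2)[OF that] by eventually_elim
        (use Cauchy_subseq_Cauchy[OF _ r'(1)] in \<open>fastforce simp: o_def\<close>)
    then show ?case
      using r' strict_mono_o[OF r(1) r'(1)] by (intro exI[of _ "r \<circ> r'"]) (auto simp: o_def)
  qed
  then show thesis using that by blast
qed

text \<open>
  After multiplication by a strictly positive weight the sequence is bounded by 1, and
  near-minimisers of the \<open>L\<^sup>2\<close> norm over the convex hulls of its tails form an \<open>L\<^sup>2\<close>-Cauchy sequence.
\<close>

lemma (in prob_space) AE_convergent_combinations:
  fixes f :: "nat \<Rightarrow> 'i \<Rightarrow> 'a \<Rightarrow> 'v::euclidean_space"
  assumes fin: "finite I"
    and meas: "\<And>n i. i \<in> I \<Longrightarrow> f n i \<in> borel_measurable M"
    and bdd: "\<And>i. i \<in> I \<Longrightarrow> AE \<omega> in M. bounded (range (\<lambda>n. f n i \<omega>))"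
  obtains c where "\<And>k. c k \<in> tail_weights k"
    "\<And>i. i \<in> I \<Longrightarrow> AE \<omega> in M. convergent (\<lambda>k. combination (c k) (\<lambda>n. f n i \<omega>))"
proof -
  define S where "S i \<omega> = (SUP n. ennreal (norm (f n i \<omega>)))" for i \<omega>
  \<comment> \<open>The supremum \<open>S\<close> is infinite at most on a null set; the value 0
    there makes \<open>g\<close> vanish, so that its bound by 1 holds everywhere.\<close>
  define w where "w i \<omega> = (if S i \<omega> = \<top> then 0 else 1 / (1 + enn2real (S i \<omega>)))" for i \<omega>
  define g where "g n i \<omega> = w i \<omega> *\<^sub>R f n i \<omega>" for n i \<omega>
  have S_meas: "S i \<in> borel_measurable M" if "i \<in> I" for i
    unfolding S_def using meas[OF that] by measurable
  have w_meas: "w i \<in> borel_measurable M" if "i \<in> I" for i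
    unfolding w_def using S_meas[OF that] by measurable
  have g_meas: "g n i \<in> borel_measurable M" if "i \<in> I" for n i
    unfolding g_def using meas[OF that] w_meas[OF that] by measurable
  have g_le: "norm (g n i \<omega>) \<le> 1" for n i \<omega>
  proof (cases "S i \<omega> = \<top>")
    case False
    have "ennreal (norm (f n i \<omega>)) \<le> S i \<omega>" unfolding S_def by (rule SUP_upper) simp
    then have "norm (f n i \<omega>) \<le> enn2real (S i \<omega>)"
      using False by (metis enn2real_ennreal enn2real_mono norm_ge_zero top.not_eq_extremum)
    moreover have "0 < 1 + enn2real (S i \<omega>)" by (simp add: add_pos_nonneg)
    ultimately show ?thesis using False by (simp add: g_def w_def pos_divide_le_eq)
  qed (simp add: g_def w_def)
  have w_pos: "AE \<omega> in M. w i \<omega> > 0" if "i \<in> I" for i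
    using bdd[OF that]
  proof eventually_elim
    case (elim \<omega>)
    then obtain K where "\<And>n. norm (f n i \<omega>) \<le> K" by (auto simp: bounded_iff)
    then have "S i \<omega> \<le> ennreal K" unfolding S_def by (intro SUP_least ennreal_leI)
    then have "S i \<omega> \<noteq> \<top>" by (auto simp: top_unique)
    then show ?case by (simp add: w_def add_pos_nonneg)
  qed
  define q where "q c = (\<integral>\<omega>. (\<Sum>i\<in>I. (norm (combination c (\<lambda>n. g n i \<omega>)))\<^sup>2) \<partial>M)" for c
  have sq_le: "(norm (combination c (\<lambda>n. g n i \<omega>)))\<^sup>2 \<le> 1" if "c \<in> tail_weights k" for c k i \<omega>
    using norm_combination_le[OF that g_le] by (simp add: power_le_one)
  have q_int: "integrable M (\<lambda>\<omega>. (norm (combination c (\<lambda>n. g n i \<omega>)))\<^sup>2)"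
    if "c \<in> tail_weights k" "i \<in> I" for c k i
    by (rule integrable_const_bound[where B = 1])
       (use sq_le[OF that(1)] g_meas[OF that(2)] in \<open>auto intro!: borel_measurable_combination\<close>)
  have q_ge: "0 \<le> q c" for c
    unfolding q_def by (intro integral_nonneg_AE) (auto intro!: sum_nonneg)
  have q_le: "q c \<le> card I" if "c \<in> tail_weights k" for c k
  proof -
    have "q c \<le> (\<integral>\<omega>. (\<Sum>i\<in>I. 1) \<partial>M)"
      unfolding q_def by (intro integral_mono sum_mono sq_le[OF that]) (use q_int that in auto)
    then show ?thesis by (simp add: prob_space)
  qed
  \<comment> \<open>The hulls shrink as \<open>k\<close> grows, so the infima increase; being at
    most \<open>card I\<close>, they converge.\<close>
  define m where "m k = Inf (q ` tail_weights k)" for k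
  have m_le: "m k \<le> q c" if "c \<in> tail_weights k" for c k
    unfolding m_def by (rule cInf_lower) (use that q_ge in \<open>auto intro!: bdd_belowI[of _ 0]\<close>)
  have m_mono: "incseq m"
    unfolding m_def incseq_def
    by (auto intro!: cInf_superset_mono bdd_belowI[of _ 0] q_ge image_mono tail_weights_antimono
        simp: tail_weights_nonempty)
  have "\<exists>c\<in>tail_weights k. q c < m k + 1 / (real k + 1)" for k
  proof -
    have "Inf (q ` tail_weights k) < m k + 1 / (real k + 1)" by (simp add: m_def)
    then show ?thesis
      using cInf_lessD[of "q ` tail_weights k"] tail_weights_nonempty[of k] by blast
  qed
  then obtain c where c: "\<And>k. c k \<in> tail_weights k" "\<And>k. q (c k) < m k + 1 / (real k + 1)"
    by metis
  have "m k \<le> card I" for k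
    using m_le[OF c(1)] q_le[OF c(1)] order_trans by blast
  then obtain L where "m \<longlonglongrightarrow> L"
    using incseq_convergent[OF m_mono] by blast
  then have "convergent m" by (rule convergentI)
  then have m_Cauchy: "Cauchy m" by (rule convergent_Cauchy)
  define s where "s k i \<omega> = combination (c k) (\<lambda>n. g n i \<omega>)" for k i \<omega>
  have s_meas: "s k i \<in> borel_measurable M" if "i \<in> I" for k i
    unfolding s_def using g_meas[OF that] by (intro borel_measurable_combination)
  have s_Cauchy: "\<exists>N. \<forall>k\<ge>N. \<forall>l\<ge>N. (\<integral>\<omega>. (norm (s k i \<omega> - s l i \<omega>))\<^sup>2 \<partial>M) < e"
    if "i \<in> I" "e > 0" for i e
  proof -
    obtain N1 where N1: "\<And>k l. k \<ge> N1 \<Longrightarrow> l \<ge> N1 \<Longrightarrow> \<bar>m k - m l\<bar> < e / 8"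
      using m_Cauchy \<open>e > 0\<close> unfolding Cauchy_def dist_real_def by (metis zero_less_divide_iff zero_less_numeral)
    obtain N2 :: nat where N2: "1 / (real N2 + 1) < e / 8"
      using nat_approx_posE[of "e / 8"] \<open>e > 0\<close> by (auto simp: add.commute)
    define N where "N = max N1 N2"
    have "(\<integral>\<omega>. (norm (s k i \<omega> - s l i \<omega>))\<^sup>2 \<partial>M) < e" if kl: "k \<ge> N" "l \<ge> N" for k l
    proof -
      have ck: "c k \<in> tail_weights N" "c l \<in> tail_weights N"
        using c(1) tail_weights_antimono kl by blast+
      \<comment> \<open>The midpoint stays in the hull of the tail from \<open>N\<close>, hence
        \<open>q d \<ge> m N\<close>, while \<open>q (c k)\<close> and \<open>q (c l)\<close> are
        below \<open>m N + e / 4\<close>: one half of \<open>e / 4\<close> pays for the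
        approximation error of \<open>c\<close>, the other for the variation of \<open>m\<close>.
        The parallelogram law then leaves less than \<open>e\<close>.\<close>
      define d where "d n = (c k n + c l n) / 2" for n
      have d: "d \<in> tail_weights N"
        unfolding d_def by (rule tail_weights_midpoint[OF ck])
      have d_eq: "combination d f = (1 / 2) *\<^sub>R (combination (c k) f + combination (c l) f)" for f :: "nat \<Rightarrow> 'v"
        unfolding d_def using ck by (intro combination_midpoint tail_weightsD(3))
      have q_small: "q (c j) < m N + e / 4" if "j \<ge> N" for j
      proof -
        have "1 / (real j + 1) \<le> 1 / (real N2 + 1)"
          using that by (intro divide_left_mono) (auto simp: N_def)
        moreover have "m j < m N + e / 8"
          using N1[of j N] that unfolding N_def by linarith
        ultimately show ?thesis using c(2)[of j] N2 by linarith
      qed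
      have eq: "(norm (s k i \<omega> - s l i \<omega>))\<^sup>2 = 2 * (norm (combination (c k) (\<lambda>n. g n i \<omega>)))\<^sup>2
          + 2 * (norm (combination (c l) (\<lambda>n. g n i \<omega>)))\<^sup>2
          - 4 * (norm (combination d (\<lambda>n. g n i \<omega>)))\<^sup>2" for i \<omega>
        unfolding s_def d_eq by (rule parallelogram_norm)
      have int: "integrable M (\<lambda>\<omega>. (norm (s k i \<omega> - s l i \<omega>))\<^sup>2)" if "i \<in> I" for i
        unfolding eq using that q_int[OF ck(1)] q_int[OF ck(2)] q_int[OF d] by auto
      have "(\<integral>\<omega>. (norm (s k i \<omega> - s l i \<omega>))\<^sup>2 \<partial>M)
          \<le> (\<integral>\<omega>. (\<Sum>i\<in>I. (norm (s k i \<omega> - s l i \<omega>))\<^sup>2) \<partial>M)"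
        using int fin \<open>i \<in> I\<close> by (intro integral_mono) (auto intro: member_le_sum)
      also have "\<dots> = 2 * q (c k) + 2 * q (c l) - 4 * q d"
        unfolding eq q_def
        using q_int[OF ck(1)] q_int[OF ck(2)] q_int[OF d]
        by (simp add: sum.distrib sum_subtractf flip: sum_distrib_left)
      also have "\<dots> < e"
        using q_small[OF kl(1)] q_small[OF kl(2)] m_le[OF d] by linarith
      finally show ?thesis .
    qed
    then show ?thesis by blast
  qed
  obtain r where r: "strict_mono r" "\<And>i. i \<in> I \<Longrightarrow> AE \<omega> in M. Cauchy (\<lambda>k. s (r k) i \<omega>)"
  proof (rule L2_Cauchy_AE_Cauchy_subseq[OF fin s_meas _ s_Cauchy])
    show "AE \<omega> in M. norm (s k i \<omega>) \<le> 1" for k i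
      unfolding s_def using norm_combination_le[OF c(1) g_le] by simp
  qed auto
  show thesis
  proof (rule that)
    show "c (r k) \<in> tail_weights k" for k
      using c(1) tail_weights_antimono[OF seq_suble[OF r(1)]] by blast
    fix i assume i: "i \<in> I"
    show "AE \<omega> in M. convergent (\<lambda>k. combination (c (r k)) (\<lambda>n. f n i \<omega>))"
      using r(2)[OF i] w_pos[OF i]
    proof eventually_elim
      case (elim \<omega>)
      obtain L where "(\<lambda>k. s (r k) i \<omega>) \<longlonglongrightarrow> L"
        using elim(1) unfolding Cauchy_convergent_iff convergent_def by blast
      then have "convergent (\<lambda>k. (1 / w i \<omega>) *\<^sub>R s (r k) i \<omega>)"
        by (rule convergentI[OF tendsto_scaleR[OF tendsto_const]])
      moreover have "(1 / w i \<omega>) *\<^sub>R s (r k) i \<omega> = combination (c (r k)) (\<lambda>n. f n i \<omega>)" for k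
        using elim(2) by (simp add: s_def g_def combination_scaleR)
      ultimately show ?case by simp
    qed
  qed
qed

section \<open>Superlinear gains without arbitrage\<close>

definition predictable ::
    "(nat \<Rightarrow> 'a measure) \<Rightarrow> nat \<Rightarrow> (nat \<Rightarrow> 'a \<Rightarrow> 'v::topological_space) \<Rightarrow> bool" where
  "predictable F T h \<longleftrightarrow> (\<forall>t\<in>{1..T}. h t \<in> borel_measurable (F (t - 1)))"

lemma predictableD: "predictable F T h \<Longrightarrow> t \<in> {1..T} \<Longrightarrow> h t \<in> borel_measurable (F (t - 1))"
  by (simp add: predictable_def)

lemma measurable_mono_sets:
  assumes "f \<in> measurable N L" "space N = space N'" "sets N \<subseteq> sets N'"
  shows "f \<in> measurable N' L"
  using assms by (auto simp: measurable_def)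

text \<open>The norm is at most the sum of the absolute coordinates, so the largest of these is at
  least the average. Thus finitely many directions detect unboundedness, each through a component of
  fixed sign.\<close>

lemma ex_signed_Basis_inner_ge:
  fixes v :: "'v::euclidean_space"
  shows "\<exists>b\<in>Basis \<union> uminus ` Basis. norm v / DIM('v) \<le> v \<bullet> b"
proof (rule ccontr)
  assume "\<not> ?thesis"
  then have less: "v \<bullet> b < norm v / DIM('v)" "v \<bullet> (- b) < norm v / DIM('v)" if "b \<in> Basis" for b
    using that by (auto simp: not_le simp del: inner_minus_right)
  have "norm v \<le> (\<Sum>b\<in>Basis. \<bar>v \<bullet> b\<bar>)" by (rule norm_le_l1)
  also have "\<dots> < (\<Sum>b\<in>(Basis :: 'v set). norm v / DIM('v))"
  proof (rule sum_strict_mono)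
    show "\<bar>v \<bullet> b\<bar> < norm v / DIM('v)" if "b \<in> Basis" for b
      using less[OF that] by (simp add: abs_less_iff)
  qed auto
  also have "\<dots> = norm v" by simp
  finally show False by simp
qed

lemma combination_ge:
  assumes c: "c \<in> tail_weights k" and "\<And>n. n \<ge> k \<Longrightarrow> a \<le> f n"
  shows "a \<le> combination c (f :: nat \<Rightarrow> real)"
proof -
  have "a = (\<Sum>n | c n \<noteq> 0. c n * a)"
    using tail_weightsD(4)[OF c] by (simp flip: sum_distrib_right)
  also have "\<dots> \<le> (\<Sum>n | c n \<noteq> 0. c n * f n)"
  proof (rule sum_mono)
    fix n assume "n \<in> {n. c n \<noteq> 0}"
    then have "n \<ge> k" using tail_weightsD(2)[OF c] by (metis mem_Collect_eq not_le)
    then show "c n * a \<le> c n * f n"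
      using assms tail_weightsD(1)[OF c] by (intro mult_left_mono) auto
  qed
  finally show ?thesis by (simp add: combination_def)
qed

text \<open>An abstract form of the weighted market gain. \<open>nonneg_gain_zero\<close> condenses
  no arbitrage and efficient friction into one condition. The pathwise axioms are demanded in every
  scenario; in the application the gain is set to 0 on the exceptional ones.\<close>

locale superlinear_gain = prob_space M + filtration "space M" F
  for M :: "'a measure" and F :: "nat \<Rightarrow> 'a measure" +
  fixes T :: nat and g :: "'a \<Rightarrow> (nat \<Rightarrow> 'v::euclidean_space) \<Rightarrow> real"
  assumes sets_F: "\<And>t. t \<le> T \<Longrightarrow> sets (F t) \<subseteq> sets M"
    and gain_measurable: "\<And>h. predictable F T h \<Longrightarrow> (\<lambda>\<omega>. g \<omega> (\<lambda>t. h t \<omega>)) \<in> borel_measurable M"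
    and gain_scale: "\<And>\<omega> a x. \<omega> \<in> space M \<Longrightarrow> 0 \<le> a \<Longrightarrow> g \<omega> (\<lambda>t. a *\<^sub>R x t) = a * g \<omega> x"
    and gain_superadditive: "\<And>\<omega> x y. \<omega> \<in> space M \<Longrightarrow> g \<omega> x + g \<omega> y \<le> g \<omega> (\<lambda>t. x t + y t)"
    and gain_Lipschitz: "\<And>\<omega> x y. \<omega> \<in> space M \<Longrightarrow>
      \<bar>g \<omega> x - g \<omega> y\<bar> \<le> (\<Sum>t=1..T. norm (x t - y t))"
    and nonneg_gain_zero: "\<And>h t. predictable F T h \<Longrightarrow> AE \<omega> in M. 0 \<le> g \<omega> (\<lambda>t. h t \<omega>) \<Longrightarrow>
      t \<in> {1..T} \<Longrightarrow> AE \<omega> in M. h t \<omega> = 0"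
begin

lemma F_mono: "f \<in> measurable (F s) L \<Longrightarrow> s \<le> t \<Longrightarrow> f \<in> measurable (F t) L"
  by (erule measurable_mono_sets) (simp_all add: space_F sets_F_mono)

lemma predictable_measurable: "predictable F T h \<Longrightarrow> t \<in> {1..T} \<Longrightarrow> h t \<in> borel_measurable M"
proof -
  assume h: "predictable F T h" and t: "t \<in> {1..T}"
  have "sets (F (t - 1)) \<subseteq> sets M" using t by (intro sets_F) auto
  then show ?thesis
    by (intro measurable_mono_sets[OF predictableD[OF h t]]) (simp_all add: space_F)
qed

lemma gain_zero: "\<omega> \<in> space M \<Longrightarrow> g \<omega> (\<lambda>t. 0) = 0"
  using gain_scale[of \<omega> 0 "\<lambda>t. 0"] by simp

lemma gain_cong:
  assumes "\<omega> \<in> space M" "\<And>t. t \<in> {1..T} \<Longrightarrow> x t = y t"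
  shows "g \<omega> x = g \<omega> y"
proof -
  have "\<bar>g \<omega> x - g \<omega> y\<bar> \<le> (\<Sum>t=1..T. norm (x t - y t))"
    by (rule gain_Lipschitz[OF assms(1)])
  also have "\<dots> = 0" using assms(2) by (intro sum.neutral) auto
  finally show ?thesis by simp
qed

lemma gain_sum:
  assumes "\<omega> \<in> space M" "finite A" "\<And>n. 0 \<le> c n"
  shows "(\<Sum>n\<in>A. c n * g \<omega> (x n)) \<le> g \<omega> (\<lambda>s. \<Sum>n\<in>A. c n *\<^sub>R x n s)"
  using assms(2)
proof (induction A)
  case empty
  show ?case using gain_zero[OF assms(1)] by simp
next
  case (insert a A)
  have "g \<omega> (\<lambda>s. c a *\<^sub>R x a s) + g \<omega> (\<lambda>s. \<Sum>n\<in>A. c n *\<^sub>R x n s)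
      \<le> g \<omega> (\<lambda>s. c a *\<^sub>R x a s + (\<Sum>n\<in>A. c n *\<^sub>R x n s))"
    by (rule gain_superadditive[OF assms(1)])
  then show ?case
    using insert gain_scale[OF assms(1,3)] by simp
qed

lemma gain_combination:
  assumes "\<omega> \<in> space M" "c \<in> tail_weights k"
  shows "combination c (\<lambda>n. g \<omega> (x n)) \<le> g \<omega> (\<lambda>s. combination c (\<lambda>n. x n s))"
  unfolding combination_def real_scaleR_def
  by (rule gain_sum[OF assms(1) tail_weightsD(3,1)[OF assms(2)]])

lemma gain_tendsto:
  assumes \<omega>: "\<omega> \<in> space M" and y: "\<And>t. t \<in> {1..T} \<Longrightarrow> (\<lambda>k. y k t) \<longlonglongrightarrow> z t"
  shows "(\<lambda>k. g \<omega> (y k)) \<longlonglongrightarrow> g \<omega> z"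
proof -
  have "(\<lambda>k. \<Sum>t=1..T. norm (y k t - z t)) \<longlonglongrightarrow> (\<Sum>t=1..T. norm (z t - z t))"
    by (intro tendsto_intros y)
  then have lim: "(\<lambda>k. \<Sum>t=1..T. norm (y k t - z t)) \<longlonglongrightarrow> 0" by simp
  have "(\<lambda>k. g \<omega> (y k) - g \<omega> z) \<longlonglongrightarrow> 0"
    by (rule Lim_null_comparison[OF _ lim]) (use gain_Lipschitz[OF \<omega>] in auto)
  then show ?thesis by (simp add: LIM_zero_iff)
qed

lemma combinations_limit:
  fixes h :: "nat \<Rightarrow> nat \<Rightarrow> 'a \<Rightarrow> 'v"
  assumes pred: "\<And>n. predictable F T (h n)"
    and bdd: "\<And>s. s \<in> {1..T} \<Longrightarrow> AE \<omega> in M. bounded (range (\<lambda>n. h n s \<omega>))"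
  obtains c h' where "\<And>k. c k \<in> tail_weights k" "\<And>k. predictable F T (\<lambda>s \<omega>. combination (c k) (\<lambda>n. h n s \<omega>))"
    "predictable F T h'"
    "AE \<omega> in M. \<forall>s\<in>{1..T}. (\<lambda>k. combination (c k) (\<lambda>n. h n s \<omega>)) \<longlonglongrightarrow> h' s \<omega>"
proof -
  obtain c where c: "\<And>k. c k \<in> tail_weights k"
      "\<And>s. s \<in> {1..T} \<Longrightarrow> AE \<omega> in M. convergent (\<lambda>k. combination (c k) (\<lambda>n. h n s \<omega>))"
    using AE_convergent_combinations[of "{1..T}" h, OF _ predictable_measurable[OF pred] bdd]
    by (metis finite_atLeastAtMost)
  have comb: "predictable F T (\<lambda>s \<omega>. combination (c k) (\<lambda>n. h n s \<omega>))" for k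
    using pred by (auto simp: predictable_def intro!: borel_measurable_combination)
  show thesis
  proof (rule that[OF c(1) comb])
    \<comment> \<open>Convergence holds only almost surely and the filtration need not be complete;
      \<open>lim\<close> is measurable on the divergence set as well, so the limit is predictable as
      it stands.\<close>
    show "predictable F T (\<lambda>s \<omega>. lim (\<lambda>k. combination (c k) (\<lambda>n. h n s \<omega>)))"
      using comb by (auto simp: predictable_def intro!: borel_measurable_lim_metric)
    have "AE \<omega> in M. \<forall>s\<in>{1..T}. convergent (\<lambda>k. combination (c k) (\<lambda>n. h n s \<omega>))"
      using c(2) by (intro AE_finite_allI) auto
    then show "AE \<omega> in M. \<forall>s\<in>{1..T}. (\<lambda>k. combination (c k) (\<lambda>n. h n s \<omega>))
        \<longlonglongrightarrow> lim (\<lambda>k. combination (c k) (\<lambda>n. h n s \<omega>))"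
      by eventually_elim (simp add: convergent_LIMSEQ_iff)
  qed
qed

section \<open>Almost sure boundedness of strategies\<close>

text \<open>Phrased for strategies that start trading at \<open>t\<close>, to allow backward
  induction over the first trading date.\<close>

definition bounded_from :: "nat \<Rightarrow> bool" where
  "bounded_from t \<longleftrightarrow> (\<forall>h :: nat \<Rightarrow> nat \<Rightarrow> 'a \<Rightarrow> 'v. (\<forall>n. predictable F T (h n)) \<longrightarrow>
    (\<forall>n. \<forall>\<omega>\<in>space M. \<forall>s\<in>{1..T}. s < t \<longrightarrow> h n s \<omega> = 0) \<longrightarrow>
    (AE \<omega> in M. bdd_below (range (\<lambda>n. g \<omega> (\<lambda>s. h n s \<omega>)))) \<longrightarrow>
    (\<forall>s\<in>{1..T}. AE \<omega> in M. bounded (range (\<lambda>n. h n s \<omega>))))"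

lemma bounded_fromD:
  fixes h :: "nat \<Rightarrow> nat \<Rightarrow> 'a \<Rightarrow> 'v"
  assumes "bounded_from t" "\<And>n. predictable F T (h n)"
    "\<And>n \<omega> s. \<omega> \<in> space M \<Longrightarrow> s \<in> {1..T} \<Longrightarrow> s < t \<Longrightarrow> h n s \<omega> = 0"
    "AE \<omega> in M. bdd_below (range (\<lambda>n. g \<omega> (\<lambda>s. h n s \<omega>)))" "s \<in> {1..T}"
  shows "AE \<omega> in M. bounded (range (\<lambda>n. h n s \<omega>))"
  by (rule assms(1)[unfolded bounded_from_def, rule_format]) (fact assms(2-))+

text \<open>Dropping the position held over period \<open>t\<close> changes the gain by at most its norm.\<close>

lemma bounded_from_Suc_tail:
  fixes h :: "nat \<Rightarrow> nat \<Rightarrow> 'a \<Rightarrow> 'v"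
  assumes t: "t \<in> {1..T}" and tail: "bounded_from (Suc t)"
    and pred: "\<And>n. predictable F T (h n)"
    and zero: "\<And>n \<omega> s. \<omega> \<in> space M \<Longrightarrow> s \<in> {1..T} \<Longrightarrow> s < t \<Longrightarrow> h n s \<omega> = 0"
    and bdd: "AE \<omega> in M. bdd_below (range (\<lambda>n. g \<omega> (\<lambda>s. h n s \<omega>)))"
    and bdd_t: "AE \<omega> in M. bounded (range (\<lambda>n. h n t \<omega>))"
    and s: "s \<in> {1..T}"
  shows "AE \<omega> in M. bounded (range (\<lambda>n. h n s \<omega>))"
proof -
  define h' where "h' n s \<omega> = (if t < s then h n s \<omega> else 0)" for n s \<omega>
  have "AE \<omega> in M. bdd_below (range (\<lambda>n. g \<omega> (\<lambda>s. h' n s \<omega>)))"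
    using bdd bdd_t AE_space
  proof eventually_elim
    case (elim \<omega>)
    obtain K where K: "\<And>n. K \<le> g \<omega> (\<lambda>s. h n s \<omega>)" using elim(1) by (auto simp: bdd_below_def)
    obtain K' where K': "\<And>n. norm (h n t \<omega>) \<le> K'" using elim(2) by (auto simp: bounded_iff)
    have "K - K' \<le> g \<omega> (\<lambda>s. h' n s \<omega>)" for n
    proof -
      have "\<bar>g \<omega> (\<lambda>s. h n s \<omega>) - g \<omega> (\<lambda>s. h' n s \<omega>)\<bar> \<le> (\<Sum>s=1..T. norm (h n s \<omega> - h' n s \<omega>))"
        by (rule gain_Lipschitz[OF elim(3)])
      also have "\<dots> = (\<Sum>s\<in>{t}. norm (h n s \<omega> - h' n s \<omega>))"
        by (rule sum.mono_neutral_right)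
           (use t zero[OF elim(3)] in \<open>auto simp: h'_def not_less le_less\<close>)
      also have "\<dots> \<le> K'" using K' by (simp add: h'_def)
      finally show ?thesis using K[of n] by linarith
    qed
    then show ?case by (auto simp: bdd_below_def)
  qed
  moreover have "predictable F T (h' n)" for n
    unfolding predictable_def h'_def using predictableD[OF pred] by auto
  ultimately have "AE \<omega> in M. bounded (range (\<lambda>n. h' n s \<omega>))"
    using tail s by (intro bounded_fromD[of "Suc t" h']) (auto simp: h'_def)
  with bdd_t AE_space show ?thesis
  proof eventually_elim
    case (elim \<omega>)
    consider "s < t" | "s = t" | "t < s" by linarith
    then show ?case
      by cases (use elim zero[OF elim(2) s] in \<open>simp_all add: h'_def\<close>)
  qed
qed

text \<open>
  If the positions at \<open>t\<close> were unbounded along a direction \<open>b\<close>, the strategies normalised at the first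
  index with a large position would have gains bounded below by a null sequence. The normalised
  positions have a uniformly positive component along \<open>b\<close>, which survives convex combinations,
  so their limit is a nonzero strategy with nonnegative gain.
\<close>

lemma bounded_from_Suc_head:
  fixes h :: "nat \<Rightarrow> nat \<Rightarrow> 'a \<Rightarrow> 'v"
  assumes t: "t \<in> {1..T}" and tail: "bounded_from (Suc t)"
    and pred: "\<And>n. predictable F T (h n)"
    and zero: "\<And>n \<omega> s. \<omega> \<in> space M \<Longrightarrow> s \<in> {1..T} \<Longrightarrow> s < t \<Longrightarrow> h n s \<omega> = 0"
    and bdd: "AE \<omega> in M. bdd_below (range (\<lambda>n. g \<omega> (\<lambda>s. h n s \<omega>)))"
  shows "AE \<omega> in M. bounded (range (\<lambda>n. h n t \<omega>))"
proof -
  let ?d = "real DIM('v)" and ?D = "Basis \<union> uminus ` Basis :: 'v set"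
  \<comment> \<open>The level \<open>Suc m\<close> rather than \<open>m\<close> keeps the norm
    positive, so that one can divide by it.\<close>
  define hit where "hit b m \<omega> n \<longleftrightarrow> real (Suc m) \<le> norm (h n t \<omega>) \<and> norm (h n t \<omega>) / ?d \<le> h n t \<omega> \<bullet> b"
    for b m \<omega> n
  define B where "B b = {\<omega> \<in> space M. \<forall>m. \<exists>n. hit b m \<omega> n}" for b
  have null: "AE \<omega> in M. \<omega> \<notin> B b" for b
  proof -
    \<comment> \<open>The chosen index is random but known at time \<open>t - 1\<close>, hence also
      at every later \<open>s - 1\<close>. Selecting strategies with it therefore preserves
      predictability.\<close>
    define N where "N m \<omega> = (LEAST n. hit b m \<omega> n)" for m \<omega>
    have N: "hit b m \<omega> (N m \<omega>)" if "\<omega> \<in> B b" for m \<omega>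
      using that unfolding N_def B_def by (auto intro: LeastI_ex)
    have ht[measurable]: "h n t \<in> borel_measurable (F (t - 1))" for n
      by (rule predictableD[OF pred t])
    have hit_meas[measurable]: "Measurable.pred (F (t - 1)) (\<lambda>\<omega>. hit b m \<omega> n)" for m n
      unfolding hit_def by measurable
    have N_meas: "N m \<in> measurable (F (t - 1)) (count_space UNIV)" for m
      unfolding N_def by measurable
    have B_meas: "Measurable.pred (F (t - 1)) (\<lambda>\<omega>. \<omega> \<in> B b)"
    proof -
      have "Measurable.pred (F (t - 1)) (\<lambda>\<omega>. \<omega> \<in> {\<omega> \<in> space (F (t - 1)). \<forall>m. \<exists>n. hit b m \<omega> n})"
        by measurable
      then show ?thesis by (simp add: B_def space_F)
    qed
    define u where "u m s \<omega> = (if t \<le> s \<and> \<omega> \<in> B b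
      then (1 / norm (h (N m \<omega>) t \<omega>)) *\<^sub>R h (N m \<omega>) s \<omega> else 0)" for m s \<omega>
    have u_pred: "predictable F T (u m)" for m
      unfolding predictable_def
    proof
      fix s assume s: "s \<in> {1..T}"
      show "u m s \<in> borel_measurable (F (s - 1))"
      proof (cases "t \<le> s")
        case True
        have le: "t - 1 \<le> s - 1" using True by simp
        note [measurable] = F_mono[OF B_meas le]
          measurable_compose_countable[OF predictableD[OF pred s] F_mono[OF N_meas[of m] le]]
          measurable_compose_countable[OF F_mono[OF ht le] F_mono[OF N_meas[of m] le]]
        show ?thesis using True unfolding u_def by measurable
      next
        case False
        then have "u m s = (\<lambda>\<omega>. 0)" by (auto simp: u_def)
        then show ?thesis by simp
      qed
    qed
    have u_gain: "g \<omega> (\<lambda>s. u m s \<omega>) = (if \<omega> \<in> B b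
        then g \<omega> (\<lambda>s. h (N m \<omega>) s \<omega>) / norm (h (N m \<omega>) t \<omega>) else 0)" if "\<omega> \<in> space M" for m \<omega>
    proof (cases "\<omega> \<in> B b")
      case True
      have "g \<omega> (\<lambda>s. u m s \<omega>) = g \<omega> (\<lambda>s. (1 / norm (h (N m \<omega>) t \<omega>)) *\<^sub>R h (N m \<omega>) s \<omega>)"
        by (rule gain_cong[OF that]) (use True zero[OF that] in \<open>auto simp: u_def\<close>)
      also have "\<dots> = g \<omega> (\<lambda>s. h (N m \<omega>) s \<omega>) / norm (h (N m \<omega>) t \<omega>)"
        by (simp add: gain_scale[OF that])
      finally show ?thesis using True by simp
    qed (simp add: u_def gain_zero[OF that])
    \<comment> \<open>Dividing by a norm of at least \<open>Suc m\<close> shrinks a lower bound of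
      the original gains by that factor.\<close>
    have u_ge: "AE \<omega> in M. \<exists>K\<ge>0. \<forall>m. - K / real (Suc m) \<le> g \<omega> (\<lambda>s. u m s \<omega>)"
      using bdd AE_space
    proof eventually_elim
      case (elim \<omega>)
      obtain K where K: "\<And>n. K \<le> g \<omega> (\<lambda>s. h n s \<omega>)" using elim(1) by (auto simp: bdd_below_def)
      have "- \<bar>K\<bar> / real (Suc m) \<le> g \<omega> (\<lambda>s. u m s \<omega>)" for m
      proof (cases "\<omega> \<in> B b")
        case True
        have pos: "real (Suc m) \<le> norm (h (N m \<omega>) t \<omega>)" using N[OF True] by (simp add: hit_def)
        then have "\<bar>K\<bar> / norm (h (N m \<omega>) t \<omega>) \<le> \<bar>K\<bar> / real (Suc m)"
          by (intro divide_left_mono mult_pos_pos) auto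
        moreover have "- \<bar>K\<bar> / norm (h (N m \<omega>) t \<omega>) \<le> g \<omega> (\<lambda>s. h (N m \<omega>) s \<omega>) / norm (h (N m \<omega>) t \<omega>)"
          using K[of "N m \<omega>"] by (intro divide_right_mono) auto
        ultimately show ?thesis using True by (simp add: u_gain[OF elim(2)])
      qed (simp add: u_gain[OF elim(2)])
      then show ?case by (intro exI[of _ "\<bar>K\<bar>"]) auto
    qed
    have u_t: "norm (u m t \<omega>) \<le> 1" for m \<omega>
      by (simp add: u_def)
    \<comment> \<open>Normalisation bounds the position at \<open>t\<close> by 1, so the induction
      hypothesis controls all later ones.\<close>
    have u_bdd: "AE \<omega> in M. bounded (range (\<lambda>m. u m s \<omega>))" if "s \<in> {1..T}" for s
    proof (rule bounded_from_Suc_tail[OF t tail u_pred _ _ _ that])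
      show "AE \<omega> in M. bdd_below (range (\<lambda>m. g \<omega> (\<lambda>s. u m s \<omega>)))"
        using u_ge
      proof eventually_elim
        case (elim \<omega>)
        then obtain K where K: "K \<ge> 0" "\<And>m. - K / real (Suc m) \<le> g \<omega> (\<lambda>s. u m s \<omega>)" by blast
        have "- K \<le> - K / real (Suc m)" for m
          using K(1) by (simp add: field_simps)
        then show ?case using K(2) by (intro bdd_belowI2[of _ "- K"]) (meson order_trans)
      qed
      show "AE \<omega> in M. bounded (range (\<lambda>m. u m t \<omega>))"
        using u_t by (auto simp: bounded_iff)
    qed (auto simp: u_def)
    obtain c v where c: "\<And>k. c k \<in> tail_weights k"
      and "\<And>k. predictable F T (\<lambda>s \<omega>. combination (c k) (\<lambda>m. u m s \<omega>))"
      and v: "predictable F T v"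
        "AE \<omega> in M. \<forall>s\<in>{1..T}. (\<lambda>k. combination (c k) (\<lambda>m. u m s \<omega>)) \<longlonglongrightarrow> v s \<omega>"
      by (rule combinations_limit[of u, OF u_pred u_bdd]) (assumption, rule that)
    have "AE \<omega> in M. 0 \<le> g \<omega> (\<lambda>s. v s \<omega>)"
      using u_ge v(2) AE_space
    proof eventually_elim
      case (elim \<omega>)
      obtain K where K: "K \<ge> 0" "\<And>m. - K / real (Suc m) \<le> g \<omega> (\<lambda>s. u m s \<omega>)" using elim(1) by blast
      \<comment> \<open>The weights \<open>c k\<close> involve only indices
        \<open>m \<ge> k\<close>, whose gains are all at least \<open>- K / real (Suc k)\<close>;
        superlinearity carries this over to the combined strategy.\<close>
      have "- K / real (Suc k) \<le> g \<omega> (\<lambda>s. combination (c k) (\<lambda>m. u m s \<omega>))" for k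
      proof -
        have "- K / real (Suc k) \<le> combination (c k) (\<lambda>m. g \<omega> (\<lambda>s. u m s \<omega>))"
        proof (rule combination_ge[OF c])
          fix m assume "k \<le> m"
          then have "K / real (Suc m) \<le> K / real (Suc k)"
            using K(1) by (intro divide_left_mono) auto
          then show "- K / real (Suc k) \<le> g \<omega> (\<lambda>s. u m s \<omega>)" using K(2)[of m] by simp
        qed
        also have "\<dots> \<le> g \<omega> (\<lambda>s. combination (c k) (\<lambda>m. u m s \<omega>))"
          by (rule gain_combination[OF elim(3) c])
        finally show ?thesis .
      qed
      moreover have "(\<lambda>k. - K / real (Suc k)) \<longlonglongrightarrow> 0"
        by (rule LIMSEQ_Suc[OF lim_const_over_n])
      moreover have "(\<lambda>k. g \<omega> (\<lambda>s. combination (c k) (\<lambda>m. u m s \<omega>))) \<longlonglongrightarrow> g \<omega> (\<lambda>s. v s \<omega>)"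
        by (rule gain_tendsto[OF elim(3)]) (use elim(2) in blast)
      ultimately show ?case by (meson LIMSEQ_le)
    qed
    then have "AE \<omega> in M. v t \<omega> = 0"
      by (rule nonneg_gain_zero[OF v(1) _ t])
    with v(2) show ?thesis
    proof eventually_elim
      case (elim \<omega>)
      show ?case
      proof
        assume B: "\<omega> \<in> B b"
        \<comment> \<open>The component along \<open>b\<close> is linear, so unlike the norm its
          lower bound is inherited by convex combinations and by their limit. On \<open>B b\<close>
          this contradicts \<open>v t \<omega> = 0\<close>.\<close>
        have "1 / ?d \<le> combination (c k) (\<lambda>m. u m t \<omega>) \<bullet> b" for k
        proof -
          have "1 / ?d \<le> combination (c k) (\<lambda>m. u m t \<omega> \<bullet> b)"
          proof (rule combination_ge[OF c])
            fix m
            have "real (Suc m) \<le> norm (h (N m \<omega>) t \<omega>)" "norm (h (N m \<omega>) t \<omega>) / ?d \<le> h (N m \<omega>) t \<omega> \<bullet> b"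
              using N[OF B, of m] by (simp_all add: hit_def)
            moreover from this(1) have "0 < norm (h (N m \<omega>) t \<omega>)" by linarith
            ultimately show "1 / ?d \<le> u m t \<omega> \<bullet> b"
              using B by (simp add: u_def field_simps)
          qed
          then show ?thesis by (simp add: combination_def inner_sum_left)
        qed
        moreover have "(\<lambda>k. combination (c k) (\<lambda>m. u m t \<omega>) \<bullet> b) \<longlonglongrightarrow> v t \<omega> \<bullet> b"
          using elim(1) t by (intro tendsto_intros) auto
        ultimately have "1 / ?d \<le> v t \<omega> \<bullet> b" by (meson LIMSEQ_le_const)
        then show False using elim(2) by simp
      qed
    qed
  qed
  have "AE \<omega> in M. \<forall>b\<in>?D. \<omega> \<notin> B b"
    using null by (intro AE_finite_allI) auto
  then show ?thesis using AE_space
  proof eventually_elim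
    case (elim \<omega>)
    \<comment> \<open>Outside all \<open>B b\<close>, each direction has a level never hit. Every
      position has a large component along some direction in \<open>?D\<close>, so the largest of
      these finitely many levels bounds all norms.\<close>
    then have "\<forall>b\<in>?D. \<exists>m. \<forall>n. \<not> hit b m \<omega> n" by (auto simp: B_def)
    then obtain m where m: "\<And>b n. b \<in> ?D \<Longrightarrow> \<not> hit b (m b) \<omega> n" by metis
    define m' where "m' = Max (m ` ?D)"
    have "norm (h n t \<omega>) \<le> real (Suc m')" for n
    proof -
      obtain b where b: "b \<in> ?D" "norm (h n t \<omega>) / ?d \<le> h n t \<omega> \<bullet> b"
        using ex_signed_Basis_inner_ge by blast
      have "m b \<le> m'" unfolding m'_def using b(1) by (intro Max_ge) auto
      then show ?thesis using m[OF b(1), of n] b(2) by (simp add: hit_def)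
    qed
    then show ?case by (auto simp: bounded_iff)
  qed
qed

text \<open>The induction runs downwards from \<open>Suc T\<close>, where all positions in
  \<open>{1..T}\<close> vanish, to 1, where the vanishing condition is void.\<close>

lemma AE_bounded_strategies:
  fixes h :: "nat \<Rightarrow> nat \<Rightarrow> 'a \<Rightarrow> 'v"
  assumes pred: "\<And>n. predictable F T (h n)"
    and bdd: "AE \<omega> in M. bdd_below (range (\<lambda>n. g \<omega> (\<lambda>s. h n s \<omega>)))"
    and s: "s \<in> {1..T}"
  shows "AE \<omega> in M. bounded (range (\<lambda>n. h n s \<omega>))"
proof -
  have "1 \<le> Suc T" by simp
  then have "bounded_from 1"
  proof (induction rule: inc_induct)
    case base
    show ?case unfolding bounded_from_def
    proof (intro allI impI ballI)
      fix h :: "nat \<Rightarrow> nat \<Rightarrow> 'a \<Rightarrow> 'v" and s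
      assume "\<forall>n. \<forall>\<omega>\<in>space M. \<forall>s\<in>{1..T}. s < Suc T \<longrightarrow> h n s \<omega> = 0" "s \<in> {1..T}"
      then show "AE \<omega> in M. bounded (range (\<lambda>n. h n s \<omega>))"
        by (intro AE_I2) (auto simp: bounded_iff)
    qed
  next
    case (step t)
    then have t: "t \<in> {1..T}" by auto
    show ?case unfolding bounded_from_def
    proof (intro allI impI ballI)
      fix h :: "nat \<Rightarrow> nat \<Rightarrow> 'a \<Rightarrow> 'v" and s
      assume h: "\<forall>n. predictable F T (h n)"
          "\<forall>n. \<forall>\<omega>\<in>space M. \<forall>s\<in>{1..T}. s < t \<longrightarrow> h n s \<omega> = 0"
          "AE \<omega> in M. bdd_below (range (\<lambda>n. g \<omega> (\<lambda>s. h n s \<omega>)))" and s: "s \<in> {1..T}"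
      note h' = h(1)[rule_format] h(2)[rule_format] h(3)
      show "AE \<omega> in M. bounded (range (\<lambda>n. h n s \<omega>))"
        by (rule bounded_from_Suc_tail[OF t step(3) h' bounded_from_Suc_head[OF t step(3) h'] s])
    qed
  qed
  from bounded_fromD[OF this pred _ bdd s] show ?thesis by auto
qed

end

section \<open>The optimal investment problem\<close>

text \<open>A branch of a hyperbola: it behaves like \<open>2 * x\<close> towards minus infinity and
  increases to 0 towards plus infinity.\<close>

definition utility :: "real \<Rightarrow> real" where
  "utility x = x - sqrt (1 + x\<^sup>2)"

text \<open>The derivative of \<open>sqrt (1 + x\<^sup>2)\<close>, so that \<open>1 - rho x\<close>
  is the marginal utility. It also serves as a bounded, strictly increasing coordinate on the real
  line.\<close>

definition rho :: "real \<Rightarrow> real" where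
  "rho x = x / sqrt (1 + x\<^sup>2)"

lemma sqrt_one_plus_square:
  "1 \<le> sqrt (1 + x\<^sup>2)" "(sqrt (1 + x\<^sup>2))\<^sup>2 = 1 + x\<^sup>2" "\<bar>x\<bar> < sqrt (1 + x\<^sup>2)"
  by (auto intro: real_less_rsqrt)

lemma abs_rho_less: "\<bar>rho x\<bar> < 1"
proof -
  have "0 < sqrt (1 + x\<^sup>2)" by (simp add: add_pos_nonneg)
  then show ?thesis using sqrt_one_plus_square(3)[of x] by (simp add: rho_def)
qed

lemma utility_neg: "utility x < 0"
  using sqrt_one_plus_square(3)[of x] by (auto simp: utility_def)

text \<open>Concavity. It amounts to \<open>1 + x * y \<le> s * t\<close>, the Cauchy-Schwarz
  inequality for the vectors (1, x) and (1, y).\<close>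

lemma utility_tangent_le: "utility y \<le> utility x + (1 - rho x) * (y - x)"
proof -
  define s t where "s = sqrt (1 + x\<^sup>2)" and "t = sqrt (1 + y\<^sup>2)"
  have s: "1 \<le> s" "s\<^sup>2 = 1 + x\<^sup>2" and t: "1 \<le> t" "t\<^sup>2 = 1 + y\<^sup>2"
    unfolding s_def t_def by (rule sqrt_one_plus_square)+
  have "(1 + x * y)\<^sup>2 \<le> (s * t)\<^sup>2"
    unfolding power_mult_distrib s(2) t(2)
    using zero_le_power2[of "x - y"] by (simp add: algebra_simps power2_eq_square)
  then have "1 + x * y \<le> s * t"
    by (rule power2_le_imp_le) (use s(1) t(1) in simp)
  then have "(1 + x * y) / s \<le> t" using s by (simp add: field_simps)
  moreover have "(1 + x * y) / s = s + x / s * (y - x)"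
    using s by (simp add: field_simps power2_eq_square)
  ultimately show ?thesis
    unfolding utility_def rho_def s_def[symmetric] t_def[symmetric] left_diff_distrib by argo
qed

text \<open>The second derivative of \<open>sqrt (1 + x\<^sup>2)\<close> is at most 1, whence the
  error \<open>d\<^sup>2 / 2\<close>. The proof needs only
  \<open>2 * s * t \<le> s\<^sup>2 + t\<^sup>2\<close>.\<close>

lemma utility_tangent_ge: "utility x + (1 - rho x) * d - d\<^sup>2 / 2 \<le> utility (x + d)"
proof -
  define s t where "s = sqrt (1 + x\<^sup>2)" and "t = sqrt (1 + (x + d)\<^sup>2)"
  have s: "1 \<le> s" "s\<^sup>2 = 1 + x\<^sup>2" and t: "1 \<le> t" "t\<^sup>2 = 1 + (x + d)\<^sup>2"
    unfolding s_def t_def by (rule sqrt_one_plus_square)+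
  have "2 * s * t \<le> s\<^sup>2 + t\<^sup>2"
    using zero_le_power2[of "s - t"] by (simp add: algebra_simps power2_eq_square)
  then have "2 * s * t \<le> 2 * s\<^sup>2 + 2 * x * d + d\<^sup>2"
    unfolding t(2) using s(2) by (simp add: algebra_simps power2_eq_square)
  also have "\<dots> \<le> 2 * s * (s + x / s * d + d\<^sup>2 / 2)"
    using s(1) mult_right_mono[of 1 s "d\<^sup>2"] by (simp add: algebra_simps power2_eq_square)
  finally have "t \<le> s + x / s * d + d\<^sup>2 / 2"
    using s(1) by simp
  then show ?thesis
    unfolding utility_def rho_def s_def[symmetric] t_def[symmetric] left_diff_distrib by argo
qed

lemma utility_mono: "x \<le> y \<Longrightarrow> utility x \<le> utility y"
  using utility_tangent_le[of x y] abs_rho_less[of y]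
    mult_nonneg_nonpos[of "1 - rho y" "x - y"] by linarith

text \<open>Strict concavity is quantified through \<open>rho\<close>, whose boundedness makes the
  gap integrable for arbitrary gains. With \<open>s\<close>, \<open>t\<close>, \<open>m\<close>,
  \<open>p\<close> as in the proof, the gap equals \<open>(s * t - p) / (s + t + 2 * m)\<close>. The
  squared distance of the unit vectors (1, a) / s and (1, b) / t is
  \<open>2 * (s * t - p) / (s * t)\<close>, which dominates that of their second coordinates
  \<open>rho a\<close> and \<open>rho b\<close>. The two are compared using
  \<open>2 * m \<le> s + t\<close> and \<open>s + t \<le> 2 * (s * t)\<close>, the latter because
  \<open>s\<close> and \<open>t\<close> are at least 1.\<close>

lemma utility_midpoint: "(utility a + utility b) / 2 + (rho a - rho b)\<^sup>2 / 8 \<le> utility ((a + b) / 2)"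
proof -
  define s t m where "s = sqrt (1 + a\<^sup>2)" and "t = sqrt (1 + b\<^sup>2)" and "m = sqrt (1 + ((a + b) / 2)\<^sup>2)"
  define p where "p = 1 + a * b"
  have s: "1 \<le> s" "s\<^sup>2 = 1 + a\<^sup>2" and t: "1 \<le> t" "t\<^sup>2 = 1 + b\<^sup>2" and m: "1 \<le> m" "m\<^sup>2 = 1 + ((a + b) / 2)\<^sup>2"
    unfolding s_def t_def m_def by (rule sqrt_one_plus_square)+
  have st: "1 \<le> s * t" using s t mult_mono[of 1 s 1 t] by simp
  have "p\<^sup>2 \<le> (s * t)\<^sup>2"
    unfolding p_def power_mult_distrib s(2) t(2)
    using zero_le_power2[of "a - b"] by (simp add: algebra_simps power2_eq_square)
  then have p: "p \<le> s * t" by (rule power2_le_imp_le) (use st in simp)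
  have diff: "(s + t)\<^sup>2 - (2 * m)\<^sup>2 = 2 * (s * t - p)"
    using s(2) t(2) m(2) by (simp add: p_def power2_eq_square field_simps)
  then have "(2 * m)\<^sup>2 \<le> (s + t)\<^sup>2" using p by argo
  then have m_le: "2 * m \<le> s + t" by (rule power2_le_imp_le) (use s(1) t(1) in simp)
  have a_eq: "a\<^sup>2 = s\<^sup>2 - 1" and b_eq: "b\<^sup>2 = t\<^sup>2 - 1" using s(2) t(2) by simp_all
  have "(a / s - b / t)\<^sup>2 = a\<^sup>2 / s\<^sup>2 + b\<^sup>2 / t\<^sup>2 - 2 * (a * b) / (s * t)"
    by (simp add: power2_diff power_divide)
  also have "a\<^sup>2 / s\<^sup>2 = 1 - (1 / s)\<^sup>2"
    using s(1) by (simp add: a_eq power_divide diff_divide_distrib)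
  also have "b\<^sup>2 / t\<^sup>2 = 1 - (1 / t)\<^sup>2"
    using t(1) by (simp add: b_eq power_divide diff_divide_distrib)
  finally have "(a / s - b / t)\<^sup>2 = 2 * (s * t - p) / (s * t) - (1 / s - 1 / t)\<^sup>2"
  proof -
    have "s * t \<noteq> 0" using st by auto
    then have e: "2 * (s * t - p) / (s * t) = 2 - 2 * (1 + a * b) / (s * t)"
      by (simp add: p_def diff_divide_distrib)
    assume "(a / s - b / t)\<^sup>2 = 1 - (1 / s)\<^sup>2 + (1 - (1 / t)\<^sup>2) - 2 * (a * b) / (s * t)"
    then show ?thesis
      unfolding e power2_diff[of "1 / s" "1 / t"] by (simp add: algebra_simps add_divide_distrib)
  qed
  then have rho_le: "(a / s - b / t)\<^sup>2 \<le> 2 * (s * t - p) / (s * t)"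
    by simp
  have "s + t \<le> 2 * (s * t)"
    using s(1) t(1) mult_nonneg_nonneg[of "s - 1" "t - 1"] mult_left_mono[of 1 t s] mult_right_mono[of 1 s t]
    by (simp add: algebra_simps)
  then have "2 * (s * t - p) / (s * t) / 8 \<le> (s * t - p) / (2 * (s + t))"
    using s t p mult_right_mono[of "s + t" "2 * (s * t)" "s * t - p"] by (simp add: divide_simps algebra_simps)
  also have "(s * t - p) / (2 * (s + t)) \<le> (s + t) / 2 - m"
  proof -
    have "2 * (s * t - p) = (s + t - 2 * m) * (s + t + 2 * m)"
      using diff by (simp add: power2_eq_square algebra_simps)
    also have "\<dots> \<le> (s + t - 2 * m) * (2 * (s + t))"
      using m_le by (intro mult_left_mono) auto
    finally show ?thesis using s t by (simp add: field_simps)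
  qed
  finally have "2 * (s * t - p) / (s * t) / 8 \<le> (s + t) / 2 - m" .
  with rho_le have "(a / s - b / t)\<^sup>2 / 8 \<le> (s + t) / 2 - m" by argo
  then show ?thesis
    unfolding utility_def rho_def s_def t_def m_def by argo
qed

lemma inj_rho: "rho x = rho y \<Longrightarrow> x = y"
proof -
  assume eq: "rho x = rho y"
  define s t where "s = sqrt (1 + x\<^sup>2)" and "t = sqrt (1 + y\<^sup>2)"
  have s: "1 \<le> s" "s\<^sup>2 = 1 + x\<^sup>2" and t: "1 \<le> t" "t\<^sup>2 = 1 + y\<^sup>2"
    unfolding s_def t_def by (rule sqrt_one_plus_square)+
  have xy: "x * t = y * s" using eq s t by (simp add: rho_def field_simps flip: s_def t_def)
  then have "x\<^sup>2 * t\<^sup>2 = y\<^sup>2 * s\<^sup>2" by (metis power_mult_distrib)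
  then have "x\<^sup>2 = y\<^sup>2" by (simp add: s t algebra_simps)
  then have "s = t" by (simp add: s_def t_def)
  then show ?thesis using xy s by simp
qed

lemma rho_less_iff: "rho x < rho y \<longleftrightarrow> x < y"
proof -
  have mono: "rho x < rho y" if "x < y" for x y
  proof -
    have "(rho x - rho y) * (y - x) \<le> 0"
      using utility_tangent_le[of x y] utility_tangent_le[of y x] by (simp add: algebra_simps)
    then have "rho x \<le> rho y" using that by (simp add: mult_le_0_iff)
    then show ?thesis using inj_rho[of x y] that by fastforce
  qed
  from mono[of x y] mono[of y x] show ?thesis by (metis less_asym linorder_less_linear)
qed

text \<open>The danger is the limit -1 of \<open>rho\<close>, that is, values tending to minus
  infinity. As \<open>- utility (x n) \<le> K\<close> forces \<open>x n \<ge> - K\<close>, the limit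
  is at least \<open>rho (- K)\<close>, hence above \<open>rho (- K - 1)\<close>. Values tending to
  plus infinity are harmless for a lower bound.\<close>

lemma bdd_below_if_rho_convergent:
  assumes conv: "convergent (\<lambda>n. rho (x n))" and freq: "\<exists>\<^sub>F n in sequentially. - utility (x n) \<le> K"
  shows "bdd_below (range x)"
proof -
  obtain l where l: "(\<lambda>n. rho (x n)) \<longlonglongrightarrow> l" using conv by (auto simp: convergent_def)
  have freq': "\<exists>\<^sub>F n in sequentially. rho (- K) \<le> rho (x n)"
    using freq
  proof (rule frequently_elim1)
    fix n assume "- utility (x n) \<le> K"
    moreover have "0 \<le> sqrt (1 + (x n)\<^sup>2)" by simp
    ultimately have "- K \<le> x n" unfolding utility_def by argo
    then show "rho (- K) \<le> rho (x n)" using rho_less_iff[of "x n" "- K"] by linarith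
  qed
  have "rho (- K - 1) < l"
  proof (rule ccontr)
    assume "\<not> ?thesis"
    then have "l < rho (- K)" using rho_less_iff[of "- K - 1" "- K"] by linarith
    from order_tendstoD(2)[OF l this] freq' show False
      by (auto simp: frequently_def not_le)
  qed
  from order_tendstoD(1)[OF l this] have "\<forall>\<^sub>F n in sequentially. - K - 1 \<le> x n"
    by eventually_elim (simp add: rho_less_iff)
  then obtain N where N: "\<And>n. n \<ge> N \<Longrightarrow> - K - 1 \<le> x n" by (auto simp: eventually_sequentially)
  have "range x \<subseteq> x ` {..<N} \<union> {- K - 1..}"
  proof
    fix z assume "z \<in> range x"
    then obtain n where "z = x n" by blast
    then show "z \<in> x ` {..<N} \<union> {- K - 1..}" using N[of n] by (cases "n < N") auto
  qed
  then show ?thesis by (rule bdd_below_mono[rotated]) auto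
qed

lemma borel_measurable_utility[measurable]: "utility \<in> borel_measurable borel"
  unfolding utility_def by measurable

lemma borel_measurable_rho[measurable]: "rho \<in> borel_measurable borel"
  unfolding rho_def by measurable

text \<open>Jensen's inequality, from the tangent at the combined point.\<close>

lemma utility_combination:
  assumes c: "c \<in> tail_weights k"
  shows "combination c (\<lambda>n. utility (x n)) \<le> utility (combination c x)"
proof -
  let ?y = "combination c x" and ?A = "{n. c n \<noteq> 0}"
  have "combination c (\<lambda>n. utility (x n)) \<le> (\<Sum>n\<in>?A. c n * (utility ?y + (1 - rho ?y) * (x n - ?y)))"
    unfolding combination_def[of c "\<lambda>n. utility (x n)"] real_scaleR_def
    by (intro sum_mono mult_left_mono utility_tangent_le tail_weightsD(1)[OF c])
  also have "\<dots> = (\<Sum>n\<in>?A. c n) * (utility ?y - (1 - rho ?y) * ?y) + (1 - rho ?y) * (\<Sum>n\<in>?A. c n * x n)"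
    by (simp add: algebra_simps sum.distrib sum_subtractf sum_distrib_left sum_distrib_right)
  also have "\<dots> = utility ?y"
    unfolding tail_weightsD(4)[OF c] by (simp add: combination_def[of c x] algebra_simps)
  finally show ?thesis .
qed

text \<open>By Fatou's lemma the lower limit has finite integral and is almost surely finite. Both
  the bound and the infinite set of indices where it holds depend on the scenario.\<close>

lemma (in prob_space) AE_frequently_le_if_integral_le:
  fixes f :: "nat \<Rightarrow> 'a \<Rightarrow> real"
  assumes int: "\<And>n. integrable M (f n)" and nonneg: "\<And>n \<omega>. 0 \<le> f n \<omega>"
    and le: "\<And>n. (\<integral>\<omega>. f n \<omega> \<partial>M) \<le> K"
  shows "AE \<omega> in M. \<exists>K. \<exists>\<^sub>F n in sequentially. f n \<omega> \<le> K"
proof -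
  have [measurable]: "f n \<in> borel_measurable M" for n using int by auto
  have "(\<integral>\<^sup>+\<omega>. liminf (\<lambda>n. ennreal (f n \<omega>)) \<partial>M) \<le> liminf (\<lambda>n. \<integral>\<^sup>+\<omega>. ennreal (f n \<omega>) \<partial>M)"
    by (rule nn_integral_liminf) auto
  also have "\<dots> \<le> liminf (\<lambda>n. ennreal K)"
    using le by (intro Liminf_mono always_eventually)
      (auto simp: nn_integral_eq_integral[OF int] nonneg intro: ennreal_leI)
  also have "\<dots> < \<infinity>" by (simp add: Liminf_const)
  finally have "AE \<omega> in M. liminf (\<lambda>n. ennreal (f n \<omega>)) \<noteq> \<infinity>"
    by (intro nn_integral_noteq_infinite) auto
  then show ?thesis
  proof eventually_elim
    case (elim \<omega>)
    show ?case
    proof (rule ccontr)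
      assume "\<not> ?case"
      then have ev: "\<forall>\<^sub>F n in sequentially. K < f n \<omega>" for K
        by (simp add: frequently_def not_le)
      obtain K where K: "0 \<le> K" "liminf (\<lambda>n. ennreal (f n \<omega>)) = ennreal K"
        using elim by (cases "liminf (\<lambda>n. ennreal (f n \<omega>))") auto
      have "ennreal (K + 1) \<le> liminf (\<lambda>n. ennreal (f n \<omega>))"
        using ev[of "K + 1"] by (intro Liminf_bounded) (auto elim!: eventually_mono intro: ennreal_leI)
      then show False using K by (simp add: ennreal_le_iff)
    qed
  qed
qed

section \<open>Existence of an optimal strategy and its first-order condition\<close>

context superlinear_gain
begin

text \<open>Integrability is part of the definition because the integral of a non-integrable
  function is 0 by default, which would exceed every genuine expected utility, these being
  negative.\<close>

definition admissible :: "(nat \<Rightarrow> 'a \<Rightarrow> 'v) \<Rightarrow> bool" where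
  "admissible h \<longleftrightarrow> predictable F T h \<and> integrable M (\<lambda>\<omega>. utility (g \<omega> (\<lambda>t. h t \<omega>)))"

definition expected_utility :: "(nat \<Rightarrow> 'a \<Rightarrow> 'v) \<Rightarrow> real" where
  "expected_utility h = (\<integral>\<omega>. utility (g \<omega> (\<lambda>t. h t \<omega>)) \<partial>M)"

lemma admissibleD:
  assumes "admissible h"
  shows "predictable F T h" "integrable M (\<lambda>\<omega>. utility (g \<omega> (\<lambda>t. h t \<omega>)))"
    "(\<lambda>\<omega>. g \<omega> (\<lambda>t. h t \<omega>)) \<in> borel_measurable M"
  using assms gain_measurable by (auto simp: admissible_def)

text \<open>Since the utility is negative, any integrable lower bound makes it integrable.\<close>

lemma admissible_if_utility_ge:
  assumes pred: "predictable F T h" and int: "integrable M f"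
    and ge: "\<And>\<omega>. \<omega> \<in> space M \<Longrightarrow> f \<omega> \<le> utility (g \<omega> (\<lambda>t. h t \<omega>))"
  shows "admissible h" "integral\<^sup>L M f \<le> expected_utility h"
proof -
  have [measurable]: "(\<lambda>\<omega>. g \<omega> (\<lambda>t. h t \<omega>)) \<in> borel_measurable M" by (rule gain_measurable[OF pred])
  have "integrable M (\<lambda>\<omega>. utility (g \<omega> (\<lambda>t. h t \<omega>)))"
  proof (rule Bochner_Integration.integrable_bound[OF int])
    show "AE \<omega> in M. norm (utility (g \<omega> (\<lambda>t. h t \<omega>))) \<le> norm (f \<omega>)"
    proof (rule AE_I2)
      fix \<omega> assume "\<omega> \<in> space M"
      then show "norm (utility (g \<omega> (\<lambda>t. h t \<omega>))) \<le> norm (f \<omega>)"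
        using ge[of \<omega>] utility_neg[of "g \<omega> (\<lambda>t. h t \<omega>)"] by simp
    qed
  qed measurable
  then show adm: "admissible h" using pred by (simp add: admissible_def)
  show "integral\<^sup>L M f \<le> expected_utility h"
    unfolding expected_utility_def
    by (rule integral_mono[OF int admissibleD(2)[OF adm] ge])
qed

lemma expected_utility_midpoint:
  assumes h: "admissible h" and k: "admissible k"
  defines "hk \<equiv> \<lambda>t \<omega>. (1 / 2) *\<^sub>R (h t \<omega> + k t \<omega>)"
  shows "admissible hk" "(expected_utility h + expected_utility k) / 2
    + (\<integral>\<omega>. (rho (g \<omega> (\<lambda>t. h t \<omega>)) - rho (g \<omega> (\<lambda>t. k t \<omega>)))\<^sup>2 \<partial>M) / 8 \<le> expected_utility hk"
proof -
  note [measurable] = admissibleD(3)[OF h] admissibleD(3)[OF k]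
  let ?x = "\<lambda>\<omega>. g \<omega> (\<lambda>t. h t \<omega>)" and ?y = "\<lambda>\<omega>. g \<omega> (\<lambda>t. k t \<omega>)"
  have pred: "predictable F T hk"
    unfolding predictable_def hk_def
  proof
    fix t assume t: "t \<in> {1..T}"
    note [measurable] = predictableD[OF admissibleD(1)[OF h] t] predictableD[OF admissibleD(1)[OF k] t]
    show "(\<lambda>\<omega>. (1 / 2) *\<^sub>R (h t \<omega> + k t \<omega>)) \<in> borel_measurable (F (t - 1))" by measurable
  qed
  have int_rho: "integrable M (\<lambda>\<omega>. (rho (?x \<omega>) - rho (?y \<omega>))\<^sup>2)"
  proof (rule integrable_const_bound[where B = 4])
    have "(rho (?x \<omega>) - rho (?y \<omega>))\<^sup>2 \<le> 4" for \<omega>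
      using power_mono[of "\<bar>rho (?x \<omega>) - rho (?y \<omega>)\<bar>" 2 2] abs_rho_less[of "?x \<omega>"] abs_rho_less[of "?y \<omega>"]
      by simp
    then show "AE \<omega> in M. norm ((rho (?x \<omega>) - rho (?y \<omega>))\<^sup>2) \<le> 4" by simp
  qed measurable
  have ge: "(utility (?x \<omega>) + utility (?y \<omega>)) / 2 + (rho (?x \<omega>) - rho (?y \<omega>))\<^sup>2 / 8
      \<le> utility (g \<omega> (\<lambda>t. hk t \<omega>))" if \<omega>: "\<omega> \<in> space M" for \<omega>
  proof -
    have "(?x \<omega> + ?y \<omega>) / 2 \<le> (1 / 2) * g \<omega> (\<lambda>t. h t \<omega> + k t \<omega>)"
      using gain_superadditive[OF \<omega>, of "\<lambda>t. h t \<omega>" "\<lambda>t. k t \<omega>"] by simp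
    also have "\<dots> = g \<omega> (\<lambda>t. hk t \<omega>)"
      unfolding hk_def by (rule gain_scale[OF \<omega>, symmetric]) simp
    finally show ?thesis using utility_midpoint utility_mono order_trans by blast
  qed
  have int: "integrable M (\<lambda>\<omega>. (utility (?x \<omega>) + utility (?y \<omega>)) / 2 + (rho (?x \<omega>) - rho (?y \<omega>))\<^sup>2 / 8)"
    using int_rho admissibleD(2)[OF h] admissibleD(2)[OF k] by auto
  show "admissible hk" by (rule admissible_if_utility_ge(1)[OF pred int ge])
  show "(expected_utility h + expected_utility k) / 2
    + (\<integral>\<omega>. (rho (?x \<omega>) - rho (?y \<omega>))\<^sup>2 \<partial>M) / 8 \<le> expected_utility hk"
    using admissible_if_utility_ge(2)[OF pred int ge] int_rho admissibleD(2)[OF h] admissibleD(2)[OF k]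
    by (simp add: expected_utility_def)
qed

lemma expected_utility_neg: "admissible h \<Longrightarrow> expected_utility h \<le> 0"
  using integral_mono[OF admissibleD(2) integrable_zero, of h] utility_neg
  by (auto simp: expected_utility_def intro: less_imp_le)

text \<open>Along a maximising sequence only \<open>rho\<close> of the gains converges at first. The
  expected utilities are bounded below, which prevents gains from escaping to minus infinity; this
  lower bound on gains is what the boundedness of strategies requires.\<close>

lemma expected_utility_maximizer:
  obtains h where "admissible h" "\<And>k. admissible k \<Longrightarrow> expected_utility k \<le> expected_utility h"
proof -
  define S where "S = expected_utility ` {h. admissible h}"
  define s where "s = Sup S"
  have zero: "admissible (\<lambda>t \<omega>. 0)"
    by (rule admissible_if_utility_ge(1)[of _ "\<lambda>_. - 1"])
       (auto simp: predictable_def gain_zero utility_def)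
  have S: "S \<noteq> {}" "bdd_above S"
    using zero expected_utility_neg by (auto simp: S_def intro!: bdd_aboveI[of _ 0])
  have le_s: "expected_utility h \<le> s" if "admissible h" for h
    unfolding s_def by (rule cSup_upper[OF _ S(2)]) (use that in \<open>auto simp: S_def\<close>)
  have "\<exists>h. admissible h \<and> s - 1 / (real n + 1) < expected_utility h" for n
  proof -
    have "s - 1 / (real n + 1) < Sup S" by (simp add: s_def)
    from less_cSupD[OF S(1) this] show ?thesis by (auto simp: S_def)
  qed
  then obtain h0 where h0: "\<And>n. admissible (h0 n)" "\<And>n. s - 1 / (real n + 1) < expected_utility (h0 n)"
    by metis
  define x0 where "x0 n \<omega> = g \<omega> (\<lambda>t. h0 n t \<omega>)" for n \<omega>
  have x0_meas[measurable]: "x0 n \<in> borel_measurable M" for n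
    unfolding x0_def by (rule admissibleD(3)[OF h0(1)])
  have "\<exists>N. \<forall>k\<ge>N. \<forall>l\<ge>N. (\<integral>\<omega>. (norm (rho (x0 k \<omega>) - rho (x0 l \<omega>)))\<^sup>2 \<partial>M) < e" if "e > 0" for e
  proof -
    obtain N :: nat where N: "1 / (real N + 1) < e / 8"
      using nat_approx_posE[of "e / 8"] \<open>e > 0\<close> by (auto simp: add.commute)
    have "(\<integral>\<omega>. (norm (rho (x0 k \<omega>) - rho (x0 l \<omega>)))\<^sup>2 \<partial>M) < e" if kl: "k \<ge> N" "l \<ge> N" for k l
    proof -
      \<comment> \<open>If both expected utilities exceed \<open>s - e / 8\<close>, so does their
        mean. The midpoint strategy cannot exceed \<open>s\<close>, so one eighth of the integral is
        below \<open>e / 8\<close>.\<close>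
      have close: "s - e / 8 < expected_utility (h0 j)" if "j \<ge> N" for j
      proof -
        have "1 / (real j + 1) \<le> 1 / (real N + 1)"
          using that by (intro divide_left_mono) auto
        then show ?thesis using h0(2)[of j] N by linarith
      qed
      have "(expected_utility (h0 k) + expected_utility (h0 l)) / 2
          + (\<integral>\<omega>. (rho (x0 k \<omega>) - rho (x0 l \<omega>))\<^sup>2 \<partial>M) / 8 \<le> s"
        unfolding x0_def
        by (rule order_trans[OF expected_utility_midpoint(2) le_s[OF expected_utility_midpoint(1)]]) (rule h0(1))+
      then show ?thesis using close[OF kl(1)] close[OF kl(2)] unfolding real_norm_def power2_abs by argo
    qed
    then show ?thesis by blast
  qed
  then obtain r where r: "strict_mono r" "AE \<omega> in M. Cauchy (\<lambda>k. rho (x0 (r k) \<omega>))"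
    by (rule L2_Cauchy_AE_Cauchy_subseq[of "{()}" "\<lambda>n _ \<omega>. rho (x0 n \<omega>)" 1, rotated 3])
       (use abs_rho_less in \<open>auto intro!: less_imp_le\<close>)
  define h where "h n = h0 (r n)" for n
  define x where "x n \<omega> = x0 (r n) \<omega>" for n \<omega>
  have x_eq: "x n \<omega> = g \<omega> (\<lambda>t. h n t \<omega>)" for n \<omega> by (simp add: x_def x0_def h_def)
  have h: "admissible (h n)" for n using h0(1) by (simp add: h_def)
  have h_ge: "s - 1 / (real n + 1) \<le> expected_utility (h n)" for n
  proof -
    have "1 / (real (r n) + 1) \<le> 1 / (real n + 1)"
      using seq_suble[OF r(1), of n] by (intro divide_left_mono) auto
    then show ?thesis using h0(2)[of "r n"] by (simp add: h_def)
  qed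
  have "AE \<omega> in M. \<exists>K. \<exists>\<^sub>F n in sequentially. - utility (x n \<omega>) \<le> K"
  proof (rule AE_frequently_le_if_integral_le[where K = "1 - s"])
    show "integrable M (\<lambda>\<omega>. - utility (x n \<omega>))" for n
      using admissibleD(2)[OF h] by (simp add: x_eq)
    show "(\<integral>\<omega>. - utility (x n \<omega>) \<partial>M) \<le> 1 - s" for n
    proof -
      have "1 / (real n + 1) \<le> 1" by simp
      then have "s - 1 \<le> expected_utility (h n)" using h_ge[of n] by linarith
      then show ?thesis by (simp add: x_eq expected_utility_def)
    qed
  qed (use utility_neg in \<open>auto intro: less_imp_le\<close>)
  with r(2) have bdd: "AE \<omega> in M. bdd_below (range (\<lambda>n. x n \<omega>))"
  proof eventually_elim
    case (elim \<omega>)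
    then show ?case
      using bdd_below_if_rho_convergent[of "\<lambda>n. x n \<omega>"] by (auto simp: x_def Cauchy_convergent_iff)
  qed
  obtain c h' where c: "\<And>k. c k \<in> tail_weights k"
    and comb: "\<And>k. predictable F T (\<lambda>s \<omega>. combination (c k) (\<lambda>n. h n s \<omega>))"
    and h': "predictable F T h'"
      "AE \<omega> in M. \<forall>s\<in>{1..T}. (\<lambda>k. combination (c k) (\<lambda>n. h n s \<omega>)) \<longlonglongrightarrow> h' s \<omega>"
    by (rule combinations_limit[of h, OF admissibleD(1)[OF h]
        AE_bounded_strategies[of h, OF admissibleD(1)[OF h] bdd[unfolded x_eq]]]) (assumption, rule that)
  define y where "y k \<omega> = g \<omega> (\<lambda>s. combination (c k) (\<lambda>n. h n s \<omega>))" for k \<omega>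
  have [measurable]: "y k \<in> borel_measurable M" for k
    unfolding y_def by (rule gain_measurable[OF comb])
  have comb_ge: "admissible (\<lambda>s \<omega>. combination (c k) (\<lambda>n. h n s \<omega>)) \<and>
      s - 1 / (real k + 1) \<le> (\<integral>\<omega>. utility (y k \<omega>) \<partial>M)" for k
  proof -
    let ?f = "\<lambda>\<omega>. combination (c k) (\<lambda>n. utility (x n \<omega>))"
    have int: "integrable M ?f"
      unfolding combination_def using admissibleD(2)[OF h] by (auto simp: x_eq)
    have ge: "?f \<omega> \<le> utility (g \<omega> (\<lambda>s. combination (c k) (\<lambda>n. h n s \<omega>)))" if "\<omega> \<in> space M" for \<omega>
    proof -
      have "?f \<omega> \<le> utility (combination (c k) (\<lambda>n. x n \<omega>))"
        by (rule utility_combination[OF c])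
      also have "\<dots> \<le> utility (g \<omega> (\<lambda>s. combination (c k) (\<lambda>n. h n s \<omega>)))"
        unfolding x_eq by (intro utility_mono gain_combination[OF that c])
      finally show ?thesis .
    qed
    have "s - 1 / (real k + 1) \<le> combination (c k) (\<lambda>n. expected_utility (h n))"
    proof (rule combination_ge[OF c])
      fix n assume "k \<le> n"
      then have "1 / (real n + 1) \<le> 1 / (real k + 1)" by (intro divide_left_mono) auto
      then show "s - 1 / (real k + 1) \<le> expected_utility (h n)" using h_ge[of n] by linarith
    qed
    also have "\<dots> = integral\<^sup>L M ?f"
      unfolding combination_def expected_utility_def using admissibleD(2)[OF h] by (simp add: x_eq)
    finally show ?thesis
      using admissible_if_utility_ge[OF comb[of k] int ge] by (simp add: y_def expected_utility_def)
  qed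
  have int_y: "integrable M (\<lambda>\<omega>. utility (y k \<omega>))" for k
    using admissibleD(2)[of "\<lambda>s \<omega>. combination (c k) (\<lambda>n. h n s \<omega>)"] comb_ge[of k] by (simp add: y_def)
  have [measurable]: "(\<lambda>\<omega>. g \<omega> (\<lambda>t. h' t \<omega>)) \<in> borel_measurable M" by (rule gain_measurable[OF h'(1)])
  \<comment> \<open>Without a dominating function, limit and integral cannot be interchanged; as
    \<open>- utility\<close> is nonnegative, Fatou's lemma gives the one inequality needed for
    optimality.\<close>
  have fatou: "(\<integral>\<^sup>+\<omega>. ennreal (- utility (g \<omega> (\<lambda>t. h' t \<omega>))) \<partial>M) \<le> ennreal (- s)"
  proof -
    have "(\<integral>\<^sup>+\<omega>. ennreal (- utility (g \<omega> (\<lambda>t. h' t \<omega>))) \<partial>M)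
        = (\<integral>\<^sup>+\<omega>. liminf (\<lambda>k. ennreal (- utility (y k \<omega>))) \<partial>M)"
    proof (rule nn_integral_cong_AE)
      show "AE \<omega> in M. ennreal (- utility (g \<omega> (\<lambda>t. h' t \<omega>))) = liminf (\<lambda>k. ennreal (- utility (y k \<omega>)))"
        using h'(2) AE_space
      proof eventually_elim
        case (elim \<omega>)
        have "(\<lambda>k. y k \<omega>) \<longlonglongrightarrow> g \<omega> (\<lambda>t. h' t \<omega>)"
          unfolding y_def by (rule gain_tendsto[OF elim(2)]) (use elim(1) in blast)
        then have "(\<lambda>k. ennreal (- utility (y k \<omega>))) \<longlonglongrightarrow> ennreal (- utility (g \<omega> (\<lambda>t. h' t \<omega>)))"
          unfolding utility_def by (intro tendsto_intros)
        from lim_imp_Liminf[OF _ this] show ?case by simp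
      qed
    qed
    also have "\<dots> \<le> liminf (\<lambda>k. \<integral>\<^sup>+\<omega>. ennreal (- utility (y k \<omega>)) \<partial>M)"
      by (rule nn_integral_liminf) auto
    also have "\<dots> \<le> liminf (\<lambda>k. ennreal (- s + 1 / (real k + 1)))"
    proof (intro Liminf_mono always_eventually allI)
      fix k
      have "(\<integral>\<^sup>+\<omega>. ennreal (- utility (y k \<omega>)) \<partial>M) = ennreal (\<integral>\<omega>. - utility (y k \<omega>) \<partial>M)"
        by (rule nn_integral_eq_integral) (use int_y utility_neg in \<open>auto intro: less_imp_le\<close>)
      also have "\<dots> \<le> ennreal (- s + 1 / (real k + 1))"
        using comb_ge[of k] by (intro ennreal_leI) simp
      finally show "(\<integral>\<^sup>+\<omega>. ennreal (- utility (y k \<omega>)) \<partial>M) \<le> ennreal (- s + 1 / (real k + 1))" .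
    qed
    also have "\<dots> = ennreal (- s)"
    proof -
      have "(\<lambda>k. 1 / (real k + 1)) \<longlonglongrightarrow> 0"
        using LIMSEQ_Suc[OF lim_const_over_n[of 1]] by (simp add: add.commute)
      then have "(\<lambda>k. ennreal (- s + 1 / (real k + 1))) \<longlonglongrightarrow> ennreal (- s + 0)"
        by (intro tendsto_intros)
      from lim_imp_Liminf[OF _ this] show ?thesis by simp
    qed
    finally show ?thesis .
  qed
  have "integrable M (\<lambda>\<omega>. - utility (g \<omega> (\<lambda>t. h' t \<omega>)))"
  proof (rule integrableI_nonneg)
    show "(\<integral>\<^sup>+\<omega>. ennreal (- utility (g \<omega> (\<lambda>t. h' t \<omega>))) \<partial>M) < \<infinity>"
      using fatou by (simp add: le_less_trans)
  qed (use utility_neg in \<open>auto intro: less_imp_le\<close>)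
  then have adm: "admissible h'" using h'(1) by (simp add: admissible_def)
  \<comment> \<open>\<open>ennreal\<close> truncates negative numbers to 0, so the inequality can be
    read off in the reals only for nonnegative \<open>- s\<close>.\<close>
  have "0 \<le> - s" using zero expected_utility_neg S le_s by (auto simp: s_def S_def intro: cSup_least)
  have "ennreal (- expected_utility h') \<le> ennreal (- s)"
    using fatou nn_integral_eq_integral[of M "\<lambda>\<omega>. - utility (g \<omega> (\<lambda>t. h' t \<omega>))"] admissibleD(2)[OF adm] utility_neg
    by (simp add: expected_utility_def less_imp_le)
  then have "s \<le> expected_utility h'" using \<open>0 \<le> - s\<close> by (simp add: ennreal_le_iff)
  then show thesis using that[OF adm] le_s order_trans by blast
qed

text \<open>
  The marginal utility at the maximiser is a pricing density: \<open>utility\<close> has derivative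
  \<open>1 - rho\<close>, which is bounded and positive.
\<close>

lemma separating_density:
  obtains Z where "Z \<in> borel_measurable M" "\<And>\<omega>. 0 < Z \<omega>" "\<And>\<omega>. Z \<omega> < (2 :: real)"
    "\<And>h C. predictable F T h \<Longrightarrow> \<forall>t\<in>{1..T}. AE \<omega> in M. norm (h t \<omega>) \<le> C \<Longrightarrow>
      (\<integral>\<omega>. Z \<omega> * g \<omega> (\<lambda>t. h t \<omega>) \<partial>M) \<le> 0"
proof -
  obtain h' where h': "admissible h'" "\<And>k. admissible k \<Longrightarrow> expected_utility k \<le> expected_utility h'"
    by (rule expected_utility_maximizer) (rule that)
  define x where "x \<omega> = g \<omega> (\<lambda>t. h' t \<omega>)" for \<omega>
  have [measurable]: "x \<in> borel_measurable M" unfolding x_def by (rule admissibleD(3)[OF h'(1)])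
  show thesis
  proof (rule that[of "\<lambda>\<omega>. 1 - rho (x \<omega>)"])
    show "0 < 1 - rho (x \<omega>)" "1 - rho (x \<omega>) < 2" for \<omega>
      using abs_rho_less[of "x \<omega>"] by auto
    fix h :: "nat \<Rightarrow> 'a \<Rightarrow> 'v" and C
    assume h: "predictable F T h" and bdd: "\<forall>t\<in>{1..T}. AE \<omega> in M. norm (h t \<omega>) \<le> C"
    define y where "y \<omega> = g \<omega> (\<lambda>t. h t \<omega>)" for \<omega>
    have [measurable]: "y \<in> borel_measurable M" unfolding y_def by (rule gain_measurable[OF h])
    \<comment> \<open>The Lipschitz constant 1 bounds the gain of a bounded strategy by the sum of
      \<open>T\<close> position norms.\<close>
    define D where "D = real T * C"
    have "AE \<omega> in M. \<forall>t\<in>{1..T}. norm (h t \<omega>) \<le> C"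
      using bdd by (intro AE_finite_allI) auto
    then have y_le: "AE \<omega> in M. \<bar>y \<omega>\<bar> \<le> D"
      using AE_space
    proof eventually_elim
      case (elim \<omega>)
      have "\<bar>y \<omega> - g \<omega> (\<lambda>t. 0)\<bar> \<le> (\<Sum>t=1..T. norm (h t \<omega> - 0))"
        unfolding y_def by (rule gain_Lipschitz[OF elim(2)])
      also have "\<dots> \<le> (\<Sum>t=1..T. C)" using elim(1) by (intro sum_mono) auto
      finally show ?case by (simp add: gain_zero[OF elim(2)] D_def)
    qed
    have int: "integrable M (\<lambda>\<omega>. (1 - rho (x \<omega>)) * y \<omega>)"
    proof (rule integrable_const_bound[where B = "2 * D"])
      show "AE \<omega> in M. norm ((1 - rho (x \<omega>)) * y \<omega>) \<le> 2 * D"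
        using y_le
      proof eventually_elim
        case (elim \<omega>)
        then show ?case unfolding norm_mult
          using abs_rho_less[of "x \<omega>"] by (intro mult_mono) auto
      qed
    qed measurable
    have int2: "integrable M (\<lambda>\<omega>. (y \<omega>)\<^sup>2)"
    proof (rule integrable_const_bound[where B = "D\<^sup>2"])
      show "AE \<omega> in M. norm ((y \<omega>)\<^sup>2) \<le> D\<^sup>2"
        using y_le by eventually_elim (metis abs_ge_zero norm_power power_mono real_norm_def)
    qed measurable
    \<comment> \<open>Perturb the maximiser by \<open>e\<close> times \<open>h\<close>. The
      quadratic minorant of the utility replaces differentiation under the integral; since
      \<open>y\<close> is bounded it is integrable, which also shows that the perturbed strategy is
      admissible.\<close>
    have "(\<integral>\<omega>. (1 - rho (x \<omega>)) * y \<omega> \<partial>M) \<le> e * (\<integral>\<omega>. (y \<omega>)\<^sup>2 \<partial>M)" if e: "0 < e" for e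
    proof -
      define k where "k t \<omega> = h' t \<omega> + e *\<^sub>R h t \<omega>" for t \<omega>
      have k: "predictable F T k"
        unfolding predictable_def k_def
      proof
        fix t assume t: "t \<in> {1..T}"
        note [measurable] = predictableD[OF admissibleD(1)[OF h'(1)] t] predictableD[OF h t]
        show "(\<lambda>\<omega>. h' t \<omega> + e *\<^sub>R h t \<omega>) \<in> borel_measurable (F (t - 1))" by measurable
      qed
      let ?f = "\<lambda>\<omega>. utility (x \<omega>) + (1 - rho (x \<omega>)) * (e * y \<omega>) - (e * y \<omega>)\<^sup>2 / 2"
      have int_f: "integrable M ?f"
        using admissibleD(2)[OF h'(1)] int int2
        by (auto simp: x_def[symmetric] power_mult_distrib mult.left_commute[of _ e])
      have ge: "?f \<omega> \<le> utility (g \<omega> (\<lambda>t. k t \<omega>))" if "\<omega> \<in> space M" for \<omega>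
      proof -
        have "x \<omega> + e * y \<omega> = g \<omega> (\<lambda>t. h' t \<omega>) + g \<omega> (\<lambda>t. e *\<^sub>R h t \<omega>)"
          using e by (simp add: x_def y_def gain_scale[OF that])
        also have "\<dots> \<le> g \<omega> (\<lambda>t. k t \<omega>)"
          unfolding k_def by (rule gain_superadditive[OF that])
        finally show ?thesis using utility_tangent_ge utility_mono order_trans by blast
      qed
      have "integral\<^sup>L M ?f \<le> expected_utility h'"
        using admissible_if_utility_ge[OF k int_f ge] h'(2) order_trans by blast
      moreover have "integral\<^sup>L M ?f = expected_utility h' + e * (\<integral>\<omega>. (1 - rho (x \<omega>)) * y \<omega> \<partial>M)
          - e\<^sup>2 * (\<integral>\<omega>. (y \<omega>)\<^sup>2 \<partial>M) / 2"
        using admissibleD(2)[OF h'(1)] int int2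
        by (simp add: expected_utility_def x_def[symmetric] power_mult_distrib mult.left_commute[of _ e])
      ultimately have "e * (\<integral>\<omega>. (1 - rho (x \<omega>)) * y \<omega> \<partial>M) \<le> e * (e * (\<integral>\<omega>. (y \<omega>)\<^sup>2 \<partial>M) / 2)"
        by (simp add: power2_eq_square algebra_simps)
      then have "(\<integral>\<omega>. (1 - rho (x \<omega>)) * y \<omega> \<partial>M) \<le> e * (\<integral>\<omega>. (y \<omega>)\<^sup>2 \<partial>M) / 2"
        using e by simp
      also have "\<dots> \<le> e * (\<integral>\<omega>. (y \<omega>)\<^sup>2 \<partial>M)" using e by simp
      finally show ?thesis .
    qed
    then have "\<forall>\<^sub>F e in at_right 0. (\<integral>\<omega>. (1 - rho (x \<omega>)) * y \<omega> \<partial>M) \<le> e * (\<integral>\<omega>. (y \<omega>)\<^sup>2 \<partial>M)"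
      by (auto simp: eventually_at_right_less eventually_at_filter)
    moreover have "((\<lambda>e. e * (\<integral>\<omega>. (y \<omega>)\<^sup>2 \<partial>M)) \<longlongrightarrow> 0 * (\<integral>\<omega>. (y \<omega>)\<^sup>2 \<partial>M)) (at_right 0)"
      by (intro tendsto_intros)
    ultimately show "(\<integral>\<omega>. (1 - rho (x \<omega>)) * g \<omega> (\<lambda>t. h t \<omega>) \<partial>M) \<le> 0"
      using tendsto_lowerbound[of "\<lambda>e. e * (\<integral>\<omega>. (y \<omega>)\<^sup>2 \<partial>M)" 0 "at_right 0"] by (simp add: y_def)
  qed measurable
qed

end

section \<open>Unbounded strategies\<close>

text \<open>
  Unbounded strategies are liquidated one period before the position exceeds a threshold. Given the
  thresholds for the earlier periods, the loss from this liquidation is dominated by an integrable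
  random variable, hence small if the threshold is large.
\<close>

lemma (in prob_space) nonneg_gain_eq_zero_if_bounded_gains_nonpos:
  fixes g :: "'a \<Rightarrow> (nat \<Rightarrow> 'v::euclidean_space) \<Rightarrow> real" and h :: "nat \<Rightarrow> 'a \<Rightarrow> 'v"
  assumes filt: "filtration (space M) F" and sets_F: "\<And>t. t \<le> T \<Longrightarrow> sets (F t) \<subseteq> sets M"
    and meas: "\<And>k. predictable F T k \<Longrightarrow> (\<lambda>\<omega>. g \<omega> (\<lambda>t. k t \<omega>)) \<in> borel_measurable M"
    and L: "integrable M L" "\<And>\<omega>. 0 \<le> L \<omega>"
    and Lip: "AE \<omega> in M. \<forall>x y. \<bar>g \<omega> x - g \<omega> y\<bar> \<le> L \<omega> * (\<Sum>t=1..T. norm (x t - y t))"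
    and zero: "AE \<omega> in M. g \<omega> (\<lambda>t. 0) = 0"
    and nonpos: "\<And>k C. predictable F T k \<Longrightarrow>
      (\<And>t \<omega>. t \<in> {1..T} \<Longrightarrow> \<omega> \<in> space M \<Longrightarrow> norm (k t \<omega>) \<le> C) \<Longrightarrow>
      (\<integral>\<omega>. g \<omega> (\<lambda>t. k t \<omega>) \<partial>M) \<le> 0"
    and h: "predictable F T h" and nonneg: "AE \<omega> in M. 0 \<le> g \<omega> (\<lambda>t. h t \<omega>)"
  shows "AE \<omega> in M. g \<omega> (\<lambda>t. h t \<omega>) = 0"
proof -
  interpret filtration "space M" F by (rule filt)
  have [measurable]: "L \<in> borel_measurable M" using L(1) by auto
  have h_meas: "h t \<in> borel_measurable M" if "t \<in> {1..T}" for t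
  proof -
    have "sets (F (t - 1)) \<subseteq> sets M" using that by (intro sets_F) auto
    then show ?thesis
      by (intro measurable_mono_sets[OF predictableD[OF h that]]) (simp_all add: space_F)
  qed
  \<comment> \<open>Dominated convergence, with the threshold tending to infinity. Thresholds start
    at \<open>K\<close> so that strategies bounded by \<open>K\<close> are never liquidated.\<close>
  have tail_small: "\<exists>m\<ge>K. (\<integral>\<omega>. indicator {\<omega>. m < norm (h t \<omega>)} \<omega> * (L \<omega> * c) \<partial>M) \<le> e"
    if t: "t \<in> {1..T}" and e: "0 < e" for t e c and K :: real
  proof -
    note [measurable] = h_meas[OF t]
    have "(\<lambda>n. \<integral>\<omega>. indicator {\<omega>. K + real n < norm (h t \<omega>)} \<omega> * (L \<omega> * c) \<partial>M)
        \<longlonglongrightarrow> (\<integral>\<omega>. 0 \<partial>M)"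
    proof (rule integral_dominated_convergence[where w = "\<lambda>\<omega>. \<bar>L \<omega> * c\<bar>"])
      show "AE \<omega> in M. (\<lambda>n. indicator {\<omega>. K + real n < norm (h t \<omega>)} \<omega> * (L \<omega> * c)) \<longlonglongrightarrow> 0"
      proof (rule AE_I2)
        fix \<omega>
        obtain N :: nat where "norm (h t \<omega>) - K \<le> real N" using real_arch_simple by blast
        then have "\<forall>n\<ge>N. indicator {\<omega>. K + real n < norm (h t \<omega>)} \<omega> * (L \<omega> * c) = 0"
          by (auto simp: indicator_def)
        then show "(\<lambda>n. indicator {\<omega>. K + real n < norm (h t \<omega>)} \<omega> * (L \<omega> * c)) \<longlonglongrightarrow> 0"
          by (intro tendsto_eventually) (auto simp: eventually_sequentially)
      qed
      show "AE \<omega> in M. norm (indicator {\<omega>. K + real n < norm (h t \<omega>)} \<omega> * (L \<omega> * c)) \<le> \<bar>L \<omega> * c\<bar>" for n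
        by (auto simp: indicator_def)
    qed (use L(1) in \<open>measurable, auto\<close>)
    then have "\<forall>\<^sub>F n in sequentially.
        (\<integral>\<omega>. indicator {\<omega>. K + real n < norm (h t \<omega>)} \<omega> * (L \<omega> * c) \<partial>M) < e"
      using e by (intro order_tendstoD(2)) auto
    then obtain n :: nat where
        "(\<integral>\<omega>. indicator {\<omega>. K + real n < norm (h t \<omega>)} \<omega> * (L \<omega> * c) \<partial>M) < e"
      by (auto simp: eventually_sequentially)
    then show ?thesis by (intro exI[of _ "K + real n"]) auto
  qed
  \<comment> \<open>Restricted to positions of norm at most \<open>K\<close> the gain is integrable.
    These events exhaust the space as \<open>K\<close> grows.\<close>
  have cut: "AE \<omega> in M. indicator {\<omega>. \<forall>t\<in>{1..T}. norm (h t \<omega>) \<le> real K} \<omega> * g \<omega> (\<lambda>t. h t \<omega>) = 0"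
    (is "AE \<omega> in M. ?u \<omega> = 0") for K :: nat
  proof -
    note [measurable] = h_meas meas[OF h]
    have u_meas: "?u \<in> borel_measurable M"
      by measurable
    have u_nonneg: "AE \<omega> in M. 0 \<le> ?u \<omega>"
      using nonneg by eventually_elim (auto simp: indicator_def)
    have u_int: "integrable M ?u"
    proof (rule Bochner_Integration.integrable_bound)
      show "integrable M (\<lambda>\<omega>. L \<omega> * (real T * real K))" using L(1) by simp
      show "AE \<omega> in M. norm (?u \<omega>) \<le> norm (L \<omega> * (real T * real K))"
        using Lip zero
      proof eventually_elim
        case (elim \<omega>)
        show ?case
        proof (cases "\<forall>t\<in>{1..T}. norm (h t \<omega>) \<le> real K")
          case True
          have "\<bar>g \<omega> (\<lambda>t. h t \<omega>) - g \<omega> (\<lambda>t. 0)\<bar> \<le> L \<omega> * (\<Sum>t=1..T. norm (h t \<omega> - 0))"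
            using elim(1) by blast
          also have "\<dots> \<le> L \<omega> * (\<Sum>t=1..T. real K)"
            using True L(2) by (intro mult_left_mono sum_mono) auto
          finally show ?thesis using True elim(2) L(2) by (simp add: abs_mult)
        qed (auto simp: indicator_def)
      qed
    qed (rule u_meas)
    have "(\<integral>\<omega>. ?u \<omega> \<partial>M) \<le> real T * e" if e: "0 < e" for e
    proof -
      \<comment> \<open>The increment \<open>A (Suc n) - A n\<close> is the threshold for period
        \<open>Suc n\<close>, and \<open>A n\<close> bounds the total of the positions kept before
        it. So \<open>L \<omega> * A n\<close> bounds the loss when that threshold is the first one
        exceeded, and the threshold is chosen afterwards to make the expected loss at most
        \<open>e\<close>. The sequence runs past \<open>T\<close>, where only its growth is
        prescribed.\<close>
      have "\<exists>A. \<forall>n. 0 \<le> A n \<and> (real K \<le> A (Suc n) - A n \<and> (n < T \<longrightarrow>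
          (\<integral>\<omega>. indicator {\<omega>. A (Suc n) - A n < norm (h (Suc n) \<omega>)} \<omega> * (L \<omega> * A n) \<partial>M) \<le> e))"
      proof (rule dependent_nat_choice)
        fix x :: real and n :: nat
        assume x: "0 \<le> x"
        show "\<exists>y. 0 \<le> y \<and> (real K \<le> y - x \<and> (n < T \<longrightarrow>
          (\<integral>\<omega>. indicator {\<omega>. y - x < norm (h (Suc n) \<omega>)} \<omega> * (L \<omega> * x) \<partial>M) \<le> e))"
        proof (cases "n < T")
          case True
          then obtain m where "m \<ge> real K"
              "(\<integral>\<omega>. indicator {\<omega>. m < norm (h (Suc n) \<omega>)} \<omega> * (L \<omega> * x) \<partial>M) \<le> e"
            using tail_small[of "Suc n" e "real K" x] e by auto
          then show ?thesis using x by (intro exI[of _ "x + m"]) auto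
        qed (use x in \<open>auto intro!: exI[of _ "x + real K"]\<close>)
      qed auto
      then obtain A where A: "\<And>n. 0 \<le> A n" "\<And>n. real K \<le> A (Suc n) - A n"
          "\<And>n. n < T \<Longrightarrow>
            (\<integral>\<omega>. indicator {\<omega>. A (Suc n) - A n < norm (h (Suc n) \<omega>)} \<omega> * (L \<omega> * A n) \<partial>M) \<le> e"
        by blast
      have A_step: "A n \<le> A (Suc n)" for n
        using A(2)[of n] of_nat_0_le_iff[of K, where ?'a = real] by linarith
      have A_mono: "A i \<le> A j" if "i \<le> j" for i j
        using lift_Suc_mono_le[of A, OF A_step that] .
      define m where "m t = A t - A (t - 1)" for t
      have m: "real K \<le> m t" "0 \<le> m t" if "t \<ge> 1" for t
        using A(2)[of "t - 1"] A_step[of "t - 1"] that by (simp_all add: m_def)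
      have m_le: "m t \<le> A T" if "t \<in> {1..T}" for t
        using A_mono[of t T] A(1)[of "t - 1"] that by (simp add: m_def)
      have m_sum: "(\<Sum>s=1..n. m s) \<le> A n" for n
      proof (induction n)
        case (Suc n)
        then show ?case by (simp add: m_def)
      qed (simp add: A(1))
      \<comment> \<open>Positions are kept as long as no threshold has been exceeded. The position
        \<open>h t\<close> is known at \<open>t - 1\<close>, so this decision is predictable even
        though it looks at period \<open>t\<close> itself.\<close>
      define G where "G t \<omega> \<longleftrightarrow> (\<forall>s\<in>{1..t}. norm (h s \<omega>) \<le> m s)" for t \<omega>
      define k where "k t \<omega> = (if G t \<omega> then h t \<omega> else 0)" for t \<omega>
      have k: "predictable F T k"
        unfolding predictable_def
      proof
        fix t assume t: "t \<in> {1..T}"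
        have [measurable]: "h s \<in> borel_measurable (F (t - 1))" if "s \<in> {1..t}" for s
        proof -
          have "s - 1 \<le> t - 1" using that by (simp add: diff_le_mono)
          then show ?thesis
            using that t by (intro measurable_mono_sets[OF predictableD[OF h, of s]]) (auto simp: space_F sets_F_mono)
        qed
        have [measurable]: "h t \<in> borel_measurable (F (t - 1))" by (rule predictableD[OF h t])
        have "Measurable.pred (F (t - 1)) (G t)"
          unfolding G_def by measurable
        then show "k t \<in> borel_measurable (F (t - 1))"
          unfolding k_def by measurable
      qed
      have k_le: "norm (k t \<omega>) \<le> m t" if "t \<in> {1..T}" for t \<omega>
        using that m(2)[of t] by (auto simp: k_def G_def)
      let ?l = "\<lambda>\<omega>. \<Sum>t<T. indicator {\<omega>. A (Suc t) - A t < norm (h (Suc t) \<omega>)} \<omega> * (L \<omega> * A t)"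
      have l_int: "integrable M (\<lambda>\<omega>. indicator {\<omega>. A (Suc t) - A t < norm (h (Suc t) \<omega>)} \<omega> * (L \<omega> * A t))"
        if "t < T" for t
      proof (rule Bochner_Integration.integrable_bound)
        show "integrable M (\<lambda>\<omega>. L \<omega> * A t)" using L(1) by simp
        have [measurable]: "h (Suc t) \<in> borel_measurable M" using that by (intro h_meas) auto
        show "(\<lambda>\<omega>. indicator {\<omega>. A (Suc t) - A t < norm (h (Suc t) \<omega>)} \<omega> * (L \<omega> * A t)) \<in> borel_measurable M"
          by measurable
      qed (auto simp: indicator_def)
      have l_sum_int: "integrable M ?l"
        by (intro Bochner_Integration.integrable_sum l_int) simp
      have k_int: "integrable M (\<lambda>\<omega>. g \<omega> (\<lambda>t. k t \<omega>))"
      proof (rule Bochner_Integration.integrable_bound)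
        show "integrable M (\<lambda>\<omega>. L \<omega> * A T)" using L(1) by simp
        show "AE \<omega> in M. norm (g \<omega> (\<lambda>t. k t \<omega>)) \<le> norm (L \<omega> * A T)"
          using Lip zero
        proof eventually_elim
          case (elim \<omega>)
          have "\<bar>g \<omega> (\<lambda>t. k t \<omega>) - g \<omega> (\<lambda>t. 0)\<bar> \<le> L \<omega> * (\<Sum>t=1..T. norm (k t \<omega> - 0))"
            using elim(1) by blast
          also have "\<dots> \<le> L \<omega> * (\<Sum>t=1..T. m t)"
            using k_le L(2) by (intro mult_left_mono sum_mono) auto
          also have "\<dots> \<le> L \<omega> * A T" by (intro mult_left_mono m_sum L(2))
          finally show ?case using elim(2) L(2) A(1) by simp
        qed
      qed (rule meas[OF k])
      \<comment> \<open>If no threshold is exceeded, \<open>k\<close> and \<open>h\<close> have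
        equal gains, and \<open>?u\<close> is at most this nonnegative gain. Otherwise some position
        exceeds \<open>K\<close>, so \<open>?u\<close> is 0, and the loss of \<open>k\<close> is
        covered by the summand of \<open>?l\<close> belonging to the first threshold
        exceeded.\<close>
      have "AE \<omega> in M. ?u \<omega> - ?l \<omega> \<le> g \<omega> (\<lambda>t. k t \<omega>)"
        using Lip zero nonneg
      proof eventually_elim
        case (elim \<omega>)
        have l_nonneg: "0 \<le> indicator {\<omega>. A (Suc t) - A t < norm (h (Suc t) \<omega>)} \<omega> * (L \<omega> * A t)" for t
          using L(2) A(1) by simp
        then have "0 \<le> ?l \<omega>" by (rule sum_nonneg)
        show ?case
        proof (cases "G T \<omega>")
          case True
          then have "k t \<omega> = h t \<omega>" if "t \<in> {1..T}" for t
            using that by (auto simp: k_def G_def)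
          then have "(\<Sum>t=1..T. norm (k t \<omega> - h t \<omega>)) = 0" by (intro sum.neutral) auto
          moreover have "\<bar>g \<omega> (\<lambda>t. k t \<omega>) - g \<omega> (\<lambda>t. h t \<omega>)\<bar> \<le> L \<omega> * (\<Sum>t=1..T. norm (k t \<omega> - h t \<omega>))"
            using elim(1) by blast
          ultimately have "g \<omega> (\<lambda>t. k t \<omega>) = g \<omega> (\<lambda>t. h t \<omega>)" by simp
          then show ?thesis using elim(3) \<open>0 \<le> ?l \<omega>\<close> by (auto simp: indicator_def)
        next
          case False
          have u0: "?u \<omega> = 0"
          proof -
            have "\<not> (\<forall>t\<in>{1..T}. norm (h t \<omega>) \<le> real K)"
              using False m(1) by (force simp: G_def)
            then show ?thesis by (simp add: indicator_def)
          qed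
          define n where "n = (LEAST t. \<not> G t \<omega>)"
          have n: "\<not> G n \<omega>" unfolding n_def by (rule LeastI[of _ T]) (rule False)
          have n_le: "n \<le> T" unfolding n_def by (rule Least_le) (rule False)
          have n_less: "G t \<omega>" if "t < n" for t using not_less_Least[of t] that by (auto simp: n_def)
          obtain j where j: "n = Suc j" using n by (cases n) (auto simp: G_def)
          have "\<not> norm (h n \<omega>) \<le> m n"
            using n n_less[of j] by (auto simp: G_def j le_Suc_eq)
          then have ind: "A (Suc j) - A j < norm (h (Suc j) \<omega>)" by (simp add: j m_def)
          have k0: "k t \<omega> = 0" if "n \<le> t" for t
            using n that by (auto simp: k_def G_def)
          have "\<bar>g \<omega> (\<lambda>t. k t \<omega>) - g \<omega> (\<lambda>t. 0)\<bar> \<le> L \<omega> * (\<Sum>t=1..T. norm (k t \<omega> - 0))"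
            using elim(1) by blast
          also have "(\<Sum>t=1..T. norm (k t \<omega> - 0)) = (\<Sum>t=1..j. norm (k t \<omega>))"
            using n_le k0 by (intro sum.mono_neutral_cong_right) (auto simp: j)
          also have "L \<omega> * \<dots> \<le> L \<omega> * (\<Sum>t=1..j. m t)"
            using k_le n_le L(2) by (intro mult_left_mono sum_mono) (auto simp: j)
          also have "\<dots> \<le> L \<omega> * A j" by (intro mult_left_mono m_sum L(2))
          also have "\<dots> = indicator {\<omega>. A (Suc j) - A j < norm (h (Suc j) \<omega>)} \<omega> * (L \<omega> * A j)"
            using ind by simp
          also have "\<dots> \<le> ?l \<omega>"
            by (rule member_le_sum) (use n_le l_nonneg in \<open>auto simp: j\<close>)
          finally show ?thesis unfolding u0 elim(2) by linarith
        qed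
      qed
      then have "(\<integral>\<omega>. ?u \<omega> - ?l \<omega> \<partial>M) \<le> (\<integral>\<omega>. g \<omega> (\<lambda>t. k t \<omega>) \<partial>M)"
        by (intro integral_mono_AE Bochner_Integration.integrable_diff u_int l_sum_int k_int)
      also have "\<dots> \<le> 0"
        by (rule nonpos[OF k]) (use k_le m_le order_trans in blast)
      finally have "(\<integral>\<omega>. ?u \<omega> \<partial>M) \<le> (\<integral>\<omega>. ?l \<omega> \<partial>M)"
        unfolding Bochner_Integration.integral_diff[OF u_int l_sum_int] by linarith
      also have "\<dots> = (\<Sum>t<T. \<integral>\<omega>. indicator {\<omega>. A (Suc t) - A t < norm (h (Suc t) \<omega>)} \<omega> * (L \<omega> * A t) \<partial>M)"
        by (intro Bochner_Integration.integral_sum l_int) simp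
      also have "\<dots> \<le> (\<Sum>t<T. e)" by (intro sum_mono A(3)) auto
      finally show ?thesis by simp
    qed
    then have "(\<integral>\<omega>. ?u \<omega> \<partial>M) \<le> 0 + e" if "0 < e" for e
      using that by (cases "T = 0") (force dest: spec[of _ "e / real T"])+
    then have "(\<integral>\<omega>. ?u \<omega> \<partial>M) \<le> 0" by (rule field_le_epsilon)
    then have "(\<integral>\<omega>. ?u \<omega> \<partial>M) = 0"
      using integral_nonneg_AE[OF u_nonneg] by linarith
    then show ?thesis
      using integral_nonneg_eq_0_iff_AE[OF u_int u_nonneg] by blast
  qed
  then have "AE \<omega> in M. \<forall>K::nat. indicator {\<omega>. \<forall>t\<in>{1..T}. norm (h t \<omega>) \<le> real K} \<omega> * g \<omega> (\<lambda>t. h t \<omega>) = 0"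
    unfolding AE_all_countable by blast
  then show ?thesis
  proof eventually_elim
    case (elim \<omega>)
    obtain K :: nat where K: "(\<Sum>t=1..T. norm (h t \<omega>)) \<le> real K" using real_arch_simple by blast
    have "norm (h t \<omega>) \<le> real K" if "t \<in> {1..T}" for t
      using member_le_sum[of t "{1..T}" "\<lambda>t. norm (h t \<omega>)"] that K by auto
    then show ?case using elim[rule_format, of K] by simp
  qed
qed

section \<open>Gains in a bid-ask market\<close>

lemma two_sided_zero[simp]: "two_sided 0 p q = 0"
  by (simp add: two_sided_def)

lemma two_sided_minus: "two_sided (- h) p q = - two_sided h q p"
  by (auto simp: two_sided_def simp flip: sum_negf intro!: sum.cong)

lemma two_sided_scaleR:
  assumes "0 \<le> a"
  shows "two_sided (a *\<^sub>R h) p q = a * two_sided h p q"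
proof (cases "a = 0")
  case False
  then show ?thesis using assms
    by (auto simp: two_sided_def sum_distrib_left zero_le_mult_iff mult.assoc intro!: sum.cong)
qed simp

text \<open>For \<open>q \<le> p\<close> each summand is the maximum of two linear functions of the
  position, hence subadditive.\<close>

lemma two_sided_add_le:
  assumes "q \<le> p"
  shows "two_sided (h + k) p q \<le> two_sided h p q + two_sided k p q"
proof -
  have "(h $ j + k $ j) * (if 0 \<le> h $ j + k $ j then p $ j else q $ j)
      \<le> h $ j * (if 0 \<le> h $ j then p $ j else q $ j) + k $ j * (if 0 \<le> k $ j then p $ j else q $ j)" for j
  proof -
    have "q $ j \<le> p $ j" using assms by (simp add: less_eq_vec_def)
    moreover have max: "a * (if 0 \<le> a then p $ j else q $ j) = max (a * p $ j) (a * q $ j)"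
      if "q $ j \<le> p $ j" for a
      using that by (auto simp: max_def mult_le_cancel_left)
    ultimately show ?thesis
      unfolding max[OF \<open>q $ j \<le> p $ j\<close>] distrib_right by (simp add: max_def)
  qed
  then show ?thesis
    by (simp add: two_sided_def sum_mono flip: sum.distrib)
qed

lemma two_sided_add_ge:
  assumes "p \<le> q"
  shows "two_sided h p q + two_sided k p q \<le> two_sided (h + k) p q"
proof -
  have eq: "- h + - k = - (h + k)" by simp
  show ?thesis
    using two_sided_add_le[OF assms, of "- h" "- k"] unfolding eq two_sided_minus by linarith
qed

text \<open>Positive and negative parts are 1-Lipschitz, and each is priced linearly. The factor
  \<open>CARD('n)\<close> comes from bounding every coordinate by the norm.\<close>

lemma two_sided_Lipschitz:
  fixes h k p q :: "real ^ 'n::finite"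
  shows "\<bar>two_sided h p q - two_sided k p q\<bar> \<le> real CARD('n) * norm (h - k) * (norm p + norm q)"
proof -
  have "\<bar>h $ j * (if 0 \<le> h $ j then p $ j else q $ j) - k $ j * (if 0 \<le> k $ j then p $ j else q $ j)\<bar>
      \<le> norm (h - k) * (norm p + norm q)" for j
  proof -
    let ?a = "h $ j" and ?b = "k $ j"
    have split: "a * (if 0 \<le> a then p $ j else q $ j) = max a 0 * p $ j + min a 0 * q $ j" for a :: real
      by auto
    have "\<bar>?a * (if 0 \<le> ?a then p $ j else q $ j) - ?b * (if 0 \<le> ?b then p $ j else q $ j)\<bar>
        = \<bar>(max ?a 0 - max ?b 0) * p $ j + (min ?a 0 - min ?b 0) * q $ j\<bar>"
      unfolding split by (simp add: algebra_simps)
    also have "\<dots> \<le> \<bar>max ?a 0 - max ?b 0\<bar> * \<bar>p $ j\<bar> + \<bar>min ?a 0 - min ?b 0\<bar> * \<bar>q $ j\<bar>"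
      unfolding abs_mult[symmetric] by (rule abs_triangle_ineq)
    also have "\<dots> \<le> \<bar>?a - ?b\<bar> * norm p + \<bar>?a - ?b\<bar> * norm q"
      by (intro add_mono mult_mono component_le_norm_cart) auto
    also have "\<dots> = \<bar>(h - k) $ j\<bar> * (norm p + norm q)"
      by (simp add: distrib_left)
    also have "\<dots> \<le> norm (h - k) * (norm p + norm q)"
      by (intro mult_right_mono component_le_norm_cart) auto
    finally show ?thesis .
  qed
  note le = this
  have "(\<Sum>j\<in>UNIV. \<bar>h $ j * (if 0 \<le> h $ j then p $ j else q $ j) - k $ j * (if 0 \<le> k $ j then p $ j else q $ j)\<bar>)
      \<le> real CARD('n) * (norm (h - k) * (norm p + norm q))"
    by (rule sum_bounded_above) (rule le)
  then show ?thesis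
    unfolding two_sided_def sum_subtractf[symmetric] by (simp add: order_trans[OF sum_abs] mult.assoc)
qed

lemma borel_measurable_two_sided[measurable (raw)]:
  fixes h p q :: "'a \<Rightarrow> real ^ 'n::finite"
  assumes [measurable]: "h \<in> borel_measurable N" "p \<in> borel_measurable N" "q \<in> borel_measurable N"
  shows "(\<lambda>\<omega>. two_sided (h \<omega>) (p \<omega>) (q \<omega>)) \<in> borel_measurable N"
proof -
  have [measurable]: "(\<lambda>\<omega>. h \<omega> $ j) \<in> borel_measurable N" "(\<lambda>\<omega>. p \<omega> $ j) \<in> borel_measurable N"
      "(\<lambda>\<omega>. q \<omega> $ j) \<in> borel_measurable N" for j
    by (rule borel_measurable_continuous_on[OF linear_continuous_on[OF bounded_linear_vec_nth]]; measurable)+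
  show ?thesis unfolding two_sided_def by measurable
qed

section \<open>Terminal wealth as a function of the security positions\<close>

text \<open>With position 0 after \<open>T\<close>, liquidation becomes a trade like any
  other.\<close>

definition next_position :: "nat \<Rightarrow> (nat \<Rightarrow> 'v::zero) \<Rightarrow> nat \<Rightarrow> 'v" where
  "next_position T x t = (if t < T then x (Suc t) else 0)"

text \<open>
  Discounted terminal wealth of the self-financing strategy with initial wealth 0 and positions \<open>x\<close>
  in the securities, all of which are sold at time \<open>T\<close>.
\<close>

definition gain :: "('a, 'n::finite) market \<Rightarrow> nat \<Rightarrow> 'a \<Rightarrow> (nat \<Rightarrow> real ^ 'n) \<Rightarrow> real" where
  "gain X T \<omega> x = (\<Sum>t=1..T. (two_sided (x t) (increment (Aask X) t \<omega>) (increment (Abid X) t \<omega>)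
      - two_sided (next_position T x t - x t) (Pask X t \<omega>) (Pbid X t \<omega>)) / savings X t \<omega>)
    - two_sided (x 1) (Pask X 0 \<omega>) (Pbid X 0 \<omega>)"

text \<open>The time-0 prices are undiscounted because the set-up cost charges 1, not
  \<open>savings X 0\<close>, per unit of the savings account.\<close>

definition price_bound :: "('a, 'n::finite) market \<Rightarrow> nat \<Rightarrow> 'a \<Rightarrow> real" where
  "price_bound X T \<omega> = norm (Pask X 0 \<omega>) + norm (Pbid X 0 \<omega>) + (\<Sum>t=1..T.
    (norm (Pask X t \<omega>) + norm (Pbid X t \<omega>)
      + norm (increment (Aask X) t \<omega>) + norm (increment (Abid X) t \<omega>)) / savings X t \<omega>)"

text \<open>Gathers the almost sure sign conditions of the market, so that estimates can be made
  scenario by scenario.\<close>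

definition regular :: "('a, 'n::finite) market \<Rightarrow> nat \<Rightarrow> 'a \<Rightarrow> bool" where
  "regular X T \<omega> \<longleftrightarrow> (\<forall>t\<le>T. 0 \<le> rate X t \<omega> \<and> Pbid X t \<omega> \<le> Pask X t \<omega>) \<and>
    (\<forall>t\<in>{1..T}. increment (Aask X) t \<omega> \<le> increment (Abid X) t \<omega>)"

lemma savings_ge_1: "regular X T \<omega> \<Longrightarrow> t \<le> T \<Longrightarrow> 1 \<le> savings X t \<omega>"
  unfolding savings_def regular_def by (intro prod_ge_1) auto

lemma gain_scaleR: "0 \<le> a \<Longrightarrow> gain X T \<omega> (\<lambda>t. a *\<^sub>R x t) = a * gain X T \<omega> x"
proof -
  assume a: "0 \<le> a"
  have "next_position T (\<lambda>t. a *\<^sub>R x t) t - a *\<^sub>R x t = a *\<^sub>R (next_position T x t - x t)" for t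
    by (simp add: next_position_def scaleR_diff_right)
  then show ?thesis
    by (simp add: gain_def two_sided_scaleR[OF a] right_diff_distrib sum_distrib_left)
qed

lemma gain_superadditive:
  assumes reg: "regular X T \<omega>"
  shows "gain X T \<omega> x + gain X T \<omega> y \<le> gain X T \<omega> (\<lambda>t. x t + y t)"
proof -
  define r where "r x t = (two_sided (x t) (increment (Aask X) t \<omega>) (increment (Abid X) t \<omega>)
      - two_sided (next_position T x t - x t) (Pask X t \<omega>) (Pbid X t \<omega>)) / savings X t \<omega>" for x t
  have r_le: "r x t + r y t \<le> r (\<lambda>t. x t + y t) t" if "t \<in> {1..T}" for t
  proof -
    have bid: "Pbid X t \<omega> \<le> Pask X t \<omega>" using that reg by (auto simp: regular_def)
    have next_eq: "next_position T (\<lambda>t. x t + y t) t - (x t + y t) = (next_position T x t - x t) + (next_position T y t - y t)"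
      by (simp add: next_position_def)
    have "two_sided (next_position T (\<lambda>t. x t + y t) t - (x t + y t)) (Pask X t \<omega>) (Pbid X t \<omega>)
        \<le> two_sided (next_position T x t - x t) (Pask X t \<omega>) (Pbid X t \<omega>)
          + two_sided (next_position T y t - y t) (Pask X t \<omega>) (Pbid X t \<omega>)"
      unfolding next_eq by (rule two_sided_add_le[OF bid])
    moreover have "two_sided (x t) (increment (Aask X) t \<omega>) (increment (Abid X) t \<omega>)
          + two_sided (y t) (increment (Aask X) t \<omega>) (increment (Abid X) t \<omega>)
        \<le> two_sided (x t + y t) (increment (Aask X) t \<omega>) (increment (Abid X) t \<omega>)"
      using that reg by (intro two_sided_add_ge) (auto simp: regular_def)
    ultimately show ?thesis
      unfolding r_def add_divide_distrib[symmetric]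
      using savings_ge_1[OF reg, of t] that by (intro divide_right_mono) auto
  qed
  have "(\<Sum>t=1..T. r x t) + (\<Sum>t=1..T. r y t) \<le> (\<Sum>t=1..T. r (\<lambda>t. x t + y t) t)"
    unfolding sum.distrib[symmetric] by (intro sum_mono r_le)
  moreover have "two_sided (x 1 + y 1) (Pask X 0 \<omega>) (Pbid X 0 \<omega>)
      \<le> two_sided (x 1) (Pask X 0 \<omega>) (Pbid X 0 \<omega>) + two_sided (y 1) (Pask X 0 \<omega>) (Pbid X 0 \<omega>)"
    using reg by (intro two_sided_add_le) (auto simp: regular_def)
  moreover have "gain X T \<omega> z = (\<Sum>t=1..T. r z t) - two_sided (z 1) (Pask X 0 \<omega>) (Pbid X 0 \<omega>)" for z
    by (simp add: gain_def r_def)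
  ultimately show ?thesis by simp
qed

text \<open>The factor 2 arises because the trade at \<open>t\<close> involves two consecutive
  positions, each varying by at most the total distance.\<close>

lemma gain_Lipschitz:
  fixes X :: "('a, 'n::finite) market"
  assumes reg: "regular X T \<omega>" and T: "1 \<le> T"
  shows "\<bar>gain X T \<omega> x - gain X T \<omega> y\<bar>
    \<le> 2 * real CARD('n) * price_bound X T \<omega> * (\<Sum>t=1..T. norm (x t - y t))"
proof -
  let ?N = "real CARD('n)" and ?D = "\<Sum>t=1..T. norm (x t - y t)"
  have D: "norm (x t - y t) \<le> ?D" if "t \<in> {1..T}" for t
    using that by (intro member_le_sum) auto
  have D0: "0 \<le> ?D" by (intro sum_nonneg) simp
  define a where "a x t = two_sided (x t) (increment (Aask X) t \<omega>) (increment (Abid X) t \<omega>)" for x :: "nat \<Rightarrow> real ^ 'n" and t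
  define b where "b x t = two_sided (next_position T x t - x t) (Pask X t \<omega>) (Pbid X t \<omega>)" for x :: "nat \<Rightarrow> real ^ 'n" and t
  define A where "A t = norm (increment (Aask X) t \<omega>) + norm (increment (Abid X) t \<omega>)" for t
  define P where "P t = norm (Pask X t \<omega>) + norm (Pbid X t \<omega>)" for t
  have [simp]: "0 \<le> A t" "0 \<le> P t" for t by (simp_all add: A_def P_def)
  have term_le: "\<bar>(a x t - b x t) / savings X t \<omega> - (a y t - b y t) / savings X t \<omega>\<bar>
      \<le> 2 * ?N * ?D * ((P t + A t) / savings X t \<omega>)" if t: "t \<in> {1..T}" for t
  proof -
    have "\<bar>a x t - a y t\<bar> \<le> ?N * norm (x t - y t) * A t"
      unfolding a_def A_def by (rule two_sided_Lipschitz)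
    also have "\<dots> \<le> ?N * ?D * A t"
      by (intro mult_right_mono mult_left_mono D[OF t]) auto
    also have "\<dots> \<le> ?N * (2 * ?D) * A t"
      using D0 by (intro mult_right_mono mult_left_mono) auto
    finally have a_le: "\<bar>a x t - a y t\<bar> \<le> ?N * (2 * ?D) * A t" .
    have next_le: "norm (next_position T x t - next_position T y t) \<le> ?D"
      using D[of "Suc t"] D0 t by (auto simp: next_position_def)
    have "norm ((next_position T x t - x t) - (next_position T y t - y t))
        = norm ((next_position T x t - next_position T y t) - (x t - y t))"
      by (simp add: algebra_simps)
    also have "\<dots> \<le> 2 * ?D"
      using norm_triangle_ineq4[of "next_position T x t - next_position T y t" "x t - y t"] next_le D[OF t] by linarith
    finally have n_le: "norm ((next_position T x t - x t) - (next_position T y t - y t)) \<le> 2 * ?D" .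
    have "\<bar>b x t - b y t\<bar> \<le> ?N * norm ((next_position T x t - x t) - (next_position T y t - y t)) * P t"
      unfolding b_def P_def by (rule two_sided_Lipschitz)
    also have "\<dots> \<le> ?N * (2 * ?D) * P t"
      by (intro mult_right_mono mult_left_mono n_le) auto
    finally have "\<bar>(a x t - b x t) - (a y t - b y t)\<bar> \<le> ?N * (2 * ?D) * A t + ?N * (2 * ?D) * P t"
      using a_le by linarith
    also have "\<dots> = 2 * ?N * ?D * (P t + A t)" by (simp add: algebra_simps)
    finally have "\<bar>(a x t - b x t) - (a y t - b y t)\<bar> / savings X t \<omega>
        \<le> 2 * ?N * ?D * (P t + A t) / savings X t \<omega>"
      using savings_ge_1[OF reg, of t] t by (intro divide_right_mono) auto
    then show ?thesis
      using savings_ge_1[OF reg, of t] t by (simp add: abs_divide flip: diff_divide_distrib)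
  qed
  have "\<bar>(\<Sum>t=1..T. (a x t - b x t) / savings X t \<omega>) - (\<Sum>t=1..T. (a y t - b y t) / savings X t \<omega>)\<bar>
      \<le> (\<Sum>t=1..T. 2 * ?N * ?D * ((P t + A t) / savings X t \<omega>))"
    unfolding sum_subtractf[symmetric] by (rule order_trans[OF sum_abs]) (intro sum_mono term_le)
  also have "\<dots> = 2 * ?N * ?D * (\<Sum>t=1..T. (P t + A t) / savings X t \<omega>)"
    by (simp add: sum_distrib_left)
  finally have sum_le: "\<bar>(\<Sum>t=1..T. (a x t - b x t) / savings X t \<omega>) - (\<Sum>t=1..T. (a y t - b y t) / savings X t \<omega>)\<bar>
      \<le> 2 * ?N * ?D * (\<Sum>t=1..T. (P t + A t) / savings X t \<omega>)" .
  have "\<bar>two_sided (x 1) (Pask X 0 \<omega>) (Pbid X 0 \<omega>) - two_sided (y 1) (Pask X 0 \<omega>) (Pbid X 0 \<omega>)\<bar>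
      \<le> ?N * norm (x 1 - y 1) * P 0"
    unfolding P_def by (rule two_sided_Lipschitz)
  also have "\<dots> \<le> ?N * (2 * ?D) * P 0"
    using D[of 1] D0 T by (intro mult_right_mono mult_left_mono) auto
  finally have init_le: "\<bar>two_sided (x 1) (Pask X 0 \<omega>) (Pbid X 0 \<omega>) - two_sided (y 1) (Pask X 0 \<omega>) (Pbid X 0 \<omega>)\<bar>
      \<le> ?N * (2 * ?D) * P 0" .
  have "2 * ?N * price_bound X T \<omega> * ?D
      = 2 * ?N * ?D * (\<Sum>t=1..T. (P t + A t) / savings X t \<omega>) + ?N * (2 * ?D) * P 0"
    by (simp add: price_bound_def P_def A_def algebra_simps)
  then show ?thesis
    using sum_le init_le unfolding gain_def a_def[symmetric] b_def[symmetric] by argo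
qed

context bid_ask_market
begin

lemma F_le: "f \<in> measurable (F s) L \<Longrightarrow> s \<le> t \<Longrightarrow> f \<in> measurable (F t) L"
  by (erule measurable_mono_sets) (simp_all add: space_F sets_F_mono)

lemma sets_F_le: "t \<le> T \<Longrightarrow> sets (F t) \<subseteq> sets M"
  using sets_F_mono[of t T] sets_horizon by simp

lemma measurable_F_M: "f \<in> measurable (F t) L \<Longrightarrow> t \<le> T \<Longrightarrow> f \<in> measurable M L"
  by (erule measurable_mono_sets) (simp_all add: space_F sets_F_le)

lemma savings_measurable: "t \<le> T \<Longrightarrow> savings X t \<in> borel_measurable (F t)"
  unfolding savings_def
  using F_le[OF rate_adapted] by (auto intro!: borel_measurable_prod borel_measurable_add)

lemma Aask_measurable: "t \<le> T \<Longrightarrow> Aask X t \<in> borel_measurable (F t)"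
proof (cases "t = 0")
  case True
  have "Aask X 0 \<in> borel_measurable (F 0) \<longleftrightarrow> (\<lambda>\<omega>. 0 :: real ^ 'n) \<in> borel_measurable (F 0)"
    using Aask_0 by (intro measurable_cong) (simp add: space_F)
  then show ?thesis using True by simp
qed (simp add: Aask_adapted)

lemma Abid_measurable: "t \<le> T \<Longrightarrow> Abid X t \<in> borel_measurable (F t)"
proof (cases "t = 0")
  case True
  have "Abid X 0 \<in> borel_measurable (F 0) \<longleftrightarrow> (\<lambda>\<omega>. 0 :: real ^ 'n) \<in> borel_measurable (F 0)"
    using Abid_0 by (intro measurable_cong) (simp add: space_F)
  then show ?thesis using True by simp
qed (simp add: Abid_adapted)

lemma increment_Aask_measurable: "t \<le> T \<Longrightarrow> increment (Aask X) t \<in> borel_measurable (F t)"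
  unfolding increment_def
  by (intro borel_measurable_diff F_le[OF Aask_measurable]) auto

lemma increment_Abid_measurable: "t \<le> T \<Longrightarrow> increment (Abid X) t \<in> borel_measurable (F t)"
  unfolding increment_def
  by (intro borel_measurable_diff F_le[OF Abid_measurable]) auto

lemmas adapted_measurable =
  savings_measurable Pask_adapted Pbid_adapted increment_Aask_measurable increment_Abid_measurable

lemmas market_measurable = adapted_measurable[THEN measurable_F_M]

lemma AE_regular: "AE \<omega> in M. regular X T \<omega>"
proof -
  have "AE \<omega> in M. \<forall>t\<in>{..T}. 0 \<le> rate X t \<omega> \<and> Pbid X t \<omega> \<le> Pask X t \<omega>"
    using rate_nonneg price_spread by (intro AE_finite_allI) auto
  moreover have "AE \<omega> in M. \<forall>t\<in>{1..T}. increment (Aask X) t \<omega> \<le> increment (Abid X) t \<omega>"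
    using dividend_spread by (intro AE_finite_allI) auto
  ultimately show ?thesis by eventually_elim (auto simp: regular_def)
qed

lemma predictable_M: "predictable F T h \<Longrightarrow> t \<in> {1..T} \<Longrightarrow> h t \<in> borel_measurable M"
  using predictableD measurable_F_M[of "h t" "t - 1"] by fastforce

lemma gain_measurable:
  assumes h: "predictable F T h"
  shows "(\<lambda>\<omega>. gain X T \<omega> (\<lambda>t. h t \<omega>)) \<in> borel_measurable M"
proof -
  have [measurable]: "(\<lambda>\<omega>. next_position T (\<lambda>t. h t \<omega>) t) \<in> borel_measurable M" for t
  proof (cases "t < T")
    case True
    then show ?thesis using predictable_M[OF h, of "Suc t"] by (simp add: next_position_def)
  qed (simp add: next_position_def)
  show ?thesis
    unfolding gain_def
    using horizon
    by (intro borel_measurable_diff borel_measurable_sum borel_measurable_divide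
        borel_measurable_two_sided market_measurable predictable_M[OF h]) auto
qed

lemma price_bound_measurable: "price_bound X T \<in> borel_measurable M"
  unfolding price_bound_def
  by (intro borel_measurable_add borel_measurable_sum borel_measurable_divide
      borel_measurable_norm[THEN measurable_compose[rotated]] market_measurable) auto

end

section \<open>Risk-neutral measures\<close>

lemma telescope_from_1:
  fixes f :: "nat \<Rightarrow> real"
  assumes "\<And>t. t \<in> {1..<n} \<Longrightarrow> f (Suc t) - f t = d t" "1 \<le> n"
  shows "f n = f 1 + (\<Sum>t=1..<n. d t)"
proof -
  have "(\<Sum>t=1..<n. d t) = (\<Sum>t=1..<n. f (Suc t) - f t)"
    using assms(1) by (intro sum.cong) auto
  also have "\<dots> = f n - f 1"
    using assms(2) by (rule sum_Suc_diff')
  finally show ?thesis by simp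
qed

lemma borel_measurable_fst_snd:
  fixes f :: "'a \<Rightarrow> 'b::topological_space \<times> 'c::topological_space"
  assumes "f \<in> borel_measurable N"
  shows "(\<lambda>\<omega>. fst (f \<omega>)) \<in> borel_measurable N" "(\<lambda>\<omega>. snd (f \<omega>)) \<in> borel_measurable N"
  by (rule borel_measurable_continuous_on[OF _ assms]; intro continuous_intros)+

section \<open>Self-financing strategies and their security positions\<close>

context bid_ask_market
begin

lemma securities_predictable:
  assumes "\<phi> \<in> SF M F T X"
  shows "predictable F T (\<lambda>t \<omega>. snd (\<phi> t \<omega>))"
  using assms by (auto simp: SF_def trading_strategy_def predictable_def
      intro: borel_measurable_fst_snd)

lemma discounted_wealth_measurable:
  assumes "\<phi> \<in> SF M F T X"
  shows "discounted_wealth X \<phi> T \<in> borel_measurable M"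
proof -
  have T: "T \<in> {1..T}" using horizon by simp
  have "\<phi> T \<in> borel_measurable (F (T - 1))"
    using assms T by (auto simp: SF_def trading_strategy_def)
  then have [measurable]: "\<phi> T \<in> borel_measurable M" by (rule measurable_F_M) simp
  have [measurable]: "(\<lambda>\<omega>. fst (\<phi> T \<omega>)) \<in> borel_measurable M" "(\<lambda>\<omega>. snd (\<phi> T \<omega>)) \<in> borel_measurable M"
    by (intro borel_measurable_fst_snd; measurable)+
  note [measurable] = market_measurable[of T, OF order_refl order_refl]
  show ?thesis
    using horizon unfolding discounted_wealth_def wealth_def dividend_flow_def by simp
qed

text \<open>Self-financing determines every increment of the cash position, and zero initial wealth
  its starting value; the increments telescope. At \<open>T\<close>, selling \<open>h\<close> at the
  bid is the trade \<open>- h\<close> with opposite sign, by \<open>two_sided_minus\<close>.\<close>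

lemma discounted_wealth_eq_gain:
  assumes \<phi>: "\<phi> \<in> SF M F T X" and V0: "AE \<omega> in M. wealth X \<phi> 0 \<omega> = 0"
  shows "AE \<omega> in M. discounted_wealth X \<phi> T \<omega> = gain X T \<omega> (\<lambda>t. snd (\<phi> t \<omega>))"
proof -
  have "AE \<omega> in M. \<forall>t\<in>{1..T - 1}. savings X t \<omega> * fst (increment \<phi> (t + 1) \<omega>)
      + two_sided (snd (increment \<phi> (t + 1) \<omega>)) (Pask X t \<omega>) (Pbid X t \<omega>) = dividend_flow X \<phi> t \<omega>"
    using \<phi> by (intro AE_finite_allI) (auto simp: SF_def self_financing_def)
  then show ?thesis
    using V0 AE_regular
  proof eventually_elim
    case (elim \<omega>)
    let ?h = "\<lambda>t. snd (\<phi> t \<omega>)" and ?B = "\<lambda>t. savings X t \<omega>"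
    let ?d = "\<lambda>t. (dividend_flow X \<phi> t \<omega>
      - two_sided (next_position T ?h t - ?h t) (Pask X t \<omega>) (Pbid X t \<omega>)) / ?B t"
    have B: "?B t \<noteq> 0" if "t \<le> T" for t using savings_ge_1[OF elim(3) that] by auto
    have "fst (\<phi> T \<omega>) = fst (\<phi> 1 \<omega>) + (\<Sum>t=1..<T. ?d t)"
    proof (rule telescope_from_1[OF _ horizon])
      fix t assume t: "t \<in> {1..<T}"
      then have "t \<in> {1..T - 1}" by auto
      then have "?B t * (fst (\<phi> (Suc t) \<omega>) - fst (\<phi> t \<omega>))
          + two_sided (next_position T ?h t - ?h t) (Pask X t \<omega>) (Pbid X t \<omega>) = dividend_flow X \<phi> t \<omega>"
        using bspec[OF elim(1), of t] t by (simp add: increment_def next_position_def)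
      then show "fst (\<phi> (Suc t) \<omega>) - fst (\<phi> t \<omega>) = ?d t"
        using B[of t] t by (simp add: field_simps)
    qed
    moreover have "fst (\<phi> 1 \<omega>) = - two_sided (?h 1) (Pask X 0 \<omega>) (Pbid X 0 \<omega>)"
      using elim(2) by (simp add: wealth_def)
    moreover have "discounted_wealth X \<phi> T \<omega> = fst (\<phi> T \<omega>) + ?d T"
      using B[of T] horizon
      by (simp add: discounted_wealth_def wealth_def next_position_def two_sided_minus
          add_divide_distrib diff_divide_distrib)
    moreover have "(\<Sum>t=1..T. ?d t) = (\<Sum>t=1..<T. ?d t) + ?d T"
      using horizon by (simp add: sum.last_plus add.commute)
    ultimately show ?case unfolding gain_def dividend_flow_def by linarith
  qed
qed

text \<open>The budget equations are solved successively for cash. The sum defining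
  \<open>cash t\<close> stops before \<open>t\<close>, so it is known at
  \<open>t - 1\<close>.\<close>

lemma SF_if_predictable:
  assumes h: "predictable F T h"
  obtains \<phi> where "\<phi> \<in> SF M F T X" "\<And>\<omega>. wealth X \<phi> 0 \<omega> = 0"
    "\<And>t \<omega>. t \<in> {1..T} \<Longrightarrow> snd (\<phi> t \<omega>) = h t \<omega>"
proof -
  define d where "d t \<omega> = (two_sided (h t \<omega>) (increment (Aask X) t \<omega>) (increment (Abid X) t \<omega>)
      - two_sided (h (Suc t) \<omega> - h t \<omega>) (Pask X t \<omega>) (Pbid X t \<omega>)) / savings X t \<omega>" for t \<omega>
  define cash where "cash t \<omega> = - two_sided (h 1 \<omega>) (Pask X 0 \<omega>) (Pbid X 0 \<omega>) + (\<Sum>s=1..<t. d s \<omega>)" for t \<omega>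
  define \<phi> where "\<phi> t \<omega> = (if t = 0 then 0 else (cash t \<omega>, h t \<omega>))" for t \<omega>
  have d_meas: "d s \<in> borel_measurable (F (t - 1))" if "s \<in> {1..<t}" "t \<le> T" for s t
  proof -
    have le: "s - 1 \<le> t - 1" "s \<le> t - 1" and sT: "s \<in> {1..T}" "Suc s \<in> {1..T}" "s \<le> T" using that by auto
    have [measurable]: "h s \<in> borel_measurable (F (t - 1))" "h (Suc s) \<in> borel_measurable (F (t - 1))"
      using F_le[OF predictableD[OF h sT(1)] le(1)] F_le[OF predictableD[OF h sT(2)], of "t - 1"] le(2) by auto
    note [measurable] = adapted_measurable[of s, THEN F_le, OF sT(3) le(2)]
    show ?thesis unfolding d_def by measurable
  qed
  have cash_meas: "cash t \<in> borel_measurable (F (t - 1))" if "t \<in> {1..T}" for t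
  proof -
    have [measurable]: "h 1 \<in> borel_measurable (F (t - 1))"
      using F_le[OF predictableD[OF h, of 1], of "t - 1"] that by auto
    note [measurable] = adapted_measurable[of 0, THEN F_le, of "t - 1"]
    have [measurable]: "d s \<in> borel_measurable (F (t - 1))" if "s \<in> {1..<t}" for s
      using d_meas[OF that] \<open>t \<in> {1..T}\<close> by simp
    show ?thesis unfolding cash_def by measurable
  qed
  have "trading_strategy M F T \<phi>"
    unfolding trading_strategy_def
  proof (intro conjI ballI)
    fix t assume t: "t \<in> {1..T}"
    then have "\<phi> t = (\<lambda>\<omega>. (cash t \<omega>, h t \<omega>))" by (auto simp: \<phi>_def)
    then show "\<phi> t \<in> borel_measurable (F (t - 1))"
      using borel_measurable_Pair[OF cash_meas[OF t] predictableD[OF h t]] by simp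
  qed (simp add: \<phi>_def)
  moreover have "self_financing M T X \<phi>"
    unfolding self_financing_def
  proof
    fix t assume t: "t \<in> {1..T - 1}"
    show "AE \<omega> in M. savings X t \<omega> * fst (increment \<phi> (t + 1) \<omega>)
        + two_sided (snd (increment \<phi> (t + 1) \<omega>)) (Pask X t \<omega>) (Pbid X t \<omega>) = dividend_flow X \<phi> t \<omega>"
      using AE_regular
    proof eventually_elim
      case (elim \<omega>)
      have "t \<le> T" using t by auto
      then have "savings X t \<omega> \<noteq> 0" using savings_ge_1[OF elim, of t] by auto
      moreover have "fst (increment \<phi> (t + 1) \<omega>) = d t \<omega>"
        using t by (simp add: increment_def \<phi>_def cash_def)
      moreover have "snd (increment \<phi> (t + 1) \<omega>) = h (Suc t) \<omega> - h t \<omega>"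
        using t by (simp add: increment_def \<phi>_def)
      ultimately show ?case
        using t by (simp add: d_def dividend_flow_def \<phi>_def)
    qed
  qed
  ultimately show thesis
    by (intro that[of \<phi>]) (auto simp: SF_def wealth_def \<phi>_def cash_def)
qed

lemma wealth_eq_discounted_wealth:
  "AE \<omega> in M. wealth X \<phi> T \<omega> = savings X T \<omega> * discounted_wealth X \<phi> T \<omega> \<and> 1 \<le> savings X T \<omega>"
  using AE_regular
proof eventually_elim
  case (elim \<omega>)
  then show ?case using savings_ge_1[OF elim, of T] by (auto simp: discounted_wealth_def)
qed

text \<open>
  The prices at time 0 enter the gain undiscounted, whereas only the discounted ones are known to be
  \<open>Q\<close>-integrable. Scaling all positions by the \<open>F 0\<close>-measurable factor \<open>1 / B\<^sub>0\<close> repairs this.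
\<close>

lemma no_arbitrage_if_risk_neutral:
  assumes Q: "risk_neutral M F T X Q"
  shows "no_arbitrage M F T X"
  unfolding no_arbitrage_def
proof (intro ballI impI)
  fix \<phi> assume \<phi>: "\<phi> \<in> SF M F T X" and V0: "AE \<omega> in M. wealth X \<phi> 0 \<omega> = 0"
    and VT: "AE \<omega> in M. 0 \<le> wealth X \<phi> T \<omega>"
  have "prob_space Q" and sets_Q[measurable_cong]: "sets Q = sets M"
    and ac: "absolutely_continuous M Q" "absolutely_continuous Q M"
    and int: "\<And>t. t \<le> T \<Longrightarrow> integrable Q (\<lambda>\<omega>. Pask X t \<omega> /\<^sub>R savings X t \<omega>)"
      "\<And>t. t \<le> T \<Longrightarrow> integrable Q (\<lambda>\<omega>. Pbid X t \<omega> /\<^sub>R savings X t \<omega>)"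
      "\<And>t. t \<in> {1..T} \<Longrightarrow> integrable Q (\<lambda>\<omega>. increment (Aask X) t \<omega> /\<^sub>R savings X t \<omega>)"
      "\<And>t. t \<in> {1..T} \<Longrightarrow> integrable Q (\<lambda>\<omega>. increment (Abid X) t \<omega> /\<^sub>R savings X t \<omega>)"
    using Q by (auto simp: risk_neutral_def equivalent_integrable_measures_def)
  have space_Q: "space Q = space M" by (rule sets_eq_imp_space_eq[OF sets_Q])
  interpret Q: prob_space Q by fact
  note AE_Q = absolutely_continuous_AE[OF sets_Q ac(1)]
  note AE_M = absolutely_continuous_AE[OF sets_Q[symmetric] ac(2)]
  \<comment> \<open>The absolute value keeps \<open>a\<close> in (0, 1] everywhere; in regular
    scenarios it is \<open>1 / savings X 0\<close>.\<close>
  define a where "a \<omega> = 1 / (1 + \<bar>rate X 0 \<omega>\<bar>)" for \<omega>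
  have a: "0 < a \<omega>" "a \<omega> \<le> 1" for \<omega> by (simp_all add: a_def add_pos_nonneg field_simps)
  have [measurable]: "rate X 0 \<in> borel_measurable (F 0)" by (rule rate_adapted) simp
  have a_meas: "a \<in> borel_measurable (F 0)" unfolding a_def by measurable
  have a_M[measurable]: "a \<in> borel_measurable M" by (rule measurable_F_M[OF a_meas]) simp
  let ?N = "2 * real CARD('n)"
  define g where "g \<omega> x = a \<omega> * gain X T \<omega> x" for \<omega> x
  define L where "L \<omega> = ?N * (norm (Pask X 0 \<omega> /\<^sub>R savings X 0 \<omega>) + norm (Pbid X 0 \<omega> /\<^sub>R savings X 0 \<omega>)
    + (\<Sum>t=1..T. norm (Pask X t \<omega> /\<^sub>R savings X t \<omega>) + norm (Pbid X t \<omega> /\<^sub>R savings X t \<omega>)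
      + norm (increment (Aask X) t \<omega> /\<^sub>R savings X t \<omega>) + norm (increment (Abid X) t \<omega> /\<^sub>R savings X t \<omega>)))" for \<omega>
  have L: "integrable Q L" unfolding L_def
    by (intro integrable_mult_right Bochner_Integration.integrable_add Bochner_Integration.integrable_sum
        integrable_norm int) auto
  have L0: "0 \<le> L \<omega>" for \<omega> unfolding L_def by (intro mult_nonneg_nonneg add_nonneg_nonneg sum_nonneg) auto
  \<comment> \<open>The factor \<open>a\<close> discounts the time-0 prices exactly; the other terms
    are already discounted and only decrease, as \<open>a \<le> 1\<close>.\<close>
  have a_bound: "a \<omega> * ?N * price_bound X T \<omega> \<le> L \<omega>" if reg: "regular X T \<omega>" for \<omega>
  proof -
    have B: "0 < savings X t \<omega>" if "t \<le> T" for t using savings_ge_1[OF reg that] by simp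
    have a_eq: "a \<omega> = 1 / savings X 0 \<omega>" using reg by (simp add: a_def savings_def regular_def)
    let ?S = "\<Sum>t=1..T. (norm (Pask X t \<omega>) + norm (Pbid X t \<omega>)
      + norm (increment (Aask X) t \<omega>) + norm (increment (Abid X) t \<omega>)) / savings X t \<omega>"
    have "0 \<le> ?S" using B by (intro sum_nonneg divide_nonneg_nonneg add_nonneg_nonneg) (auto intro: less_imp_le)
    then have "a \<omega> * ?S \<le> ?S" using a by (intro mult_left_le_one_le) (auto intro: less_imp_le)
    moreover have "a \<omega> * (norm (Pask X 0 \<omega>) + norm (Pbid X 0 \<omega>))
        = norm (Pask X 0 \<omega> /\<^sub>R savings X 0 \<omega>) + norm (Pbid X 0 \<omega> /\<^sub>R savings X 0 \<omega>)"
      using B[of 0] by (simp add: a_eq field_simps)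
    moreover have "?S = (\<Sum>t=1..T. norm (Pask X t \<omega> /\<^sub>R savings X t \<omega>) + norm (Pbid X t \<omega> /\<^sub>R savings X t \<omega>)
      + norm (increment (Aask X) t \<omega> /\<^sub>R savings X t \<omega>) + norm (increment (Abid X) t \<omega> /\<^sub>R savings X t \<omega>))"
      using B by (intro sum.cong) (auto simp: add_divide_distrib divide_inverse_commute abs_of_pos less_imp_le distrib_left)
    ultimately have "a \<omega> * price_bound X T \<omega> \<le> norm (Pask X 0 \<omega> /\<^sub>R savings X 0 \<omega>) + norm (Pbid X 0 \<omega> /\<^sub>R savings X 0 \<omega>)
      + (\<Sum>t=1..T. norm (Pask X t \<omega> /\<^sub>R savings X t \<omega>) + norm (Pbid X t \<omega> /\<^sub>R savings X t \<omega>)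
      + norm (increment (Aask X) t \<omega> /\<^sub>R savings X t \<omega>) + norm (increment (Abid X) t \<omega> /\<^sub>R savings X t \<omega>))"
      unfolding price_bound_def distrib_left[of "a \<omega>" "norm (Pask X 0 \<omega>) + norm (Pbid X 0 \<omega>)"] by linarith
    then have "?N * (a \<omega> * price_bound X T \<omega>) \<le> L \<omega>"
      unfolding L_def by (intro mult_left_mono) auto
    then show ?thesis by (simp add: mult_ac)
  qed
  define h where "h t \<omega> = snd (\<phi> t \<omega>)" for t \<omega>
  have h: "predictable F T h" using securities_predictable[OF \<phi>] by (simp add: h_def[abs_def])
  have gain_\<phi>: "AE \<omega> in M. discounted_wealth X \<phi> T \<omega> = gain X T \<omega> (\<lambda>t. h t \<omega>)"
    using discounted_wealth_eq_gain[OF \<phi> V0] by (simp add: h_def)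
  have "AE \<omega> in Q. g \<omega> (\<lambda>t. h t \<omega>) = 0"
  proof (rule Q.nonneg_gain_eq_zero_if_bounded_gains_nonpos
      [where F = F and T = T and L = L and h = h])
    show "filtration (space Q) F" unfolding space_Q by unfold_locales
    show "sets (F t) \<subseteq> sets Q" if "t \<le> T" for t using sets_F_le[OF that] by (simp add: sets_Q)
    show "(\<lambda>\<omega>. g \<omega> (\<lambda>t. k t \<omega>)) \<in> borel_measurable Q" if "predictable F T k" for k
      using gain_measurable[OF that] unfolding g_def by measurable
    show "AE \<omega> in Q. \<forall>x y. \<bar>g \<omega> x - g \<omega> y\<bar> \<le> L \<omega> * (\<Sum>t=1..T. norm (x t - y t))"
    proof (rule AE_Q)
      show "AE \<omega> in M. \<forall>x y. \<bar>g \<omega> x - g \<omega> y\<bar> \<le> L \<omega> * (\<Sum>t=1..T. norm (x t - y t))"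
        using AE_regular
      proof eventually_elim
        case (elim \<omega>)
        show ?case
        proof (intro allI)
          fix x y :: "nat \<Rightarrow> real ^ 'n"
          have "\<bar>g \<omega> x - g \<omega> y\<bar> = a \<omega> * \<bar>gain X T \<omega> x - gain X T \<omega> y\<bar>"
            using a[of \<omega>] by (simp add: g_def abs_mult flip: right_diff_distrib)
          also have "\<dots> \<le> a \<omega> * (?N * price_bound X T \<omega> * (\<Sum>t=1..T. norm (x t - y t)))"
            using a(1)[of \<omega>] by (intro mult_left_mono gain_Lipschitz[OF elim horizon]) simp
          also have "\<dots> = a \<omega> * ?N * price_bound X T \<omega> * (\<Sum>t=1..T. norm (x t - y t))"
            by (simp add: mult_ac)
          also have "\<dots> \<le> L \<omega> * (\<Sum>t=1..T. norm (x t - y t))"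
            by (intro mult_right_mono a_bound[OF elim] sum_nonneg) simp
          finally show "\<bar>g \<omega> x - g \<omega> y\<bar> \<le> L \<omega> * (\<Sum>t=1..T. norm (x t - y t))" .
        qed
      qed
    qed
    have "gain X T \<omega> (\<lambda>t. 0) = 0" for \<omega>
      using gain_scaleR[of 0 X T \<omega> "\<lambda>t. 0"] by simp
    then show "AE \<omega> in Q. g \<omega> (\<lambda>t. 0) = 0" by (simp add: g_def)
    show "predictable F T h" "integrable Q L" "\<And>\<omega>. 0 \<le> L \<omega>" by (rule h L L0)+
    show "AE \<omega> in Q. 0 \<le> g \<omega> (\<lambda>t. h t \<omega>)"
    proof (rule AE_Q)
      show "AE \<omega> in M. 0 \<le> g \<omega> (\<lambda>t. h t \<omega>)"
        using VT gain_\<phi> wealth_eq_discounted_wealth[of \<phi>]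
      proof eventually_elim
        case (elim \<omega>)
        then have "0 \<le> discounted_wealth X \<phi> T \<omega>" by (auto simp: zero_le_mult_iff)
        then show ?case using elim(2) a(1)[of \<omega>] by (simp add: g_def)
      qed
    qed
    fix k :: "nat \<Rightarrow> 'a \<Rightarrow> real ^ 'n" and C
    assume k: "predictable F T k" and C: "\<And>t \<omega>. t \<in> {1..T} \<Longrightarrow> \<omega> \<in> space Q \<Longrightarrow> norm (k t \<omega>) \<le> C"
    \<comment> \<open>By positive homogeneity the factor \<open>a\<close> moves inside the gain. It
      is known at time 0 and at most 1, so the scaled strategy is predictable, bounded, and subject
      to the risk-neutral inequality.\<close>
    define k' where "k' t \<omega> = a \<omega> *\<^sub>R k t \<omega>" for t \<omega>
    have k': "predictable F T k'"
      unfolding predictable_def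
    proof
      fix t assume t: "t \<in> {1..T}"
      note [measurable] = F_le[OF a_meas, of "t - 1"] predictableD[OF k t]
      show "k' t \<in> borel_measurable (F (t - 1))" unfolding k'_def by measurable
    qed
    obtain \<psi> where \<psi>: "\<psi> \<in> SF M F T X" "\<And>\<omega>. wealth X \<psi> 0 \<omega> = 0"
        "\<And>t \<omega>. t \<in> {1..T} \<Longrightarrow> snd (\<psi> t \<omega>) = k' t \<omega>"
      by (rule SF_if_predictable[OF k']) (rule that)
    have "\<exists>C. \<forall>t\<in>{1..T}. AE \<omega> in M. \<bar>snd (\<psi> t \<omega>) $ j\<bar> \<le> C" for j
    proof (intro exI[of _ C] ballI AE_I2)
      fix t \<omega> assume t: "t \<in> {1..T}" and \<omega>: "\<omega> \<in> space M"
      have "\<bar>snd (\<psi> t \<omega>) $ j\<bar> \<le> norm (k' t \<omega>)"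
        unfolding \<psi>(3)[OF t] by (rule component_le_norm_cart)
      also have "\<dots> \<le> norm (k t \<omega>)"
        using a[of \<omega>] by (simp add: k'_def mult_left_le_one_le)
      also have "\<dots> \<le> C" using C[OF t] \<omega> by (simp add: space_Q)
      finally show "\<bar>snd (\<psi> t \<omega>) $ j\<bar> \<le> C" .
    qed
    then have \<psi>_nonpos: "integrable Q (discounted_wealth X \<psi> T)" "(\<integral>\<omega>. discounted_wealth X \<psi> T \<omega> \<partial>Q) \<le> 0"
      using Q \<psi>(1,2) by (auto simp: risk_neutral_def)
    have "AE \<omega> in M. wealth X \<psi> 0 \<omega> = 0" using \<psi>(2) by simp
    from discounted_wealth_eq_gain[OF \<psi>(1) this]
    have "AE \<omega> in M. g \<omega> (\<lambda>t. k t \<omega>) = discounted_wealth X \<psi> T \<omega>"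
    proof eventually_elim
      case (elim \<omega>)
      have "g \<omega> (\<lambda>t. k t \<omega>) = gain X T \<omega> (\<lambda>t. k' t \<omega>)"
        unfolding g_def k'_def using a(1)[of \<omega>] by (simp add: gain_scaleR)
      also have "\<dots> = gain X T \<omega> (\<lambda>t. snd (\<psi> t \<omega>))"
        using \<psi>(3) horizon by (auto simp: gain_def next_position_def intro!: sum.cong)
      finally show ?case using elim by simp
    qed
    from AE_Q[OF this] have "(\<integral>\<omega>. g \<omega> (\<lambda>t. k t \<omega>) \<partial>Q) = (\<integral>\<omega>. discounted_wealth X \<psi> T \<omega> \<partial>Q)"
      using gain_measurable[OF k] discounted_wealth_measurable[OF \<psi>(1)]
      by (intro integral_cong_AE) (auto simp: g_def)
    then show "(\<integral>\<omega>. g \<omega> (\<lambda>t. k t \<omega>) \<partial>Q) \<le> 0" using \<psi>_nonpos(2) by simp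
  qed
  from AE_M[OF this] show "AE \<omega> in M. wealth X \<phi> T \<omega> = 0"
    using gain_\<phi> wealth_eq_discounted_wealth[of \<phi>]
  proof eventually_elim
    case (elim \<omega>)
    then show ?case using a(1)[of \<omega>] by (simp add: g_def)
  qed
qed

section \<open>Construction of the bounded density\<close>

text \<open>The density is \<open>w * Z\<close> up to normalisation. The weight \<open>w\<close>
  first makes the gain 1-Lipschitz; as a factor of the density it then undoes this scaling, since
  integrating \<open>w * Z\<close> against the true gain is integrating \<open>Z\<close> against the
  scaled one.\<close>

lemma risk_neutral_if_NAEF:
  assumes NA: "no_arbitrage M F T X" and EF: "efficient_friction M F T X"
  shows "\<exists>Q. risk_neutral M F T X Q \<and> bounded_density M Q"
proof -
  let ?N = "2 * real CARD('n)"
  have "0 < CARD('n)" by simp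
  then have N_ge: "1 \<le> ?N" by linarith
  note [measurable] = price_bound_measurable market_measurable
  have price_bound_nonneg: "0 \<le> price_bound X T \<omega>" if reg: "regular X T \<omega>" for \<omega>
  proof -
    have "0 \<le> savings X t \<omega>" if "t \<le> T" for t using savings_ge_1[OF reg that] by simp
    then show ?thesis unfolding price_bound_def
      by (intro add_nonneg_nonneg sum_nonneg divide_nonneg_nonneg) auto
  qed
  have regular_meas[measurable]: "Measurable.pred M (regular X T)"
  proof -
    have [measurable]: "rate X t \<in> borel_measurable M" if "t \<le> T" for t
      using measurable_F_M[OF rate_adapted[OF that] that] .
    have [measurable]: "(\<lambda>\<omega>. Pask X t \<omega> $ j) \<in> borel_measurable M" "(\<lambda>\<omega>. Pbid X t \<omega> $ j) \<in> borel_measurable M"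
        "(\<lambda>\<omega>. increment (Aask X) t \<omega> $ j) \<in> borel_measurable M" "(\<lambda>\<omega>. increment (Abid X) t \<omega> $ j) \<in> borel_measurable M"
      if "t \<le> T" for t j
      by (rule borel_measurable_continuous_on[OF linear_continuous_on[OF bounded_linear_vec_nth]];
          rule market_measurable[OF that that])+
    show ?thesis
      unfolding regular_def less_eq_vec_def by measurable
  qed
  \<comment> \<open>The summand 1 avoids division by 0 and gives \<open>w \<le> 1\<close>. The value
    0 in irregular scenarios makes the axioms of \<open>superlinear_gain\<close> hold there
    trivially.\<close>
  define w where "w \<omega> = (if regular X T \<omega> then 1 / (1 + ?N * price_bound X T \<omega>) else 0)" for \<omega>
  have w_meas[measurable]: "w \<in> borel_measurable M" unfolding w_def by measurable
  have w_pos: "0 < w \<omega>" if "regular X T \<omega>" for \<omega>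
    using that price_bound_nonneg[OF that] by (simp add: w_def add_pos_nonneg)
  have w_nonneg: "0 \<le> w \<omega>" for \<omega> using w_pos[of \<omega>] by (cases "regular X T \<omega>") (auto simp: w_def)
  have w_bound: "w \<omega> * (?N * price_bound X T \<omega>) \<le> 1" "w \<omega> \<le> 1" for \<omega>
    using price_bound_nonneg[of \<omega>] by (auto simp: w_def field_simps add_pos_nonneg)
  define g where "g \<omega> x = w \<omega> * gain X T \<omega> x" for \<omega> x
  interpret superlinear: superlinear_gain M F T g
  proof unfold_locales
    show "sets (F t) \<subseteq> sets M" if "t \<le> T" for t by (rule sets_F_le[OF that])
    show "(\<lambda>\<omega>. g \<omega> (\<lambda>t. h t \<omega>)) \<in> borel_measurable M" if "predictable F T h" for h
      using gain_measurable[OF that] unfolding g_def by measurable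
    show "g \<omega> (\<lambda>t. a *\<^sub>R x t) = a * g \<omega> x" if "0 \<le> a" for \<omega> a x
      using gain_scaleR[OF that, of X T \<omega> x] by (simp add: g_def)
    show "g \<omega> x + g \<omega> y \<le> g \<omega> (\<lambda>t. x t + y t)" for \<omega> x y
    proof (cases "regular X T \<omega>")
      case True
      then show ?thesis
        unfolding g_def distrib_left[symmetric]
        by (intro mult_left_mono gain_superadditive w_nonneg)
    qed (simp add: g_def w_def)
    show "\<bar>g \<omega> x - g \<omega> y\<bar> \<le> (\<Sum>t=1..T. norm (x t - y t))" for \<omega> x y
    proof (cases "regular X T \<omega>")
      case True
      have "\<bar>g \<omega> x - g \<omega> y\<bar> = w \<omega> * \<bar>gain X T \<omega> x - gain X T \<omega> y\<bar>"
        using w_nonneg[of \<omega>] by (simp add: g_def abs_mult flip: right_diff_distrib)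
      also have "\<dots> \<le> w \<omega> * (?N * price_bound X T \<omega> * (\<Sum>t=1..T. norm (x t - y t)))"
        by (intro mult_left_mono gain_Lipschitz[OF True horizon] w_nonneg)
      also have "\<dots> = w \<omega> * (?N * price_bound X T \<omega>) * (\<Sum>t=1..T. norm (x t - y t))"
        by (simp add: mult_ac)
      also have "\<dots> \<le> 1 * (\<Sum>t=1..T. norm (x t - y t))"
        by (intro mult_right_mono w_bound sum_nonneg) simp
      finally show ?thesis by simp
    qed (simp add: g_def w_def sum_nonneg)
    \<comment> \<open>No arbitrage turns nonnegative terminal wealth into zero wealth, and efficient
      friction then forces the positions to vanish.\<close>
    fix h t assume h: "predictable F T h" and nonneg: "AE \<omega> in M. 0 \<le> g \<omega> (\<lambda>t. h t \<omega>)" and t: "t \<in> {1..T}"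
    obtain \<phi> where \<phi>: "\<phi> \<in> SF M F T X" "\<And>\<omega>. wealth X \<phi> 0 \<omega> = 0"
        "\<And>t \<omega>. t \<in> {1..T} \<Longrightarrow> snd (\<phi> t \<omega>) = h t \<omega>"
      by (rule SF_if_predictable[OF h]) (rule that)
    have V0: "AE \<omega> in M. wealth X \<phi> 0 \<omega> = 0" using \<phi>(2) by simp
    have "AE \<omega> in M. 0 \<le> wealth X \<phi> T \<omega>"
      using nonneg discounted_wealth_eq_gain[OF \<phi>(1) V0] wealth_eq_discounted_wealth[of \<phi>] AE_regular
    proof eventually_elim
      case (elim \<omega>)
      have "gain X T \<omega> (\<lambda>t. snd (\<phi> t \<omega>)) = gain X T \<omega> (\<lambda>t. h t \<omega>)"
        using \<phi>(3) horizon by (auto simp: gain_def next_position_def intro!: sum.cong)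
      then have "0 \<le> discounted_wealth X \<phi> T \<omega>"
        using elim w_pos[OF elim(4)] by (simp add: g_def zero_le_mult_iff)
      then show ?case using elim(3) by simp
    qed
    then have "AE \<omega> in M. wealth X \<phi> T \<omega> = 0"
      using NA \<phi>(1) V0 by (auto simp: no_arbitrage_def)
    then have "AE \<omega> in M. \<phi> t \<omega> = 0"
      using EF \<phi>(1) V0 t by (auto simp: efficient_friction_def)
    then show "AE \<omega> in M. h t \<omega> = 0"
      by eventually_elim (use \<phi>(3)[OF t] in \<open>metis snd_zero\<close>)
  qed
  obtain Z where Z_meas[measurable]: "Z \<in> borel_measurable M" and Z: "\<And>\<omega>. 0 < Z \<omega>" "\<And>\<omega>. Z \<omega> < (2 :: real)"
    and Z_nonpos: "\<And>h C. predictable F T h \<Longrightarrow> \<forall>t\<in>{1..T}. AE \<omega> in M. norm (h t \<omega>) \<le> C \<Longrightarrow>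
      (\<integral>\<omega>. Z \<omega> * g \<omega> (\<lambda>t. h t \<omega>) \<partial>M) \<le> 0"
    by (rule superlinear.separating_density) (rule that)
  have int_wZ: "integrable M (\<lambda>\<omega>. w \<omega> * Z \<omega>)"
  proof (rule integrable_const_bound[where B = "1 * 2"])
    show "AE \<omega> in M. norm (w \<omega> * Z \<omega>) \<le> 1 * 2"
    proof (rule AE_I2)
      fix \<omega>
      show "norm (w \<omega> * Z \<omega>) \<le> 1 * 2"
        unfolding norm_mult using w_bound(2)[of \<omega>] w_nonneg[of \<omega>] Z[of \<omega>]
        by (intro mult_mono) auto
    qed
  qed measurable
  have wZ_nonneg: "0 \<le> w \<omega> * Z \<omega>" for \<omega> using w_nonneg Z(1)[of \<omega>] by simp
  define c where "c = (\<integral>\<omega>. w \<omega> * Z \<omega> \<partial>M)"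
  have "c \<noteq> 0"
  proof
    assume "c = 0"
    then have "AE \<omega> in M. w \<omega> * Z \<omega> = 0"
      using integral_nonneg_eq_0_iff_AE[OF int_wZ] wZ_nonneg by (simp add: c_def)
    with AE_regular have "AE \<omega> in M. False"
    proof eventually_elim
      case (elim \<omega>)
      then show ?case using w_pos[of \<omega>] Z(1)[of \<omega>] by simp
    qed
    then show False by simp
  qed
  moreover have "0 \<le> c" unfolding c_def by (intro integral_nonneg_AE AE_I2 wZ_nonneg)
  ultimately have c: "0 < c" by simp
  define f where "f \<omega> = w \<omega> * Z \<omega> / c" for \<omega>
  have f_meas[measurable]: "f \<in> borel_measurable M" unfolding f_def by measurable
  have f_nonneg: "0 \<le> f \<omega>" for \<omega> using wZ_nonneg c by (simp add: f_def)
  have f_pos: "AE \<omega> in M. 0 < f \<omega>"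
    using AE_regular by eventually_elim (use w_pos Z(1) c in \<open>simp add: f_def\<close>)
  define Q where "Q = density M (\<lambda>\<omega>. ennreal (f \<omega>))"
  have sets_Q: "sets Q = sets M" by (simp add: Q_def)
  have "emeasure Q (space Q) = 1"
  proof -
    have "emeasure Q (space Q) = (\<integral>\<^sup>+\<omega>. ennreal (f \<omega>) \<partial>M)"
      by (auto simp: Q_def emeasure_density intro!: nn_integral_cong)
    also have "\<dots> = ennreal (\<integral>\<omega>. f \<omega> \<partial>M)"
      using int_wZ f_nonneg by (intro nn_integral_eq_integral) (auto simp: f_def)
    also have "(\<integral>\<omega>. f \<omega> \<partial>M) = 1" using c by (simp add: f_def c_def)
    finally show ?thesis by simp
  qed
  then have prob_Q: "prob_space Q" by (rule prob_spaceI)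
  have ac_Q: "absolutely_continuous M Q"
    unfolding Q_def by (intro absolutely_continuousI_density) measurable
  have Q_ac: "absolutely_continuous Q M"
    unfolding absolutely_continuous_def
  proof
    fix A assume "A \<in> null_sets Q"
    then have A: "A \<in> sets M" "AE \<omega> in M. \<omega> \<in> A \<longrightarrow> ennreal (f \<omega>) = 0"
      by (auto simp: Q_def null_sets_density_iff)
    have "AE \<omega> in M. \<omega> \<notin> A" using A(2) f_pos by eventually_elim auto
    then show "A \<in> null_sets M" using A(1) by (simp add: AE_iff_null_sets)
  qed
  \<comment> \<open>The density is at most \<open>2 * w / c\<close>, so a bound on
    \<open>w * norm Y\<close> suffices. It applies both to prices and to the wealth of bounded
    strategies.\<close>
  have int_Q: "integrable Q Y" if Y[measurable]: "Y \<in> borel_measurable M"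
    and bound: "AE \<omega> in M. w \<omega> * norm (Y \<omega>) \<le> K" for Y :: "'a \<Rightarrow> 'b::{banach, second_countable_topology}" and K
  proof -
    have "integrable M (\<lambda>\<omega>. f \<omega> *\<^sub>R Y \<omega>)"
    proof (rule integrable_const_bound[where B = "2 * K / c"])
      show "AE \<omega> in M. norm (f \<omega> *\<^sub>R Y \<omega>) \<le> 2 * K / c"
        using bound
      proof eventually_elim
        case (elim \<omega>)
        have "norm (f \<omega> *\<^sub>R Y \<omega>) = Z \<omega> * (w \<omega> * norm (Y \<omega>)) / c"
          unfolding norm_scaleR real_norm_def abs_of_nonneg[OF f_nonneg] by (simp add: f_def mult_ac)
        also have "\<dots> \<le> 2 * K / c"
          using elim Z[of \<omega>] w_nonneg[of \<omega>] c by (intro divide_right_mono mult_mono) auto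
        finally show ?case .
      qed
    qed measurable
    then show ?thesis
      unfolding Q_def using f_nonneg by (subst integrable_density) auto
  qed
  have int_price: "integrable Q (\<lambda>\<omega>. Y \<omega> /\<^sub>R savings X t \<omega>)"
    if Y: "Y \<in> borel_measurable M" and t: "t \<le> T"
      and bound: "\<And>\<omega>. regular X T \<omega> \<Longrightarrow> norm (Y \<omega>) / savings X t \<omega> \<le> price_bound X T \<omega>"
    for Y :: "'a \<Rightarrow> real ^ 'n" and t
  proof (rule int_Q)
    note [measurable] = Y market_measurable(1)[OF t t]
    show "(\<lambda>\<omega>. Y \<omega> /\<^sub>R savings X t \<omega>) \<in> borel_measurable M" by measurable
    show "AE \<omega> in M. w \<omega> * norm (Y \<omega> /\<^sub>R savings X t \<omega>) \<le> 1"
      using AE_regular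
    proof eventually_elim
      case (elim \<omega>)
      have "norm (Y \<omega> /\<^sub>R savings X t \<omega>) = norm (Y \<omega>) / savings X t \<omega>"
        using savings_ge_1[OF elim t] by (simp add: divide_inverse_commute)
      also have "\<dots> \<le> 1 * price_bound X T \<omega>" using bound[OF elim] by simp
      also have "\<dots> \<le> ?N * price_bound X T \<omega>"
        using price_bound_nonneg[OF elim] N_ge by (intro mult_right_mono) auto
      finally have "w \<omega> * norm (Y \<omega> /\<^sub>R savings X t \<omega>) \<le> w \<omega> * (?N * price_bound X T \<omega>)"
        by (intro mult_left_mono w_nonneg)
      then show ?case using w_bound(1)[of \<omega>] by linarith
    qed
  qed
  \<comment> \<open>\<open>price_bound\<close> contains the time-0 prices undiscounted; dividing
    them by \<open>savings X 0 \<ge> 1\<close> only decreases them.\<close>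
  have bound_0: "norm (Pask X 0 \<omega>) / savings X 0 \<omega> \<le> price_bound X T \<omega>"
      "norm (Pbid X 0 \<omega>) / savings X 0 \<omega> \<le> price_bound X T \<omega>"
    and bound_t: "t \<in> {1..T} \<Longrightarrow> (norm (Pask X t \<omega>) + norm (Pbid X t \<omega>)
      + norm (increment (Aask X) t \<omega>) + norm (increment (Abid X) t \<omega>)) / savings X t \<omega> \<le> price_bound X T \<omega>"
    if reg: "regular X T \<omega>" for \<omega> t
  proof -
    have B: "1 \<le> savings X t \<omega>" if "t \<le> T" for t by (rule savings_ge_1[OF reg that])
    let ?s = "\<lambda>t. (norm (Pask X t \<omega>) + norm (Pbid X t \<omega>)
      + norm (increment (Aask X) t \<omega>) + norm (increment (Abid X) t \<omega>)) / savings X t \<omega>"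
    have s: "0 \<le> ?s t" if "t \<in> {1..T}" for t using B[of t] that by simp
    have le: "norm (v :: real ^ 'n) / savings X 0 \<omega> \<le> norm v" for v
      using B[of 0] by (simp add: field_simps mult_right_le_one_le mult_le_cancel_left1)
    have S: "0 \<le> (\<Sum>t=1..T. ?s t)" by (intro sum_nonneg s)
    show "norm (Pask X 0 \<omega>) / savings X 0 \<omega> \<le> price_bound X T \<omega>"
      using le[of "Pask X 0 \<omega>"] S norm_ge_zero[of "Pbid X 0 \<omega>"] unfolding price_bound_def by linarith
    show "norm (Pbid X 0 \<omega>) / savings X 0 \<omega> \<le> price_bound X T \<omega>"
      using le[of "Pbid X 0 \<omega>"] S norm_ge_zero[of "Pask X 0 \<omega>"] unfolding price_bound_def by linarith
    assume "t \<in> {1..T}"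
    then have "?s t \<le> (\<Sum>t=1..T. ?s t)" by (intro member_le_sum s) auto
    then show "?s t \<le> price_bound X T \<omega>"
      using norm_ge_zero[of "Pbid X 0 \<omega>"] norm_ge_zero[of "Pask X 0 \<omega>"] unfolding price_bound_def by linarith
  qed
  have bound: "norm v / savings X t \<omega> \<le> price_bound X T \<omega>"
    if reg: "regular X T \<omega>" and t: "t \<in> {1..T}"
      and v: "v \<in> {Pask X t \<omega>, Pbid X t \<omega>, increment (Aask X) t \<omega>, increment (Abid X) t \<omega>}" for \<omega> t v
  proof -
    have "norm v / savings X t \<omega> \<le> (norm (Pask X t \<omega>) + norm (Pbid X t \<omega>)
      + norm (increment (Aask X) t \<omega>) + norm (increment (Abid X) t \<omega>)) / savings X t \<omega>"
      using v savings_ge_1[OF reg, of t] t by (intro divide_right_mono) auto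
    also have "\<dots> \<le> price_bound X T \<omega>" by (rule bound_t[OF reg t])
    finally show ?thesis .
  qed
  have "Q \<in> equivalent_integrable_measures M T X"
    unfolding equivalent_integrable_measures_def
  proof (intro CollectI conjI allI ballI impI)
    fix t assume t: "t \<le> T"
    show "integrable Q (\<lambda>\<omega>. Pask X t \<omega> /\<^sub>R savings X t \<omega>)" "integrable Q (\<lambda>\<omega>. Pbid X t \<omega> /\<^sub>R savings X t \<omega>)"
      using bound_0 bound[of _ t] t
      by (cases "t = 0"; intro int_price market_measurable[OF t t] t; force)+
  next
    fix t assume t: "t \<in> {1..T}"
    then have tT: "t \<le> T" by simp
    show "integrable Q (\<lambda>\<omega>. increment (Aask X) t \<omega> /\<^sub>R savings X t \<omega>)"
        "integrable Q (\<lambda>\<omega>. increment (Abid X) t \<omega> /\<^sub>R savings X t \<omega>)"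
      using bound[OF _ t] by (intro int_price market_measurable[OF tT tT] tT; force)+
  qed (fact prob_Q sets_Q ac_Q Q_ac)+
  moreover have "integrable Q (discounted_wealth X \<phi> T) \<and> (\<integral>\<omega>. discounted_wealth X \<phi> T \<omega> \<partial>Q) \<le> 0"
    if \<phi>: "\<phi> \<in> SF M F T X" and V0: "AE \<omega> in M. wealth X \<phi> 0 \<omega> = 0"
      and bdd: "\<forall>j. \<exists>C. \<forall>t\<in>{1..T}. AE \<omega> in M. \<bar>snd (\<phi> t \<omega>) $ j\<bar> \<le> C" for \<phi>
  proof -
    define h where "h t \<omega> = snd (\<phi> t \<omega>)" for t \<omega>
    have h: "predictable F T h" using securities_predictable[OF \<phi>] by (simp add: h_def[abs_def])
    obtain C where C: "\<And>j t. t \<in> {1..T} \<Longrightarrow> AE \<omega> in M. \<bar>h t \<omega> $ j\<bar> \<le> C j"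
      using bdd unfolding h_def by metis
    have h_bdd: "AE \<omega> in M. norm (h t \<omega>) \<le> (\<Sum>j\<in>UNIV. C j)" if "t \<in> {1..T}" for t
    proof -
      have "AE \<omega> in M. \<forall>j\<in>UNIV. \<bar>h t \<omega> $ j\<bar> \<le> C j"
        using C[OF that] by (intro AE_finite_allI) auto
      then show ?thesis
      proof eventually_elim
        case (elim \<omega>)
        show ?case
          by (rule order_trans[OF norm_le_l1_cart]) (intro sum_mono, use elim in auto)
      qed
    qed
    have wealth_eq: "AE \<omega> in M. w \<omega> * discounted_wealth X \<phi> T \<omega> = g \<omega> (\<lambda>t. h t \<omega>)"
      using discounted_wealth_eq_gain[OF \<phi> V0] by eventually_elim (simp add: g_def h_def)
    note [measurable] = discounted_wealth_measurable[OF \<phi>]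
    have "AE \<omega> in M. \<forall>t\<in>{1..T}. norm (h t \<omega>) \<le> (\<Sum>j\<in>UNIV. C j)"
      using h_bdd by (intro AE_finite_allI) auto
    then have "AE \<omega> in M. w \<omega> * norm (discounted_wealth X \<phi> T \<omega>) \<le> real T * (\<Sum>j\<in>UNIV. C j)"
      using wealth_eq AE_space
    proof eventually_elim
      case (elim \<omega>)
      have "w \<omega> * norm (discounted_wealth X \<phi> T \<omega>) = \<bar>g \<omega> (\<lambda>t. h t \<omega>) - g \<omega> (\<lambda>t. 0)\<bar>"
        using w_nonneg[of \<omega>] superlinear.gain_zero[OF elim(3)] by (simp add: abs_mult flip: elim(2))
      also have "\<dots> \<le> (\<Sum>t=1..T. norm (h t \<omega> - 0))" by (rule superlinear.gain_Lipschitz[OF elim(3)])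
      also have "\<dots> \<le> (\<Sum>t=1..T. \<Sum>j\<in>UNIV. C j)" using elim(1) by (intro sum_mono) auto
      finally show ?case by simp
    qed
    then have "integrable Q (discounted_wealth X \<phi> T)"
      by (intro int_Q) measurable
    moreover have "(\<integral>\<omega>. discounted_wealth X \<phi> T \<omega> \<partial>Q) \<le> 0"
    proof -
      have "(\<integral>\<omega>. discounted_wealth X \<phi> T \<omega> \<partial>Q) = (\<integral>\<omega>. f \<omega> * discounted_wealth X \<phi> T \<omega> \<partial>M)"
        unfolding Q_def using f_nonneg by (subst integral_density) auto
      also have "\<dots> = (\<integral>\<omega>. Z \<omega> * g \<omega> (\<lambda>t. h t \<omega>) / c \<partial>M)"
      proof (rule integral_cong_AE)
        show "AE \<omega> in M. f \<omega> * discounted_wealth X \<phi> T \<omega> = Z \<omega> * g \<omega> (\<lambda>t. h t \<omega>) / c"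
          using wealth_eq by eventually_elim (simp add: f_def mult_ac)
      qed (intro borel_measurable_divide borel_measurable_times superlinear.gain_measurable[OF h]
          borel_measurable_const Z_meas f_meas discounted_wealth_measurable[OF \<phi>])+
      also have "\<dots> = (\<integral>\<omega>. Z \<omega> * g \<omega> (\<lambda>t. h t \<omega>) \<partial>M) / c" by simp
      also have "\<dots> \<le> 0"
        using Z_nonpos[OF h ballI[OF h_bdd]] c by (simp add: divide_nonpos_pos)
      finally show ?thesis .
    qed
    ultimately show ?thesis ..
  qed
  ultimately have "risk_neutral M F T X Q"
    by (auto simp: risk_neutral_def)
  moreover have "bounded_density M Q"
    unfolding bounded_density_def
  proof
    have "AE \<omega> in M. ennreal (f \<omega>) = RN_deriv M Q \<omega>"
      by (rule RN_deriv_unique) (auto simp: Q_def)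
    then show "AE \<omega> in M. RN_deriv M Q \<omega> \<le> ennreal (2 / c)"
    proof eventually_elim
      case (elim \<omega>)
      have "w \<omega> * Z \<omega> \<le> 1 * 2" using w_bound(2)[of \<omega>] w_nonneg[of \<omega>] Z[of \<omega>] by (intro mult_mono) auto
      then have "f \<omega> \<le> 2 / c" using c by (simp add: f_def divide_right_mono)
      then show ?case by (simp add: ennreal_leI flip: elim)
    qed
  qed
  ultimately show ?thesis by blast
qed

end

theorem theorem3p5:
  fixes M :: "'a measure" and F :: "nat \<Rightarrow> 'a measure" and T :: nat
    and X :: "('a, 'n::finite) market"
  assumes "bid_ask_market M F T X"
    and "efficient_friction M F T X"
  shows "(NAEF M F T X \<longleftrightarrow> (\<exists>Q. risk_neutral M F T X Q)) \<and>
    ((\<exists>Q. risk_neutral M F T X Q) \<longleftrightarrow> (\<exists>Q. risk_neutral M F T X Q \<and> bounded_density M Q))"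
proof -
  interpret bid_ask_market M F T X by (rule assms(1))
  have "NAEF M F T X \<longleftrightarrow> no_arbitrage M F T X" using assms(2) by (simp add: NAEF_def)
  then show ?thesis
    using no_arbitrage_if_risk_neutral risk_neutral_if_NAEF[OF _ assms(2)] by blast
qed

end
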